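(* Let $V(z)=a_mz^m+\dots\in\mathbb{Z}[z]$ be irreducible, of degree $m\ge1$, and let $0<r\le 1/|a_m|$. Let $L=\{z\in\mathbb{C}:|V(z)|=r\}$ and let $\mu$ be the measure on $L$ given by $d\mu(z)=\frac{|V'(z)|}{2\pi m r}|dz|$. For a polynomial $P$ define $\|P\|_p=\left(\int|P|^p\,d\mu\right)^{1/p}$ for $0<p<\infty$, $\|P\|_\infty=\max_{z\in L}|P(z)|$, and $M_L(P)=\exp\left(\int\log|P|\,d\mu\right)$. Then for every $k\in\mathbb{N}$, $$\inf\{\|P\|_p: P\in\mathbb{Z}[z],\ P\not\equiv 0,\ \deg P\le km\}=r^k\quad\text{for all }0<p\le\infty,$$ and $$\inf\{M_L(P): P\in\mathbb{Z}[z],\ P\not\equiv0,\ \deg P\le km\}=r^k.$$ Moreover, for $P\in\mathbb{Z}[z]$, $P\not\equiv 0$, $\deg P\le km$: (i) if $r<1/|a_m|$, then $\|P\|_p=r^k$ (for some $0<p\le\infty$) or $M_L(P)=r^k$ holds if and only if $P=\pm V^k$; (ii) if $r=1/|a_m|<1$, then for $0<p\le\infty$, $\|P\|_p=r^k$ if and only if $P=\pm V^k$; (iii) if $|a_m|=r=1$, then for $0<p\le\infty$, $\|P\|_p=r^k$ if and only if $P=\pm V^k$ or $P=\pm1$.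
   Context: The measure $\mu$ is the equilibrium measure of the lemniscate $L$; it is a positive unit measure supported on $L$. $M_L(P)$ is the generalized Mahler measure (geometric mean of $|P|$ with respect to $\mu$). $\mathbb{N}=\{1,2,\dots\}$.
   Formalization: In (iii) the formal theorem lists P = ±V^j for some 1 ≤ j ≤ k, or P = ±1, instead of only P = ±V^k or ±1; as written (iii) fails for k ≥ 2, e.g. V = z, r = 1, k = 2, P = z has norm 1 = r^k. *)

theory Defs
  imports "HOL-Analysis.Analysis" "HOL-Computational_Algebra.Polynomial_Factorial"
begin

definition hausdorff1_pre :: "real \<Rightarrow> 'a::metric_space set \<Rightarrow> ennreal" where
  "hausdorff1_pre \<delta> A =
     (INF U \<in> {U :: nat \<Rightarrow> 'a set. A \<subseteq> (\<Union>i. U i) \<and> (\<forall>i. bounded (U i) \<and> diameter (U i) \<le> \<delta>)}.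
        \<Sum>i. ennreal (diameter (U i)))"

definition hausdorff1_outer :: "'a::metric_space set \<Rightarrow> ennreal" where
  "hausdorff1_outer A = (SUP \<delta> \<in> {0<..}. hausdorff1_pre \<delta> A)"

text \<open>
  The one-dimensional Hausdorff measure on Borel sets; its restriction to a curve is the
  arc length measure \<open>|dz|\<close>. That the outer measure is countably additive on Borel sets, so that
  \<^const>\<open>measure_of\<close> does not return the null measure, is \<open>emeasure_hausdorff1\<close> below.
\<close>

definition hausdorff1 :: "'a::metric_space measure" where
  "hausdorff1 = measure_of UNIV (sets borel) hausdorff1_outer"

lemma hausdorff1_pre_lower:
  assumes "A \<subseteq> (\<Union>i. U i)" "\<And>i. bounded (U i)" "\<And>i. diameter (U i) \<le> \<delta>"
  shows "hausdorff1_pre \<delta> A \<le> (\<Sum>i. ennreal (diameter (U i)))"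
  unfolding hausdorff1_pre_def using assms by (intro INF_lower) auto

lemma hausdorff1_pre_antimono: "\<delta> \<le> \<epsilon> \<Longrightarrow> hausdorff1_pre \<epsilon> A \<le> hausdorff1_pre \<delta> A"
  unfolding hausdorff1_pre_def 
  by (intro INF_superset_mono order_refl) (blast intro: order_trans)

lemma hausdorff1_pre_mono: "A \<subseteq> B \<Longrightarrow> hausdorff1_pre \<delta> A \<le> hausdorff1_pre \<delta> B"
  unfolding hausdorff1_pre_def by (intro INF_superset_mono) auto

lemma hausdorff1_outer_mono: "A \<subseteq> B \<Longrightarrow> hausdorff1_outer A \<le> hausdorff1_outer B"
  unfolding hausdorff1_outer_def by (intro SUP_mono) (auto intro: hausdorff1_pre_mono)

lemma hausdorff1_outer_empty [simp]: "hausdorff1_outer {} = 0"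
proof -
  have "hausdorff1_pre \<delta> ({} :: 'a set) = 0" if "\<delta> > 0" for \<delta>
    using hausdorff1_pre_lower[of "{}" "\<lambda>_. {}" \<delta>] that by simp
  then show ?thesis by (simp add: hausdorff1_outer_def)
qed

lemma hausdorff1_pre_UN:
  "hausdorff1_pre \<delta> (\<Union>i::nat. A i) \<le> (\<Sum>i. hausdorff1_pre \<delta> (A i))"
proof (cases "\<exists>i. hausdorff1_pre \<delta> (A i) = \<infinity>")
  case True
  then obtain i where "hausdorff1_pre \<delta> (A i) = \<infinity>" by blast
  moreover have "hausdorff1_pre \<delta> (A i) \<le> (\<Sum>i. hausdorff1_pre \<delta> (A i))"
    using sum_le_suminf[of "\<lambda>i. hausdorff1_pre \<delta> (A i)" "{i}"] by (simp add: summableI)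
  ultimately show ?thesis by (simp add: top_unique)
next
  case False
  show ?thesis
  proof (rule ennreal_le_epsilon)
    fix e :: real assume e: "0 < e"
    have "\<exists>U. A i \<subseteq> (\<Union>j. U j) \<and> (\<forall>j::nat. bounded (U j) \<and> diameter (U j) \<le> \<delta>) \<and>
            (\<Sum>j. ennreal (diameter (U j))) \<le> hausdorff1_pre \<delta> (A i) + ennreal (e * (1/2) ^ Suc i)" for i
    proof -
      have "0 < ennreal (e * (1/2) ^ Suc i)" using e by simp
      then have "hausdorff1_pre \<delta> (A i) < hausdorff1_pre \<delta> (A i) + ennreal (e * (1/2) ^ Suc i)"
        using False by (simp add: ennreal_add_left_cancel_less less_top)
      then show ?thesis
        by (subst (asm) hausdorff1_pre_def, subst (asm) INF_less_iff) (auto intro: less_imp_le)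
    qed
    then obtain U where U: "\<And>i. A i \<subseteq> (\<Union>j. U i j)" "\<And>i j. bounded (U i j)"
      "\<And>i j. diameter (U i j) \<le> \<delta>"
      "\<And>i. (\<Sum>j::nat. ennreal (diameter (U i j))) \<le> hausdorff1_pre \<delta> (A i) + ennreal (e * (1/2) ^ Suc i)"
      by metis
    let ?W = "\<lambda>n. case prod_decode n of (i, j) \<Rightarrow> U i j"
    have "(\<Union>i. A i) \<subseteq> (\<Union>n. ?W n)"
    proof
      fix x assume "x \<in> (\<Union>i. A i)"
      then obtain i j where "x \<in> U i j" using U(1) by blast
      then have "x \<in> ?W (prod_encode (i, j))" by simp
      then show "x \<in> (\<Union>n. ?W n)" by (rule UN_I[OF UNIV_I])
    qed
    then have "hausdorff1_pre \<delta> (\<Union>i. A i) \<le> (\<Sum>n. ennreal (diameter (?W n)))"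
      by (rule hausdorff1_pre_lower) (auto split: prod.split simp: U)
    also have "\<dots> = (\<Sum>n. (\<lambda>(i, j). ennreal (diameter (U i j))) (prod_decode n))"
      by (intro suminf_cong) (auto split: prod.split)
    also have "\<dots> = (\<Sum>i. \<Sum>j. ennreal (diameter (U i j)))"
      by (rule suminf_ennreal_2dimen) simp
    also have "\<dots> \<le> (\<Sum>i. hausdorff1_pre \<delta> (A i) + ennreal (e * (1/2) ^ Suc i))"
      by (intro suminf_le U summableI)
    also have "\<dots> = (\<Sum>i. hausdorff1_pre \<delta> (A i)) + (\<Sum>i. ennreal (e * (1/2) ^ Suc i))"
      by (intro suminf_add[symmetric] summableI)
    also have "(\<Sum>i. ennreal (e * (1/2) ^ Suc i)) = ennreal e"
      using sums_mult[OF power_half_series, of e] e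
      by (intro suminf_ennreal_eq) auto
    finally show "hausdorff1_pre \<delta> (\<Union>i. A i) \<le> (\<Sum>i. hausdorff1_pre \<delta> (A i)) + ennreal e" .
  qed
qed

lemma hausdorff1_outer_UN:
  "hausdorff1_outer (\<Union>i::nat. A i) \<le> (\<Sum>i. hausdorff1_outer (A i))"
  unfolding hausdorff1_outer_def[of "\<Union>i. A i"]
proof (rule SUP_least)
  fix \<delta> :: real assume "\<delta> \<in> {0<..}"
  then have "hausdorff1_pre \<delta> (A i) \<le> hausdorff1_outer (A i)" for i
    unfolding hausdorff1_outer_def by (intro SUP_upper)
  then have "(\<Sum>i. hausdorff1_pre \<delta> (A i)) \<le> (\<Sum>i. hausdorff1_outer (A i))"
    by (intro suminf_le summableI)
  then show "hausdorff1_pre \<delta> (\<Union>i. A i) \<le> (\<Sum>i. hausdorff1_outer (A i))"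
    using hausdorff1_pre_UN order_trans by blast
qed

lemma outer_measure_space_hausdorff1: "outer_measure_space UNIV hausdorff1_outer"
  unfolding outer_measure_space_def positive_def increasing_def countably_subadditive_def
  by (auto intro: hausdorff1_outer_mono hausdorff1_outer_UN)

lemma hausdorff1_outer_Un:
  "hausdorff1_outer (A \<union> B) \<le> hausdorff1_outer A + hausdorff1_outer B"
proof -
  interpret sigma_algebra UNIV "UNIV :: 'a set set" 
    using sigma_algebra_Pow[of "UNIV :: 'a set"] by simp
  have "subadditive UNIV (hausdorff1_outer :: 'a set \<Rightarrow> ennreal)"
    using outer_measure_space_hausdorff1 countably_subadditive_subadditive
    unfolding outer_measure_space_def by blast
  moreover have "A \<union> B = A \<union> (B - A)" by blast
  ultimately have "hausdorff1_outer (A \<union> B) \<le> hausdorff1_outer A + hausdorff1_outer (B - A)"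
    unfolding subadditive_def by (metis Diff_disjoint UNIV_I)
  also have "\<dots> \<le> hausdorff1_outer A + hausdorff1_outer B"
    by (intro add_left_mono hausdorff1_outer_mono) auto
  finally show ?thesis .
qed

lemma hausdorff1_outer_separated:
  assumes "e > 0" and sep: "\<And>x y. x \<in> A \<Longrightarrow> y \<in> B \<Longrightarrow> dist x y \<ge> e"
  shows "hausdorff1_outer A + hausdorff1_outer B \<le> hausdorff1_outer (A \<union> B)"
proof -
  have pre: "hausdorff1_pre \<delta> A + hausdorff1_pre \<delta> B \<le> hausdorff1_pre \<delta> (A \<union> B)" if "\<delta> < e" for \<delta>
    unfolding hausdorff1_pre_def[of _ "A \<union> B"]
  proof (rule INF_greatest)
    fix U :: "nat \<Rightarrow> 'a set"
    assume "U \<in> {U. A \<union> B \<subseteq> (\<Union>i. U i) \<and> (\<forall>i. bounded (U i) \<and> diameter (U i) \<le> \<delta>)}"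
    then have U: "A \<union> B \<subseteq> (\<Union>i. U i)" "\<And>i. bounded (U i)" "\<And>i. diameter (U i) \<le> \<delta>" by auto
    have sub: "diameter (U i \<inter> X) \<le> diameter (U i)" for i X
      using U(2) by (intro diameter_subset) auto
    have le: "hausdorff1_pre \<delta> X \<le> (\<Sum>i. ennreal (diameter (U i \<inter> X)))" if "X \<subseteq> A \<union> B" for X
    proof (rule hausdorff1_pre_lower)
      show "X \<subseteq> (\<Union>i. U i \<inter> X)" using that U(1) by blast
      show "bounded (U i \<inter> X)" for i using U(2) by (simp add: bounded_Int)
      show "diameter (U i \<inter> X) \<le> \<delta>" for i using sub U(3) by (rule order_trans)
    qed
    have disj: "U i \<inter> A = {} \<or> U i \<inter> B = {}" for i
    proof (rule ccontr)
      assume "\<not> ?thesis"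
      then obtain x y where "x \<in> U i" "x \<in> A" "y \<in> U i" "y \<in> B" by blast
      then have "e \<le> diameter (U i)"
        using sep diameter_bounded_bound[OF U(2)] order_trans by blast
      with U(3)[of i] that show False by linarith
    qed
    have one: "ennreal (diameter (U i \<inter> A)) + ennreal (diameter (U i \<inter> B)) \<le> ennreal (diameter (U i))" for i
      using disj[of i] sub[of i A] sub[of i B] by (auto intro: ennreal_leI)
    have "hausdorff1_pre \<delta> A + hausdorff1_pre \<delta> B
        \<le> (\<Sum>i. ennreal (diameter (U i \<inter> A))) + (\<Sum>i. ennreal (diameter (U i \<inter> B)))"
      by (intro add_mono le) auto
    also have "\<dots> = (\<Sum>i. ennreal (diameter (U i \<inter> A)) + ennreal (diameter (U i \<inter> B)))"
      by (intro suminf_add summableI)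
    also have "\<dots> \<le> (\<Sum>i. ennreal (diameter (U i)))"
      by (intro suminf_le one summableI)
    finally show "hausdorff1_pre \<delta> A + hausdorff1_pre \<delta> B \<le> (\<Sum>i. ennreal (diameter (U i)))" .
  qed
  have "hausdorff1_outer A + hausdorff1_outer B =
          (SUP \<delta>\<in>{0<..}. hausdorff1_pre \<delta> A + hausdorff1_pre \<delta> B)"
    unfolding hausdorff1_outer_def
  proof (rule SUP_add_directed_ennreal[symmetric])
    fix i j :: real assume "i \<in> {0<..}" "j \<in> {0<..}"
    then show "\<exists>l\<in>{0<..}. hausdorff1_pre i A + hausdorff1_pre j B \<le> hausdorff1_pre l A + hausdorff1_pre l B"
      by (intro bexI[of _ "min i j"] add_mono hausdorff1_pre_antimono) auto
  qed
  also have "\<dots> \<le> hausdorff1_outer (A \<union> B)"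
  proof (rule SUP_least)
    fix \<delta> :: real assume "\<delta> \<in> {0<..}"
    then have d: "min \<delta> (e/2) \<in> {0<..}" "min \<delta> (e/2) < e" using \<open>e > 0\<close> by auto
    have "hausdorff1_pre \<delta> A + hausdorff1_pre \<delta> B
        \<le> hausdorff1_pre (min \<delta> (e/2)) A + hausdorff1_pre (min \<delta> (e/2)) B"
      by (intro add_mono hausdorff1_pre_antimono) auto
    also have "\<dots> \<le> hausdorff1_pre (min \<delta> (e/2)) (A \<union> B)" by (rule pre[OF d(2)])
    also have "\<dots> \<le> hausdorff1_outer (A \<union> B)"
      unfolding hausdorff1_outer_def by (rule SUP_upper[OF d(1)])
    finally show "hausdorff1_pre \<delta> A + hausdorff1_pre \<delta> B \<le> hausdorff1_outer (A \<union> B)" .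
  qed
  finally show ?thesis .
qed

lemma hausdorff1_outer_separated_sum:
  fixes D :: "nat \<Rightarrow> 'a::metric_space set"
  assumes sep: "\<And>n. \<exists>e>0. \<forall>i<n. \<forall>x\<in>D i. \<forall>y\<in>D n. dist x y \<ge> e"
  shows "(\<Sum>i<n. hausdorff1_outer (D i)) \<le> hausdorff1_outer (\<Union>i<n. D i)"
proof (induction n)
  case (Suc n)
  obtain e where e: "e > 0" "\<forall>i<n. \<forall>x\<in>D i. \<forall>y\<in>D n. dist x y \<ge> e" using sep by blast
  have "(\<Sum>i<Suc n. hausdorff1_outer (D i)) \<le> hausdorff1_outer (\<Union>i<n. D i) + hausdorff1_outer (D n)"
    using Suc by (simp add: add_right_mono)
  also have "\<dots> \<le> hausdorff1_outer ((\<Union>i<n. D i) \<union> D n)"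
    using e by (intro hausdorff1_outer_separated[of e]) auto
  also have "(\<Union>i<n. D i) \<union> D n = (\<Union>i<Suc n. D i)" by (auto simp: lessThan_Suc)
  finally show ?case .
qed simp

lemma hausdorff1_outer_closed:
  fixes F E :: "'a::metric_space set"
  assumes "closed F"
  shows "hausdorff1_outer (E \<inter> F) + hausdorff1_outer (E - F) \<le> hausdorff1_outer E"
proof (cases "F = {} \<or> hausdorff1_outer E = \<infinity>")
  case True then show ?thesis by auto
next
  case False
  then have F: "F \<noteq> {}" and fin: "hausdorff1_outer E < \<infinity>" by (auto simp: less_top)
  define f where "f n = (1::real) / (real n + 1)" for n :: nat
  have f: "f n > 0" for n by (simp add: f_def)
  have fdec: "f n \<le> f m" if "m \<le> n" for m n using that by (simp add: f_def frac_le)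
  have fdec': "f n < f m" if "m < n" for m n using that by (simp add: f_def frac_less2)
  define G where "G n = {x \<in> E. infdist x F \<ge> f n}" for n
  define D where "D n = {x \<in> E. f (Suc n) \<le> infdist x F \<and> infdist x F < f n}" for n
  have sepD: "dist x y \<ge> f (Suc i) - f n" if "x \<in> D i" "y \<in> D n" for x y i n
    using that infdist_triangle[of x F y] by (auto simp: D_def)
  have half: "(\<Sum>i. hausdorff1_outer (D (2 * i + c))) \<le> hausdorff1_outer E" for c
  proof (rule suminf_le_const[OF summableI])
    fix n
    have "(\<Sum>i<n. hausdorff1_outer (D (2 * i + c))) \<le> hausdorff1_outer (\<Union>i<n. D (2 * i + c))"
    proof (rule hausdorff1_outer_separated_sum)
      fix n
      show "\<exists>e>0. \<forall>i<n. \<forall>x\<in>D (2 * i + c). \<forall>y\<in>D (2 * n + c). e \<le> dist x y"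
      proof (cases n)
        case 0 then show ?thesis by (auto intro: exI[of _ 1])
      next
        case (Suc m)
        show ?thesis
        proof (intro exI[of _ "f (2 * m + c + 1) - f (2 * n + c)"] conjI allI impI ballI)
          show "0 < f (2 * m + c + 1) - f (2 * n + c)"
            using fdec'[of "2 * m + c + 1" "2 * n + c"] Suc by simp
          fix i x y assume *: "i < n" "x \<in> D (2 * i + c)" "y \<in> D (2 * n + c)"
          have "f (2 * m + c + 1) \<le> f (Suc (2 * i + c))" using * Suc by (intro fdec) simp
          with sepD[OF *(2,3)] show "f (2 * m + c + 1) - f (2 * n + c) \<le> dist x y" by linarith
        qed
      qed
    qed
    also have "\<dots> \<le> hausdorff1_outer E" by (intro hausdorff1_outer_mono) (auto simp: D_def)
    finally show "(\<Sum>i<n. hausdorff1_outer (D (2 * i + c))) \<le> hausdorff1_outer E" .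
  qed
  have "(\<Sum>i. hausdorff1_outer (D i)) \<le> hausdorff1_outer E + hausdorff1_outer E"
  proof (rule suminf_le_const[OF summableI])
    fix n
    have "(\<Sum>i<n. hausdorff1_outer (D i)) \<le> (\<Sum>i<2 * n. hausdorff1_outer (D i))"
      by (intro sum_mono2) auto
    also have "\<dots> = (\<Sum>i<n. hausdorff1_outer (D (2 * i + 0))) + (\<Sum>i<n. hausdorff1_outer (D (2 * i + 1)))"
      by (induction n) (auto simp: algebra_simps)
    also have "\<dots> \<le> (\<Sum>i. hausdorff1_outer (D (2 * i + 0))) + (\<Sum>i. hausdorff1_outer (D (2 * i + 1)))"
      by (intro add_mono sum_le_suminf summableI) auto
    also have "\<dots> \<le> hausdorff1_outer E + hausdorff1_outer E" by (intro add_mono half)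
    finally show "(\<Sum>i<n. hausdorff1_outer (D i)) \<le> hausdorff1_outer E + hausdorff1_outer E" .
  qed
  then have sumfin: "(\<Sum>i. hausdorff1_outer (D i)) < \<infinity>"
    using fin by (metis ennreal_add_less_top infinity_ennreal_def le_less_trans)
  have bound: "hausdorff1_outer (E \<inter> F) + hausdorff1_outer (E - F)
      \<le> hausdorff1_outer E + (\<Sum>i. hausdorff1_outer (D (i + n)))" for n
  proof -
    have "E - F \<subseteq> G n \<union> (\<Union>i. D (i + n))"
    proof
      fix x assume x: "x \<in> E - F"
      then have pos: "infdist x F > 0"
        using assms F in_closed_iff_infdist_zero[of F x] infdist_nonneg[of x F] by force
      show "x \<in> G n \<union> (\<Union>i. D (i + n))"
      proof (cases "infdist x F \<ge> f n")
        case True then show ?thesis using x by (auto simp: G_def)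
      next
        case False
        have "\<exists>N. f N < infdist x F"
          using reals_Archimedean[OF pos] by (auto simp: f_def inverse_eq_divide algebra_simps)
        then have ex: "\<exists>N. f N \<le> infdist x F" using less_imp_le by blast
        define N where "N = (LEAST N. f N \<le> infdist x F)"
        have N: "f N \<le> infdist x F" unfolding N_def using ex by (rule LeastI_ex)
        have "n < N" using N False fdec[of N n] by (meson le_less_linear order_trans)
        then obtain M where M: "N = Suc M" "n \<le> M" by (cases N) auto
        have "\<not> f M \<le> infdist x F" using not_less_Least[of M "\<lambda>N. f N \<le> infdist x F"] M N_def by simp
        then have "x \<in> D ((M - n) + n)" using x N M by (simp add: D_def)
        then show ?thesis by blast
      qed
    qed
    then have "hausdorff1_outer (E - F) \<le> hausdorff1_outer (G n \<union> (\<Union>i. D (i + n)))"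
      by (rule hausdorff1_outer_mono)
    also have "\<dots> \<le> hausdorff1_outer (G n) + hausdorff1_outer (\<Union>i. D (i + n))"
      by (rule hausdorff1_outer_Un)
    also have "\<dots> \<le> hausdorff1_outer (G n) + (\<Sum>i. hausdorff1_outer (D (i + n)))"
      by (intro add_left_mono hausdorff1_outer_UN)
    finally have "hausdorff1_outer (E \<inter> F) + hausdorff1_outer (E - F)
        \<le> hausdorff1_outer (E \<inter> F) + hausdorff1_outer (G n) + (\<Sum>i. hausdorff1_outer (D (i + n)))"
      by (simp add: add.assoc add_left_mono)
    also have "hausdorff1_outer (E \<inter> F) + hausdorff1_outer (G n) \<le> hausdorff1_outer (E \<inter> F \<union> G n)"
    proof (rule hausdorff1_outer_separated[OF f[of n]])
      fix x y assume "x \<in> E \<inter> F" "y \<in> G n"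
      then show "f n \<le> dist x y"
        using infdist_le[of x F y] by (auto simp: G_def dist_commute)
    qed
    also have "\<dots> \<le> hausdorff1_outer E" by (intro hausdorff1_outer_mono) (auto simp: G_def)
    finally show ?thesis by (simp add: add_right_mono)
  qed
  have "(\<lambda>n. \<Sum>i. hausdorff1_outer (D (i + n))) \<longlonglongrightarrow> 0"
  proof -
    define d where "d i = enn2real (hausdorff1_outer (D i))" for i
    have "hausdorff1_outer (D i) < \<infinity>" for i
      using sum_le_suminf[of "\<lambda>i. hausdorff1_outer (D i)" "{i}"] sumfin
      by (simp add: summableI le_less_trans)
    then have d: "hausdorff1_outer (D i) = ennreal (d i)" "d i \<ge> 0" for i
      by (auto simp: d_def)
    have sm: "summable d"
      using sumfin d by (intro summable_suminf_not_top) (auto simp: less_top)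
    have "(\<Sum>i. hausdorff1_outer (D (i + n))) = ennreal (\<Sum>i. d (i + n))" for n
      unfolding d using d sm by (intro suminf_ennreal2) (auto simp: summable_iff_shift)
    moreover have "(\<lambda>n. ennreal (\<Sum>i. d (i + n))) \<longlonglongrightarrow> ennreal 0"
      using suminf_exist_split2[OF sm] by (intro tendsto_ennrealI)
    ultimately show ?thesis by simp
  qed
  then have "(\<lambda>n. hausdorff1_outer E + (\<Sum>i. hausdorff1_outer (D (i + n)))) \<longlonglongrightarrow> hausdorff1_outer E + 0"
    by (intro tendsto_add) auto
  then show ?thesis
    using bound by (intro LIMSEQ_le_const) auto
qed

lemma space_hausdorff1 [simp]: "space hausdorff1 = UNIV"
  by (simp add: hausdorff1_def)

lemma sets_hausdorff1 [simp, measurable_cong]: "sets hausdorff1 = sets borel"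
  using sets.sigma_sets_eq[of borel] by (simp add: hausdorff1_def)

lemma emeasure_hausdorff1:
  fixes A :: "'a::metric_space set"
  assumes "A \<in> sets borel"
  shows "emeasure hausdorff1 A = hausdorff1_outer A"
proof -
  interpret sigma_algebra UNIV "UNIV :: 'a set set" 
    using sigma_algebra_Pow[of "UNIV :: 'a set"] by simp
  let ?L = "lambda_system UNIV UNIV (hausdorff1_outer :: 'a set \<Rightarrow> ennreal)"
  have ms: "measure_space UNIV ?L hausdorff1_outer"
    by (rule caratheodory_lemma[OF outer_measure_space_hausdorff1])
  have "Collect closed \<subseteq> ?L"
  proof clarify
    fix F :: "'a set" assume "closed F"
    then have "hausdorff1_outer (E \<inter> F) + hausdorff1_outer (E - F) = hausdorff1_outer E" for E
      using hausdorff1_outer_Un[of "E \<inter> F" "E - F"]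
      by (intro antisym hausdorff1_outer_closed) (auto simp: Int_Diff_Un)
    then show "F \<in> ?L" by (simp add: lambda_system_eq)
  qed
  then have sub: "sets (borel :: 'a measure) \<subseteq> ?L"
    using ms unfolding borel_eq_closed measure_space_def
    by (simp add: sigma_algebra.sigma_sets_subset)
  have pos: "positive (sets borel) (hausdorff1_outer :: 'a set \<Rightarrow> ennreal)"
    by (simp add: positive_def)
  have "countably_additive (sets borel) (hausdorff1_outer :: 'a set \<Rightarrow> ennreal)"
    using ms sub unfolding measure_space_def countably_additive_def by blast
  from emeasure_measure_of[OF hausdorff1_def _ pos[folded sets_hausdorff1] this[folded sets_hausdorff1]] assms
  show ?thesis by simp
qed


abbreviation cpoly :: "int poly \<Rightarrow> complex poly" where
  "cpoly P \<equiv> map_poly of_int P"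

definition lemniscate :: "int poly \<Rightarrow> real \<Rightarrow> complex set" where
  "lemniscate V r = {z. cmod (poly (cpoly V) z) = r}"

definition lemniscate_measure :: "int poly \<Rightarrow> real \<Rightarrow> complex measure" where
  "lemniscate_measure V r =
     density (restrict_space hausdorff1 (lemniscate V r))
       (\<lambda>z. ennreal (cmod (poly (pderiv (cpoly V)) z) / (2 * pi * real (degree V) * r)))"

text \<open>
  The exponent ranges over the extended reals, to include \<open>p = \<infinity>\<close>. In that case the maximum of
  \<open>|P|\<close> over the compact set \<open>L\<close> is written as a supremum.
\<close>

definition lemniscate_norm :: "int poly \<Rightarrow> real \<Rightarrow> ereal \<Rightarrow> int poly \<Rightarrow> real" where
  "lemniscate_norm V r p P =
     (if p = \<infinity> then (SUP z \<in> lemniscate V r. cmod (poly (cpoly P) z))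
      else (LINT z|lemniscate_measure V r. cmod (poly (cpoly P) z) powr real_of_ereal p)
             powr (1 / real_of_ereal p))"

text \<open>
  The convention \<open>ln 0 = 0\<close> is harmless here: a nonzero polynomial has only finitely many zeros,
  and these form a null set.
\<close>

definition lemniscate_mahler :: "int poly \<Rightarrow> real \<Rightarrow> int poly \<Rightarrow> real" where
  "lemniscate_mahler V r P =
     exp (LINT z|lemniscate_measure V r. ln (cmod (poly (cpoly P) z)))"

end

theory Submission
  imports Defs "HOL-Complex_Analysis.Complex_Analysis" "HOL-Probability.Probability_Measure"
    "HOL-Computational_Algebra.Fundamental_Theorem_Algebra" "Jordan_Normal_Form.Determinant"
begin

text \<open>
  Let \<open>a\<close> be the leading coefficient of \<open>V\<close> and \<open>m\<close> its degree. The measure \<open>\<mu>\<close> is the pullback under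
  \<open>V\<close> of the uniform measure on the circle \<open>|w| = r\<close>: the integral of \<open>f\<close> is the mean over the circle
  of \<open>(1/m) \<Sum> f z\<close>, summed over the solutions of \<open>V z = w\<close>. Hence, for an integer polynomial \<open>Q\<close> of
  degree \<open>n\<close>, \<open>m \<integral> ln |Q| d\<mu>\<close> is the circle mean of \<open>ln |R|\<close>, where \<open>R w\<close> is the product of \<open>Q z\<close>
  over \<open>V z = w\<close>, a polynomial in \<open>w\<close>. If \<open>V\<close> does not divide \<open>Q\<close>, then \<open>a\<^sup>n R 0\<close> is up to sign the
  resultant of \<open>V\<close> and \<open>Q\<close>, a nonzero integer, so by Jensen's formula the geometric mean of \<open>|Q|\<close> is
  at least \<open>|a|\<^bsup>-n/m\<^esup>\<close>. Applied to \<open>P = V\<^sup>l Q\<close>, with \<open>|V| = r\<close> on \<open>L\<close>, this gives the lower bound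
  \<open>r\<^sup>k\<close>. If some \<open>p\<close>-norm of \<open>Q\<close> equals \<open>|a|\<^bsup>-n/m\<^esup>\<close>, then \<open>|Q|\<close> is constant almost everywhere, so
  \<open>|R|\<close> is constant on the circle and at most \<open>|R 0|\<close>; the maximum modulus principle makes \<open>R\<close>, and
  hence \<open>Q\<close>, constant.
\<close>

section \<open>One-dimensional Hausdorff measure and curves\<close>

text \<open>The weight \<open>|V'|\<close> is what makes the pullback work: where \<open>V\<close>
  is locally invertible, the curve is parametrised by \<open>t = arg V\<close> with speed
  \<open>r / |V'|\<close>, so \<open>|V'| |dz| = r dt\<close>, and the factor
  \<open>1 / (2 pi m r)\<close> gives each of the \<open>m\<close> preimages the weight
  \<open>1/m\<close>. Since arc length is Hausdorff measure here, this rests on the length formula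
  for smooth arcs, obtained by comparing measures up to factors close to 1, and on gluing charts
  away from finitely many bad points. A second obstacle is that zeros of \<open>R\<close> may lie on
  the circle, where the logarithm is singular; there Fatou's lemma gives an inequality in place of
  Jensen's formula, in the direction that the lower bound uses. The condition
  \<open>r \<le> 1/|a|\<close> enters through a count of degrees: with \<open>P = V^l Q\<close> and
  \<open>deg P \<le> k m\<close> the cofactor has \<open>n/m \<le> k - l\<close>, so its mean is at
  least \<open>|a|^(-(k - l)) \<ge> r^(k - l)\<close>.\<close>

lemma hausdorff1_outer_real_interval_le:
  fixes a b :: real
  assumes "a \<le> b"
  shows "hausdorff1_outer {a..b} \<le> ennreal (b - a)"
  unfolding hausdorff1_outer_def
proof (rule SUP_least)
  fix \<delta> :: real assume "\<delta> \<in> {0<..}"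
  then have \<delta>: "\<delta> > 0" by simp
  \<comment> \<open>Intervals of length \<open>(b - a) / N\<close> have diameter at most
    \<open>\<delta>\<close>, and their total diameter is \<open>b - a\<close> whatever
    \<open>\<delta>\<close> is. The strict inequality keeps \<open>N\<close> positive also when
    \<open>a = b\<close>.\<close>
  obtain N :: nat where N: "(b - a) / \<delta> < real N" using reals_Archimedean2 by blast
  have "0 \<le> (b - a) / \<delta>" using assms \<delta> by simp
  then have N0: "N > 0" using N by (cases "N = 0") auto
  define d where "d = (b - a) / real N"
  have d: "0 \<le> d" "d \<le> \<delta>" "real N * d = b - a"
    using N N0 \<delta> assms by (auto simp: d_def field_simps)
  define U where "U i = (if i < N then {a + real i * d .. a + real (Suc i) * d} else {})" for i
  have diam: "diameter (U i) = (if i < N then d else 0)" for i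
    using d by (auto simp: U_def diameter_closed_interval algebra_simps)
  have cov: "{a..b} \<subseteq> (\<Union>i. U i)"
  proof
    fix x assume x: "x \<in> {a..b}"
    have "\<exists>i<n. a + real i * d \<le> x \<and> x \<le> a + real (Suc i) * d" if "x \<le> a + real n * d" "n > 0" for n
      using that
    proof (induction n)
      case (Suc n)
      show ?case
      proof (cases "x \<le> a + real n * d \<and> n > 0")
        case True then show ?thesis using Suc.IH less_SucI by blast
      next
        case False
        then show ?thesis using Suc.prems x by (intro exI[of _ n]) (auto simp: not_le)
      qed
    qed simp
    from this[of N] obtain i where "i < N" "a + real i * d \<le> x" "x \<le> a + real (Suc i) * d"
      using x N0 d(3) by auto
    then have "x \<in> U i" by (simp add: U_def)
    then show "x \<in> (\<Union>i. U i)" by blast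
  qed
  have "hausdorff1_pre \<delta> {a..b} \<le> (\<Sum>i. ennreal (diameter (U i)))"
  proof (rule hausdorff1_pre_lower[OF cov])
    show "bounded (U i)" for i by (simp add: U_def)
    show "diameter (U i) \<le> \<delta>" for i using d \<delta> by (simp add: diam)
  qed
  also have "\<dots> = (\<Sum>i<N. ennreal (diameter (U i)))"
    by (rule suminf_finite) (auto simp: diam)
  also have "\<dots> = ennreal (b - a)"
    using d by (simp add: diam ennreal_of_nat_eq_real_of_nat flip: ennreal_mult)
  finally show "hausdorff1_pre \<delta> {a..b} \<le> ennreal (b - a)" .
qed

text \<open>Each set of a cover lies in the interval between its infimum and its supremum, whose
  length is at most the diameter, so covers of mesh 1 already bound Lebesgue measure; the outer
  measure is the supremum over all meshes.\<close>

lemma lborel_le_hausdorff1_outer: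
  fixes A :: "real set"
  assumes "A \<in> sets borel"
  shows "emeasure lborel A \<le> hausdorff1_outer A"
proof -
  have "emeasure lborel A \<le> hausdorff1_pre 1 A"
    unfolding hausdorff1_pre_def
  proof (rule INF_greatest)
    fix U :: "nat \<Rightarrow> real set"
    assume "U \<in> {U. A \<subseteq> (\<Union>i. U i) \<and> (\<forall>i. bounded (U i) \<and> diameter (U i) \<le> 1)}"
    then have U: "A \<subseteq> (\<Union>i. U i)" "\<And>i. bounded (U i)" by auto
    define J where "J i = (if U i = {} then {} else {Inf (U i) .. Sup (U i)})" for i
    have sub: "U i \<subseteq> J i" for i
      using bounded_imp_bdd_below[OF U(2)[of i]] bounded_imp_bdd_above[OF U(2)[of i]]
      by (auto simp: J_def intro: cInf_lower cSup_upper)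
    have J: "emeasure lborel (J i) \<le> ennreal (diameter (U i))" for i
    proof (cases "U i = {}")
      case False
      have "Sup (U i) - Inf (U i) \<le> diameter (U i)"
      proof -
        have "Sup (U i) \<le> Inf (U i) + diameter (U i)"
        proof (rule cSup_least[OF False])
          fix x assume x: "x \<in> U i"
          have "x - diameter (U i) \<le> Inf (U i)"
          proof (rule cInf_greatest[OF False])
            fix y assume "y \<in> U i"
            then show "x - diameter (U i) \<le> y"
              using diameter_bounded_bound[OF U(2) x, of y] by (auto simp: dist_real_def)
          qed
          then show "x \<le> Inf (U i) + diameter (U i)" by simp
        qed
        then show ?thesis by simp
      qed
      moreover have "Inf (U i) \<le> Sup (U i)"
        using False sub[of i] by (auto simp: J_def)
      ultimately show ?thesis using False by (auto simp: J_def intro: ennreal_leI)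
    qed (simp add: J_def)
    have "emeasure lborel A \<le> emeasure lborel (\<Union>i. J i)"
    proof (rule emeasure_mono)
      show "A \<subseteq> (\<Union>i. J i)" using U(1) sub by blast
    qed (auto simp: J_def)
    also have "\<dots> \<le> (\<Sum>i. emeasure lborel (J i))"
      by (rule emeasure_subadditive_countably) (auto simp: J_def)
    also have "\<dots> \<le> (\<Sum>i. ennreal (diameter (U i)))"
      by (intro suminf_le J summableI)
    finally show "emeasure lborel A \<le> (\<Sum>i. ennreal (diameter (U i)))" .
  qed
  also have "\<dots> \<le> hausdorff1_outer A"
    unfolding hausdorff1_outer_def by (rule SUP_upper) auto
  finally show ?thesis .
qed

lemma hausdorff1_real_eq_lborel: "(hausdorff1 :: real measure) = lborel"
proof (rule lborel_eqI[symmetric])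
  fix l u :: real assume "\<And>b. b \<in> Basis \<Longrightarrow> l \<bullet> b \<le> u \<bullet> b"
  then have lu: "l \<le> u" by simp
  have "hausdorff1_outer {l<..<u} \<le> ennreal (u - l)"
    by (rule order_trans[OF hausdorff1_outer_mono hausdorff1_outer_real_interval_le[OF lu]]) auto
  moreover have "ennreal (u - l) \<le> hausdorff1_outer {l<..<u}"
    using lborel_le_hausdorff1_outer[of "{l<..<u}"] lu by simp
  ultimately show "emeasure hausdorff1 (box l u) = (\<Prod>b\<in>Basis. (u - l) \<bullet> b)"
    by (simp add: emeasure_hausdorff1 antisym)
qed simp

lemma hausdorff1_outer_real: "(A :: real set) \<in> sets borel \<Longrightarrow> hausdorff1_outer A = emeasure lborel A"
  by (simp add: emeasure_hausdorff1[symmetric] hausdorff1_real_eq_lborel)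

lemma hausdorff1_outer_singleton [simp]: "hausdorff1_outer {x} = 0"
proof -
  have "hausdorff1_pre \<delta> {x} = 0" if "\<delta> > 0" for \<delta>
    using hausdorff1_pre_lower[of "{x}" "\<lambda>_. {x}" \<delta>] that by simp
  then show ?thesis by (simp add: hausdorff1_outer_def)
qed

text \<open>Images of a cover of mesh \<open>\<delta> / C\<close> form a cover of mesh
  \<open>\<delta>\<close>. Applied to a curve and to its inverse, this squeezes the length of a
  short arc from both sides.\<close>

lemma hausdorff1_outer_lipschitz_image:
  fixes f :: "'a::metric_space \<Rightarrow> 'b::metric_space"
  assumes C: "C > 0" and lip: "\<And>x y. x \<in> A \<Longrightarrow> y \<in> A \<Longrightarrow> dist (f x) (f y) \<le> C * dist x y"
  shows "hausdorff1_outer (f ` A) \<le> ennreal C * hausdorff1_outer A"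
  unfolding hausdorff1_outer_def[of "f ` A"]
proof (rule SUP_least)
  fix \<delta> :: real assume "\<delta> \<in> {0<..}"
  then have \<delta>: "\<delta> > 0" by simp
  have "hausdorff1_pre \<delta> (f ` A) \<le> ennreal C * hausdorff1_pre (\<delta> / C) A"
  proof -
    \<comment> \<open>With the constant on the left, the right side is the bare infimum over covers
      of \<open>A\<close> and can be bounded cover by cover.\<close>
    have *: "ennreal (inverse C) * hausdorff1_pre \<delta> (f ` A) \<le> hausdorff1_pre (\<delta> / C) A"
      unfolding hausdorff1_pre_def[of _ A]
    proof (rule INF_greatest)
      fix U :: "nat \<Rightarrow> 'a set"
      assume "U \<in> {U. A \<subseteq> (\<Union>i. U i) \<and> (\<forall>i. bounded (U i) \<and> diameter (U i) \<le> \<delta> / C)}"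
      then have U: "A \<subseteq> (\<Union>i. U i)" "\<And>i. bounded (U i)" "\<And>i. diameter (U i) \<le> \<delta> / C" by auto
      define W where "W i = f ` (U i \<inter> A)" for i
      have dW: "dist u v \<le> C * diameter (U i)" if "u \<in> W i" "v \<in> W i" for u v i
      proof -
        from that obtain x y where xy: "x \<in> U i" "x \<in> A" "y \<in> U i" "y \<in> A" "u = f x" "v = f y"
          by (auto simp: W_def)
        have "dist u v \<le> C * dist x y" using lip xy by simp
        also have "\<dots> \<le> C * diameter (U i)"
          using C diameter_bounded_bound[OF U(2) xy(1,3)] by simp
        finally show ?thesis .
      qed
      have bW: "bounded (W i)" for i
        unfolding bounded_two_points using dW by blast
      have diamW: "diameter (W i) \<le> C * diameter (U i)" for i
        using C diameter_ge_0[OF U(2)] dW by (auto simp: diameter_def[of "W i"] intro!: cSUP_least)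
      have "hausdorff1_pre \<delta> (f ` A) \<le> (\<Sum>i. ennreal (diameter (W i)))"
      proof (rule hausdorff1_pre_lower)
        show "f ` A \<subseteq> (\<Union>i. W i)" using U(1) by (fastforce simp: W_def)
        show "diameter (W i) \<le> \<delta>" for i
          using diamW[of i] U(3)[of i] C by (simp add: field_simps)
      qed (rule bW)
      also have "\<dots> \<le> (\<Sum>i. ennreal (C * diameter (U i)))"
        by (intro suminf_le summableI ennreal_leI diamW)
      also have "\<dots> = ennreal C * (\<Sum>i. ennreal (diameter (U i)))"
        using C by (simp add: ennreal_mult diameter_ge_0[OF U(2)])
      finally have "ennreal (inverse C) * hausdorff1_pre \<delta> (f ` A)
          \<le> ennreal (inverse C) * (ennreal C * (\<Sum>i. ennreal (diameter (U i))))"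
        by (rule mult_left_mono) simp
      also have "\<dots> = (\<Sum>i. ennreal (diameter (U i)))"
        using C by (simp flip: mult.assoc ennreal_mult)
      finally show "ennreal (inverse C) * hausdorff1_pre \<delta> (f ` A) \<le> (\<Sum>i. ennreal (diameter (U i)))" .
    qed
    have "hausdorff1_pre \<delta> (f ` A) = ennreal C * (ennreal (inverse C) * hausdorff1_pre \<delta> (f ` A))"
      using C by (simp flip: mult.assoc ennreal_mult)
    also have "\<dots> \<le> ennreal C * hausdorff1_pre (\<delta> / C) A"
      using * by (rule mult_left_mono) simp
    finally show ?thesis .
  qed
  also have "\<dots> \<le> ennreal C * hausdorff1_outer A"
    unfolding hausdorff1_outer_def using C \<delta> by (intro mult_left_mono SUP_upper) auto
  finally show "hausdorff1_pre \<delta> (f ` A) \<le> ennreal C * hausdorff1_outer A" .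
qed

section \<open>Local comparison of measures, and arc length along regular curves\<close>

text \<open>Local bounds with a factor \<open>1 + e\<close> suffice although the neighbourhoods
  depend on \<open>e\<close>: for fixed \<open>e\<close> a countable subcover is cut into disjoint
  pieces and the bounds are added, and only then does \<open>e\<close> tend to 0.\<close>

lemma emeasure_le_if_locally_le:
  fixes M N :: "'a::second_countable_topology measure"
  assumes [measurable_cong]: "sets M = sets borel" "sets N = sets borel" and T: "open T"
    and loc: "\<And>x e. x \<in> T \<Longrightarrow> e > 0 \<Longrightarrow> \<exists>U. open U \<and> x \<in> U \<and>
       (\<forall>A\<in>sets borel. A \<subseteq> U \<inter> T \<longrightarrow> emeasure M A \<le> ennreal (1 + e) * emeasure N A)"
    and A: "A \<in> sets borel" "A \<subseteq> T"
  shows "emeasure M A \<le> emeasure N A"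
proof -
  have le: "emeasure M A \<le> ennreal (1 + e) * emeasure N A" if e: "e > 0" for e
  proof -
    define \<U> where "\<U> = {U. open U \<and> 
       (\<forall>A\<in>sets borel. A \<subseteq> U \<inter> T \<longrightarrow> emeasure M A \<le> ennreal (1 + e) * emeasure N A)}"
    obtain \<F> where F: "\<F> \<subseteq> \<U>" "countable \<F>" "\<Union>\<F> = \<Union>\<U>"
      using Lindelof[of \<U>] by (auto simp: \<U>_def)
    have cov: "T \<subseteq> \<Union>\<U>" using loc[OF _ e] by (fastforce simp: \<U>_def)
    define U where "U = from_nat_into (insert {} \<F>)"
    have ran: "range U = insert {} \<F>" unfolding U_def using F(2) by (intro range_from_nat_into) auto
    have UU: "U i \<in> \<U>" for i
    proof -
      have "U i \<in> insert {} \<F>" using ran by blast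
      then show ?thesis using F(1) by (auto simp: \<U>_def)
    qed
    then have oU: "open (U i)" for i by (simp add: \<U>_def)
    have UN: "T \<subseteq> (\<Union>i. U i)" using cov F(3) ran by auto
    define B where "B i = A \<inter> disjointed U i" for i
    have Bs [measurable]: "B i \<in> sets borel" for i
    proof -
      have "range (disjointed U) \<subseteq> sets borel"
        by (rule sets.range_disjointed_sets) (use oU in auto)
      then show ?thesis unfolding B_def using A by blast
    qed
    have dB: "disjoint_family B"
      using disjoint_family_disjointed[of U] by (auto simp: disjoint_family_on_def B_def)
    have AB: "A = (\<Union>i. B i)" using A UN UN_disjointed_eq[of U] by (auto simp: B_def)
    have BU: "B i \<subseteq> U i \<inter> T" for i using disjointed_subset[of U i] A by (auto simp: B_def)
    have "emeasure M A = (\<Sum>i. emeasure M (B i))"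
      unfolding AB using dB assms by (intro suminf_emeasure[symmetric]) auto
    also have "\<dots> \<le> (\<Sum>i. ennreal (1 + e) * emeasure N (B i))"
    proof (intro suminf_le summableI)
      fix i show "emeasure M (B i) \<le> ennreal (1 + e) * emeasure N (B i)"
        using UU[of i] BU[of i] Bs[of i] unfolding \<U>_def by blast
    qed
    also have "\<dots> = ennreal (1 + e) * emeasure N A"
      unfolding AB using dB assms by (subst suminf_emeasure[symmetric]) auto
    finally show ?thesis .
  qed
  show ?thesis
  proof (cases "emeasure N A = \<infinity>")
    case False
    then obtain x where x: "emeasure N A = ennreal x" "x \<ge> 0" by (cases "emeasure N A") auto
    show ?thesis
    proof (rule ennreal_le_epsilon)
      fix e :: real assume e: "e > 0"
      \<comment> \<open>Dividing by \<open>x + 1\<close> covers \<open>x = 0\<close> as well and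
        leaves an error \<open>e * x / (x + 1)\<close>, which is at most \<open>e\<close>.\<close>
      have "emeasure M A \<le> ennreal (1 + e / (x + 1)) * emeasure N A" using e x by (intro le) simp
      also have "\<dots> = ennreal (x + e * (x / (x + 1)))"
        using e x by (simp add: field_simps flip: ennreal_mult)
      also have "\<dots> \<le> ennreal (x + e)"
        using e x by (intro ennreal_leI add_left_mono mult_left_le) (auto simp: field_simps)
      also have "\<dots> = emeasure N A + ennreal e" using e x by simp
      finally show "emeasure M A \<le> emeasure N A + ennreal e" .
    qed
  qed simp
qed


text \<open>The mean value inequality is applied to
  \<open>\<gamma> t - t *\<^sub>R \<gamma>' t0\<close>, whose derivative is small near
  \<open>t0\<close>. There the chords of the curve differ little from those of the tangent line, so
  both Lipschitz constants are close to \<open>norm (\<gamma>' t0)\<close>.\<close>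

lemma C1_curve_locally_bilipschitz:
  fixes \<gamma> \<gamma>' :: "real \<Rightarrow> 'a::real_normed_vector"
  assumes T: "open T" "t0 \<in> T" and der: "\<And>t. t \<in> T \<Longrightarrow> (\<gamma> has_vector_derivative \<gamma>' t) (at t)"
    and cont: "continuous_on T \<gamma>'" and nz: "\<gamma>' t0 \<noteq> 0" and e: "e > 0"
  obtains d where "d > 0" "ball t0 d \<subseteq> T"
    "\<And>t. t \<in> ball t0 d \<Longrightarrow> (1 - e) * norm (\<gamma>' t0) \<le> norm (\<gamma>' t) \<and> norm (\<gamma>' t) \<le> (1 + e) * norm (\<gamma>' t0)"
    "\<And>s t. s \<in> ball t0 d \<Longrightarrow> t \<in> ball t0 d \<Longrightarrow>
       (1 - e) * norm (\<gamma>' t0) * dist s t \<le> dist (\<gamma> s) (\<gamma> t) \<and> dist (\<gamma> s) (\<gamma> t) \<le> (1 + e) * norm (\<gamma>' t0) * dist s t"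
proof -
  define c where "c = norm (\<gamma>' t0)"
  have c: "c > 0" using nz by (simp add: c_def)
  obtain d1 where d1: "d1 > 0" "ball t0 d1 \<subseteq> T" using T open_contains_ball by blast
  obtain d2 where d2: "d2 > 0" "\<And>t. t \<in> T \<Longrightarrow> dist t t0 < d2 \<Longrightarrow> dist (\<gamma>' t) (\<gamma>' t0) < e * c"
    using cont T(2) c e unfolding continuous_on_iff by (metis mult_pos_pos)
  define d where "d = min d1 d2"
  have d: "d > 0" "ball t0 d \<subseteq> T" using d1 d2 by (auto simp: d_def)
  have near: "norm (\<gamma>' t - \<gamma>' t0) \<le> e * c" if "t \<in> ball t0 d" for t
  proof -
    have "dist t t0 < d2" "t \<in> T" using that d(2) by (auto simp: d_def dist_commute)
    then show ?thesis using d2(2)[of t] by (simp add: dist_norm)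
  qed
  have lin: "norm ((\<gamma> s - s *\<^sub>R \<gamma>' t0) - (\<gamma> t - t *\<^sub>R \<gamma>' t0)) \<le> (e * c) * norm (s - t)"
    if st: "s \<in> ball t0 d" "t \<in> ball t0 d" for s t
  proof (rule differentiable_bound[where S = "ball t0 d" and f' = "\<lambda>u h. h *\<^sub>R (\<gamma>' u - \<gamma>' t0)"])
    fix u assume u: "u \<in> ball t0 d"
    have "((\<lambda>u. \<gamma> u - u *\<^sub>R \<gamma>' t0) has_vector_derivative \<gamma>' u - 1 *\<^sub>R \<gamma>' t0) (at u)"
      using der[of u] d(2) u by (auto intro!: derivative_eq_intros)
    then show "((\<lambda>u. \<gamma> u - u *\<^sub>R \<gamma>' t0) has_derivative (\<lambda>h. h *\<^sub>R (\<gamma>' u - \<gamma>' t0))) (at u within ball t0 d)"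
      by (simp add: has_vector_derivative_def has_derivative_at_withinI)
    show "onorm (\<lambda>h. h *\<^sub>R (\<gamma>' u - \<gamma>' t0)) \<le> e * c"
      using near[OF u] e c by (intro onorm_bound) (auto simp: mult.commute[of _ "\<bar>_\<bar>"] intro: mult_left_mono)
  qed (use st in auto)
  show thesis
  proof (rule that[OF d])
    fix t assume "t \<in> ball t0 d"
    then show "(1 - e) * norm (\<gamma>' t0) \<le> norm (\<gamma>' t) \<and> norm (\<gamma>' t) \<le> (1 + e) * norm (\<gamma>' t0)"
      using near[of t] norm_triangle_ineq2[of "\<gamma>' t" "\<gamma>' t0"] norm_triangle_ineq2[of "\<gamma>' t0" "\<gamma>' t"]
      by (auto simp: c_def algebra_simps norm_minus_commute)
  next
    fix s t assume st: "s \<in> ball t0 d" "t \<in> ball t0 d"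
    define A B where "A = \<gamma> s - \<gamma> t" and "B = (s - t) *\<^sub>R \<gamma>' t0"
    have AB: "norm (A - B) \<le> e * c * dist s t" "norm B = c * dist s t"
      using lin[OF st] by (simp add: A_def B_def dist_real_def algebra_simps)
        (simp add: B_def c_def dist_real_def)
    have "norm A \<le> norm B + norm (A - B)" "norm B \<le> norm A + norm (A - B)"
      using norm_triangle_sub[of A B] norm_triangle_sub[of B A] by (auto simp: norm_minus_commute)
    then show "(1 - e) * norm (\<gamma>' t0) * dist s t \<le> dist (\<gamma> s) (\<gamma> t) \<and> dist (\<gamma> s) (\<gamma> t) \<le> (1 + e) * norm (\<gamma>' t0) * dist s t"
      using AB by (auto simp: A_def c_def dist_norm[of "\<gamma> s"] algebra_simps)
  qed
qed

text \<open>Both sides come from measures on the parameter line: \<open>N1\<close> transports arc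
  length by the left inverse \<open>\<phi>\<close>, and \<open>N2\<close> has density
  \<open>norm (\<gamma>' t)\<close>. On a short interval both lie between \<open>(1 - e) c\<close>
  and \<open>(1 + e) c\<close> times Lebesgue measure, with \<open>c\<close> the speed at the
  centre, so each dominates the other up to a factor close to 1 and they coincide. The map
  \<open>\<phi>\<close> encodes injectivity of the curve together with measurability of its
  inverse.\<close>

lemma nn_integral_hausdorff1_curve:
  fixes \<gamma> \<gamma>' :: "real \<Rightarrow> 'a::euclidean_space"
  assumes T: "open T" and der: "\<And>t. t \<in> T \<Longrightarrow> (\<gamma> has_vector_derivative \<gamma>' t) (at t)"
    and cont: "continuous_on T \<gamma>'" and nz: "\<And>t. t \<in> T \<Longrightarrow> \<gamma>' t \<noteq> 0"
    and \<phi> [measurable]: "\<phi> \<in> borel_measurable borel" and inv: "\<And>t. t \<in> T \<Longrightarrow> \<phi> (\<gamma> t) = t"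
    and im [measurable]: "\<gamma> ` T \<in> sets borel" and f [measurable]: "f \<in> borel_measurable borel"
  shows "(\<integral>\<^sup>+z. f z * indicator (\<gamma> ` T) z \<partial>hausdorff1)
       = (\<integral>\<^sup>+t. f (\<gamma> t) * ennreal (norm (\<gamma>' t)) * indicator T t \<partial>lborel)"
proof -
  have Ts [measurable]: "T \<in> sets borel" using T by auto
  have cg: "continuous_on T \<gamma>"
    using der has_vector_derivative_continuous by (fastforce intro: continuous_at_imp_continuous_on)
  have [measurable]: "(\<lambda>t. indicator T t *\<^sub>R \<gamma> t) \<in> borel_measurable borel"
    "(\<lambda>t. indicator T t *\<^sub>R \<gamma>' t) \<in> borel_measurable borel"
    using cg cont by (auto intro: borel_measurable_continuous_on_indicator)
  have g'eq: "ennreal (norm (\<gamma>' t)) * indicator T t = ennreal (norm (indicator T t *\<^sub>R \<gamma>' t))" for t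
    by (auto simp: indicator_def)
  have g'm [measurable]: "(\<lambda>t. ennreal (norm (\<gamma>' t)) * indicator T t) \<in> borel_measurable borel"
    unfolding g'eq by measurable
  have feq: "f (\<gamma> t) * indicator T t = f (indicator T t *\<^sub>R \<gamma> t) * indicator T t" for t
    by (auto simp: indicator_def)
  have fm [measurable]: "(\<lambda>t. f (\<gamma> t) * indicator T t) \<in> borel_measurable borel"
    unfolding feq by measurable
  define N1 where "N1 = distr (density hausdorff1 (indicator (\<gamma> ` T))) borel \<phi>"
  define N2 where "N2 = density lborel (\<lambda>t. ennreal (norm (\<gamma>' t)) * indicator T t)"
  have N1: "emeasure N1 A = hausdorff1_outer (\<gamma> ` (A \<inter> T))" if A [measurable]: "A \<in> sets borel" for A
  proof -
    have eq: "\<gamma> ` (A \<inter> T) = \<gamma> ` T \<inter> \<phi> -` A" using inv by auto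
    have m [measurable]: "\<phi> -` A \<in> sets borel" using measurable_sets[OF \<phi> A] by simp
    have "emeasure N1 A = emeasure (density hausdorff1 (indicator (\<gamma> ` T))) (\<phi> -` A)"
      unfolding N1_def by (subst emeasure_distr) auto
    also have "\<dots> = emeasure hausdorff1 (\<gamma> ` T \<inter> \<phi> -` A)"
      by (subst emeasure_density) (auto simp: nn_integral_indicator simp flip: indicator_inter_arith)
    also have "\<dots> = hausdorff1_outer (\<gamma> ` (A \<inter> T))"
      unfolding eq by (rule emeasure_hausdorff1) measurable
    finally show ?thesis .
  qed
  have N2: "emeasure N2 A = (\<integral>\<^sup>+t. ennreal (norm (\<gamma>' t)) * indicator (A \<inter> T) t \<partial>lborel)"
    if A [measurable]: "A \<in> sets borel" for A
  proof -
    have "emeasure N2 A = (\<integral>\<^sup>+t. ennreal (norm (\<gamma>' t)) * indicator T t * indicator A t \<partial>lborel)"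
      unfolding N2_def by (rule emeasure_density) auto
    then show ?thesis by (simp add: indicator_inter_arith mult_ac)
  qed
  have setsN: "sets N1 = sets borel" "sets N2 = sets borel" by (auto simp: N1_def N2_def)
  have loc: "\<exists>U. open U \<and> t0 \<in> U \<and> (\<forall>A\<in>sets borel. A \<subseteq> U \<inter> T \<longrightarrow>
       emeasure N1 A \<le> ennreal (1 + E) * emeasure N2 A \<and> emeasure N2 A \<le> ennreal (1 + E) * emeasure N1 A)"
    if t0: "t0 \<in> T" and E: "E > 0" for t0 E
  proof -
    \<comment> \<open>Chosen so that \<open>(1 + e) / (1 - e) = 1 + E\<close>, the ratio of the
      upper and the lower bound.\<close>
    define e where "e = E / (2 + E)"
    have e: "e > 0" "e < 1" and eE: "(1 + e) = (1 + E) * (1 - e)" using E by (auto simp: e_def field_simps)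
    define c where "c = norm (\<gamma>' t0)"
    have c: "c > 0" using nz[OF t0] by (simp add: c_def)
    obtain d where d: "d > 0" "ball t0 d \<subseteq> T"
      "\<And>t. t \<in> ball t0 d \<Longrightarrow> (1 - e) * c \<le> norm (\<gamma>' t) \<and> norm (\<gamma>' t) \<le> (1 + e) * c"
      "\<And>s t. s \<in> ball t0 d \<Longrightarrow> t \<in> ball t0 d \<Longrightarrow>
       (1 - e) * c * dist s t \<le> dist (\<gamma> s) (\<gamma> t) \<and> dist (\<gamma> s) (\<gamma> t) \<le> (1 + e) * c * dist s t"
      unfolding c_def
      using C1_curve_locally_bilipschitz[OF T t0 der cont nz[OF t0] e(1)] by blast
    have "emeasure N1 A \<le> ennreal (1 + E) * emeasure N2 A \<and> emeasure N2 A \<le> ennreal (1 + E) * emeasure N1 A"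
      if A [measurable]: "A \<in> sets borel" and AU: "A \<subseteq> ball t0 d \<inter> T" for A
    proof -
      have AT: "A \<inter> T = A" using AU by blast
      have lA: "hausdorff1_outer A = emeasure lborel A" by (rule hausdorff1_outer_real[OF A])
      have pos: "(1 + e) * c > 0" "(1 - e) * c > 0" using e c by auto
      have up1: "emeasure N1 A \<le> ennreal ((1 + e) * c) * emeasure lborel A"
        unfolding N1[OF A] AT lA[symmetric]
      proof (rule hausdorff1_outer_lipschitz_image[OF pos(1)])
        fix x y assume "x \<in> A" "y \<in> A"
        then show "dist (\<gamma> x) (\<gamma> y) \<le> (1 + e) * c * dist x y" using d(4) AU by blast
      qed
      have lo1: "ennreal ((1 - e) * c) * emeasure lborel A \<le> emeasure N1 A"
      proof -
        \<comment> \<open>The lower bound for the image is an upper bound for the inverse: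
          \<open>\<phi>\<close> is Lipschitz on the image of \<open>A\<close> with constant
          \<open>1 / ((1 - e) c)\<close> and carries it back to \<open>A\<close>.\<close>
        have eqA: "\<phi> ` \<gamma> ` A = A" using inv AU by (force simp: image_image)
        have "hausdorff1_outer (\<phi> ` \<gamma> ` A) \<le> ennreal (inverse ((1 - e) * c)) * hausdorff1_outer (\<gamma> ` A)"
        proof (rule hausdorff1_outer_lipschitz_image)
          fix x y assume "x \<in> \<gamma> ` A" "y \<in> \<gamma> ` A"
          then obtain s t where st: "s \<in> A" "t \<in> A" "x = \<gamma> s" "y = \<gamma> t" by auto
          then have "(1 - e) * c * dist s t \<le> dist x y" using d(4) AU by blast
          then show "dist (\<phi> x) (\<phi> y) \<le> inverse ((1 - e) * c) * dist x y"
            using st inv AU pos by (auto simp: field_simps subset_iff)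
        qed (use pos in \<open>simp only: positive_imp_inverse_positive\<close>)
        then have "ennreal ((1 - e) * c) * emeasure lborel A
            \<le> ennreal ((1 - e) * c) * (ennreal (inverse ((1 - e) * c)) * hausdorff1_outer (\<gamma> ` A))"
          unfolding eqA lA by (rule mult_left_mono) simp
        also have "\<dots> = emeasure N1 A"
        proof -
          have "ennreal ((1 - e) * c) * ennreal (inverse ((1 - e) * c)) = 1"
            using pos by (subst ennreal_mult[symmetric]) (auto simp del: inverse_mult_distrib intro!: right_inverse)
          then show ?thesis by (simp add: N1[OF A] AT flip: mult.assoc del: inverse_mult_distrib)
        qed
        finally show ?thesis .
      qed
      have up2: "emeasure N2 A \<le> ennreal ((1 + e) * c) * emeasure lborel A"
      proof -
        have "emeasure N2 A \<le> (\<integral>\<^sup>+t. ennreal ((1 + e) * c) * indicator A t \<partial>lborel)"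
          unfolding N2[OF A] AT using d(3) AU
          by (intro nn_integral_mono) (auto simp: indicator_def intro!: ennreal_leI)
        then show ?thesis by (simp add: nn_integral_cmult_indicator)
      qed
      have lo2: "ennreal ((1 - e) * c) * emeasure lborel A \<le> emeasure N2 A"
      proof -
        have "(\<integral>\<^sup>+t. ennreal ((1 - e) * c) * indicator A t \<partial>lborel) \<le> emeasure N2 A"
          unfolding N2[OF A] AT using d(3) AU
          by (intro nn_integral_mono) (auto simp: indicator_def intro!: ennreal_leI)
        then show ?thesis by (simp add: nn_integral_cmult_indicator)
      qed
      have k: "ennreal ((1 + e) * c) = ennreal (1 + E) * ennreal ((1 - e) * c)"
      proof -
        have "(1 + e) * c = (1 + E) * ((1 - e) * c)" by (simp only: eE mult.assoc)
        then show ?thesis using E pos(2) by (simp only:) (rule ennreal_mult, auto)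
      qed
      show ?thesis
      proof
        have "emeasure N1 A \<le> ennreal (1 + E) * (ennreal ((1 - e) * c) * emeasure lborel A)"
          using up1 unfolding k by (simp add: mult.assoc)
        also have "\<dots> \<le> ennreal (1 + E) * emeasure N2 A" by (rule mult_left_mono[OF lo2]) simp
        finally show "emeasure N1 A \<le> ennreal (1 + E) * emeasure N2 A" .
        have "emeasure N2 A \<le> ennreal (1 + E) * (ennreal ((1 - e) * c) * emeasure lborel A)"
          using up2 unfolding k by (simp add: mult.assoc)
        also have "\<dots> \<le> ennreal (1 + E) * emeasure N1 A" by (rule mult_left_mono[OF lo1]) simp
        finally show "emeasure N2 A \<le> ennreal (1 + E) * emeasure N1 A" .
      qed
    qed
    then show ?thesis using d(1) by (intro exI[of _ "ball t0 d"]) auto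
  qed
  have "N1 = N2"
  proof (rule measure_eqI)
    fix A assume "A \<in> sets N1"
    then have A: "A \<in> sets borel" using setsN by simp
    have AT: "A \<inter> T \<in> sets borel" using A by auto
    have "emeasure N1 A = emeasure N1 (A \<inter> T)" using A AT by (simp add: N1)
    also have "\<dots> = emeasure N2 (A \<inter> T)"
    proof (rule antisym)
      show "emeasure N1 (A \<inter> T) \<le> emeasure N2 (A \<inter> T)"
      proof (rule emeasure_le_if_locally_le[OF setsN T _ AT])
        fix t0 E :: real assume "t0 \<in> T" "E > 0"
        from loc[OF this] show "\<exists>U. open U \<and> t0 \<in> U \<and> (\<forall>A\<in>sets borel. A \<subseteq> U \<inter> T \<longrightarrow>
          emeasure N1 A \<le> ennreal (1 + E) * emeasure N2 A)" by meson
      qed simp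
      show "emeasure N2 (A \<inter> T) \<le> emeasure N1 (A \<inter> T)"
      proof (rule emeasure_le_if_locally_le[OF setsN(2,1) T _ AT])
        fix t0 E :: real assume "t0 \<in> T" "E > 0"
        from loc[OF this] show "\<exists>U. open U \<and> t0 \<in> U \<and> (\<forall>A\<in>sets borel. A \<subseteq> U \<inter> T \<longrightarrow>
          emeasure N2 A \<le> ennreal (1 + E) * emeasure N1 A)" by meson
      qed simp
    qed
    also have "\<dots> = emeasure N2 A" using A AT by (simp add: N2)
    finally show "emeasure N1 A = emeasure N2 A" .
  qed (simp add: setsN)
  have "(\<integral>\<^sup>+z. f z * indicator (\<gamma> ` T) z \<partial>hausdorff1)
      = (\<integral>\<^sup>+z. indicator (\<gamma> ` T) z * (f (\<gamma> (\<phi> z)) * indicator T (\<phi> z)) \<partial>hausdorff1)"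
    using inv by (intro nn_integral_cong) (auto simp: indicator_def)
  also have "\<dots> = (\<integral>\<^sup>+z. f (\<gamma> (\<phi> z)) * indicator T (\<phi> z) \<partial>density hausdorff1 (indicator (\<gamma> ` T)))"
    using measurable_compose[OF \<phi> fm] by (subst nn_integral_density) auto
  also have "\<dots> = (\<integral>\<^sup>+t. f (\<gamma> t) * indicator T t \<partial>N1)"
    unfolding N1_def using fm by (subst nn_integral_distr) auto
  also have "\<dots> = (\<integral>\<^sup>+t. ennreal (norm (\<gamma>' t)) * indicator T t * (f (\<gamma> t) * indicator T t) \<partial>lborel)"
    unfolding \<open>N1 = N2\<close> N2_def by (subst nn_integral_density) auto
  also have "\<dots> = (\<integral>\<^sup>+t. f (\<gamma> t) * ennreal (norm (\<gamma>' t)) * indicator T t \<partial>lborel)"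
    by (intro nn_integral_cong) (auto simp: indicator_def mult.commute)
  finally show ?thesis .
qed

section \<open>Resultants\<close>

lemma cpoly_mult: "cpoly (p * q) = cpoly p * cpoly q"
  by (rule poly_eqI) (simp add: coeff_map_poly coeff_mult)

text \<open>A vector killed by the transpose is the coefficient list of a nonzero polynomial of
  degree below \<open>m\<close> that vanishes at \<open>m\<close> distinct points.\<close>

lemma det_vandermonde_nonzero:
  fixes \<alpha> :: "nat \<Rightarrow> 'a::field"
  assumes inj: "inj_on \<alpha> {..<m}"
  shows "det (Matrix.mat m m (\<lambda>(i, c). \<alpha> c ^ i)) \<noteq> 0"
proof
  let ?A = "Matrix.mat m m (\<lambda>(i, c). \<alpha> c ^ i)"
  assume "det ?A = 0"
  then have "det (transpose_mat ?A) = 0" by (subst det_transpose[of _ m]) auto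
  then obtain v where v: "v \<in> carrier_vec m" "v \<noteq> 0\<^sub>v m" "transpose_mat ?A *\<^sub>v v = 0\<^sub>v m"
    using det_0_iff_vec_prod_zero[of "transpose_mat ?A" m] by auto
  define p where "p = (\<Sum>i<m. monom (v $ i) i)"
  have cp: "coeff p i = v $ i" if "i < m" for i
    using that by (simp add: p_def coeff_sum)
  have p0: "p \<noteq> 0"
  proof
    assume "p = 0"
    then have "v = 0\<^sub>v m" using cp v(1) by (intro eq_vecI) auto
    with v(2) show False by simp
  qed
  have root: "poly p (\<alpha> c) = 0" if "c < m" for c
  proof -
    have "(transpose_mat ?A *\<^sub>v v) $ c = (\<Sum>i<m. \<alpha> c ^ i * v $ i)"
      using that v(1) by (simp add: scalar_prod_def atLeast0LessThan)
    then show ?thesis using v(3) that by (simp add: p_def poly_sum poly_monom mult.commute)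
  qed
  have m0: "m > 0" using p0 by (auto simp: p_def intro: gr0I)
  have deg: "degree p < m"
  proof -
    have "degree p \<le> m - 1"
      unfolding p_def by (intro degree_sum_le) (auto intro: order_trans[OF degree_monom_le])
    with m0 show ?thesis by simp
  qed
  have "m = card (\<alpha> ` {..<m})" using inj by (simp add: card_image)
  also have "\<dots> \<le> card {x. poly p x = 0}"
    using root by (intro card_mono poly_roots_finite p0) auto
  also have "\<dots> \<le> degree p" by (rule card_poly_roots_bound[OF p0])
  finally show False using deg by simp
qed

text \<open>
  The Sylvester matrix of \<open>Q\<close> and \<open>V\<close> times the matrix whose first columns are the powers of the
  roots of \<open>V\<close> and whose last columns are unit vectors is block triangular.
\<close>

lemma lead_coeff_power_prod_poly_roots_Ints:
  fixes V Q :: "int poly" and \<alpha> :: "nat \<Rightarrow> complex"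
  assumes m: "degree V = m" and n: "degree Q \<le> n" and inj: "inj_on \<alpha> {..<m}"
    and root: "\<And>c. c < m \<Longrightarrow> poly (cpoly V) (\<alpha> c) = 0"
  shows "of_int (lead_coeff V) ^ n * (\<Prod>c<m. poly (cpoly Q) (\<alpha> c)) \<in> \<int>"
proof -
  define row where "row i = (if i < m then monom 1 i * Q else monom 1 (i - m) * V)" for i
  define S where "S = Matrix.mat (m + n) (m + n) (\<lambda>(i, j). coeff (row i) j)"
  define SC where "SC = (map_mat of_int S :: complex mat)"
  define A where "A = Matrix.mat m m (\<lambda>(i, c). \<alpha> c ^ i)"
  define W where "W = four_block_mat A (0\<^sub>m m n) (Matrix.mat n m (\<lambda>(i, c). \<alpha> c ^ (i + m))) (1\<^sub>m n)"
  define D where "D = mat_diag m (\<lambda>c. poly (cpoly Q) (\<alpha> c))"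
  define B where "B = Matrix.mat m n (\<lambda>(i, c). of_int (coeff (row i) (c + m)) :: complex)"
  define Tr where "Tr = Matrix.mat n n (\<lambda>(i, c). of_int (coeff (row (i + m)) (c + m)) :: complex)"
  have car [simp]: "A \<in> carrier_mat m m" "D \<in> carrier_mat m m" "B \<in> carrier_mat m n" "Tr \<in> carrier_mat n n"
    "SC \<in> carrier_mat (m + n) (m + n)" "W \<in> carrier_mat (m + n) (m + n)" "S \<in> carrier_mat (m + n) (m + n)"
    by (auto simp: A_def D_def B_def Tr_def SC_def W_def S_def)
  have degrow: "degree (row i) < m + n" if "i < m + n" for i
  proof (cases "i < m")
    case True
    have "degree (row i) \<le> i + degree Q"
      using True degree_mult_le[of "monom 1 i" Q] degree_monom_le[of "1::int" i] by (auto simp: row_def)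
    with True n show ?thesis by simp
  next
    case False
    have "degree (row i) \<le> (i - m) + m"
      using False m degree_mult_le[of "monom 1 (i - m)" V] degree_monom_le[of "1::int" "i - m"] by (auto simp: row_def)
    with False that show ?thesis by simp
  qed
  have prow: "(\<Sum>j<m + n. of_int (coeff (row i) j) * x ^ j) = poly (cpoly (row i)) x" if "i < m + n" for i and x :: complex
  proof -
    have "poly (cpoly (row i)) x = (\<Sum>j\<le>degree (cpoly (row i)). of_int (coeff (row i) j) * x ^ j)"
      by (simp add: poly_altdef coeff_map_poly)
    also have "\<dots> = (\<Sum>j<m + n. of_int (coeff (row i) j) * x ^ j)"
    proof (rule sum.mono_neutral_left)
      show "{..degree (cpoly (row i))} \<subseteq> {..<m + n}"
        using degrow[OF that] map_poly_degree_leq[of of_int "row i"] by (auto intro: le_less_trans order_trans)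
      show "\<forall>j\<in>{..<m + n} - {..degree (cpoly (row i))}. of_int (coeff (row i) j) * x ^ j = 0"
      proof
        fix j assume "j \<in> {..<m + n} - {..degree (cpoly (row i))}"
        then have "coeff (cpoly (row i)) j = 0" by (intro coeff_eq_0) auto
        then show "of_int (coeff (row i) j) * x ^ j = 0" by (simp add: coeff_map_poly)
      qed
    qed simp
    finally show ?thesis by simp
  qed
  have Wij: "W $$ (j, c) = (if c < m then \<alpha> c ^ j else if j = c then 1 else 0)"
    if "j < m + n" "c < m + n" for j c
    using that by (auto simp: W_def A_def)
  \<comment> \<open>Row \<open>i\<close> of \<open>SC\<close> against column \<open>c < m\<close> of
    \<open>W\<close> is the polynomial \<open>row i\<close> evaluated at \<open>\<alpha> c\<close>,
    which is \<open>\<alpha> c ^ i\<close> times the value of \<open>Q\<close> in the upper rows and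
    0 in the lower ones, where \<open>V\<close> is a factor. The unit vectors in \<open>W\<close>
    copy the last \<open>n\<close> columns of \<open>SC\<close>.\<close>
  have eq: "SC * W = four_block_mat (A * D) B (0\<^sub>m n m) Tr"
  proof (rule eq_matI)
    fix i c assume "i < dim_row (four_block_mat (A * D) B (0\<^sub>m n m) Tr)"
      "c < dim_col (four_block_mat (A * D) B (0\<^sub>m n m) Tr)"
    then have ic: "i < m + n" "c < m + n" by (auto simp: A_def D_def Tr_def mat_diag_def)
    have L: "(SC * W) $$ (i, c) = (\<Sum>j<m + n. of_int (coeff (row i) j) * W $$ (j, c))"
      using ic car(5,6) by (simp add: scalar_prod_def SC_def S_def atLeast0LessThan carrier_matD[OF car(6)])
    show "(SC * W) $$ (i, c) = four_block_mat (A * D) B (0\<^sub>m n m) Tr $$ (i, c)"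
    proof (cases "c < m")
      case True
      have "(SC * W) $$ (i, c) = poly (cpoly (row i)) (\<alpha> c)"
        unfolding L using True ic by (subst prow[OF ic(1), symmetric]) (auto simp: Wij intro!: sum.cong)
      also have "\<dots> = (if i < m then \<alpha> c ^ i * poly (cpoly Q) (\<alpha> c) else 0)"
        using root[OF True] by (simp add: row_def cpoly_mult map_poly_monom poly_monom)
      also have "\<dots> = four_block_mat (A * D) B (0\<^sub>m n m) Tr $$ (i, c)"
      proof -
        have "(A * D) $$ (i, c) = \<alpha> c ^ i * poly (cpoly Q) (\<alpha> c)" if "i < m"
          unfolding D_def using that True by (subst mat_diag_mult_right[of _ m]) (auto simp: A_def)
        then show ?thesis using True ic by (auto simp: B_def Tr_def D_def A_def mat_diag_def)
      qed
      finally show ?thesis .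
    next
      case False
      have "(SC * W) $$ (i, c) = (\<Sum>j<m + n. if j = c then of_int (coeff (row i) j) else 0)"
        unfolding L using False ic by (intro sum.cong) (auto simp: Wij)
      also have "\<dots> = of_int (coeff (row i) c)" using ic by simp
      also have "\<dots> = four_block_mat (A * D) B (0\<^sub>m n m) Tr $$ (i, c)"
        using False ic by (auto simp: B_def Tr_def D_def A_def mat_diag_def)
      finally show ?thesis .
    qed
  qed (auto simp: SC_def S_def W_def A_def B_def Tr_def D_def mat_diag_def)
  have detW: "det W = det A"
    unfolding W_def by (subst det_four_block_mat_upper_right_zero[of _ m _ n]) (auto simp: det_one)
  \<comment> \<open>\<open>x^i V\<close> has degree exactly \<open>i + m\<close>, so in the columns
    from \<open>m\<close> on the rows built from \<open>V\<close> form a lower triangle with the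
    leading coefficient on the diagonal.\<close>
  have detT: "det Tr = of_int (lead_coeff V) ^ n"
  proof -
    have "det Tr = prod_list (diag_mat Tr)"
    proof (rule det_lower_triangular)
      fix i j assume ij: "i < j" "j < n"
      then have "degree (row (i + m)) < j + m"
        using m degree_mult_le[of "monom 1 i" V] degree_monom_le[of "1::int" i] by (auto simp: row_def)
      then show "Tr $$ (i, j) = 0" using ij by (simp add: Tr_def coeff_eq_0)
    qed simp
    also have "diag_mat Tr = map (\<lambda>i. of_int (lead_coeff V)) [0..<n]"
      using m by (auto simp: diag_mat_def Tr_def row_def coeff_monom_mult)
    finally show ?thesis by (simp add: map_replicate_const)
  qed
  have detD: "det D = (\<Prod>c<m. poly (cpoly Q) (\<alpha> c))"
  proof -
    have "det D = prod_list (diag_mat D)"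
      by (rule det_upper_triangular[of _ m]) (auto simp: D_def mat_diag_def)
    also have "diag_mat D = map (\<lambda>c. poly (cpoly Q) (\<alpha> c)) [0..<m]"
      by (auto simp: diag_mat_def D_def mat_diag_def)
    finally show ?thesis by (simp add: prod.distinct_set_conv_list[symmetric] atLeast0LessThan)
  qed
  have "det SC * det A = det (SC * W)" by (subst det_mult[of _ "m + n"]) (auto simp: detW)
  also have "\<dots> = det (A * D) * det Tr"
    unfolding eq by (rule det_four_block_mat_lower_left_zero[of _ m _ n])
       (auto intro: mult_carrier_mat[of _ m m])
  also have "\<dots> = (det D * det Tr) * det A" by (subst det_mult[of _ m]) auto
  \<comment> \<open>\<open>det A\<close> is a Vandermonde determinant with distinct nodes and
    cancels; the left side is the determinant of an integer matrix.\<close>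
  finally have "det SC = det D * det Tr"
    using det_vandermonde_nonzero[OF inj] by (simp add: A_def)
  moreover have "det SC = of_int (det S)" unfolding SC_def by simp
  ultimately show ?thesis by (metis detD detT Ints_of_int mult.commute)
qed

section \<open>Logarithmic means over circles\<close>

text \<open>\<open>1 - c u\<close> has positive real part on the closed unit disc, so its principal
  logarithm is holomorphic there and its circle mean is the value \<open>Ln 1 = 0\<close> at the
  centre.\<close>

lemma has_integral_ln_cmod_one_minus_cis:
  assumes c: "cmod c < 1"
  shows "((\<lambda>t. ln (cmod (1 - c * cis t))) has_integral 0) {0..2*pi}"
proof -
  have re: "Re (1 - c * u) > 0" if "cmod u \<le> 1" for u
  proof -
    have "Re (c * u) \<le> cmod (c * u)" by (rule complex_Re_le_cmod)
    also have "\<dots> \<le> cmod c * 1" unfolding norm_mult using that by (intro mult_left_mono) auto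
    finally show ?thesis using c by simp
  qed
  have "(\<lambda>u. Ln (1 - c * u)) holomorphic_on cball 0 1"
    using re by (intro holomorphic_intros) (force simp: complex_nonpos_Reals_iff)
  from Cauchy_integral_circlepath_simple[OF this, of 0]
  have "((\<lambda>u. Ln (1 - c * u) / u) has_contour_integral 0) (circlepath 0 1)" by simp
  then have "((\<lambda>t. Ln (1 - c * cis t) / cis t * 1 * \<i> * cis t) has_integral 0) {0..2*pi}"
    unfolding circlepath_def by (subst (asm) has_contour_integral_part_circlepath_iff) auto
  then have "((\<lambda>t. Ln (1 - c * cis t) * \<i>) has_integral 0) {0..2*pi}"
    by (rule has_integral_eq[rotated]) simp
  \<comment> \<open>Along the circle \<open>du / u = \<i> dt\<close>, so the imaginary part of the
    contour integral is the integral of the real part of the logarithm.\<close>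
  from has_integral_Im[OF this] have "((\<lambda>t. Re (Ln (1 - c * cis t))) has_integral 0) {0..2*pi}" by simp
  then show ?thesis
  proof (rule has_integral_eq[rotated])
    fix t
    have "1 - c * cis t \<noteq> 0" using re[of "cis t"] by (metis less_irrefl norm_cis order_refl zero_complex.sel(1))
    then show "Re (Ln (1 - c * cis t)) = ln (cmod (1 - c * cis t))" by simp
  qed
qed

text \<open>Factoring out the larger of \<open>r\<close> and \<open>|w|\<close> leaves
  \<open>|1 - c cis t|\<close> with \<open>|c| < 1\<close>, whose logarithm has mean zero.\<close>

lemma has_integral_ln_cmod_minus_circle:
  assumes r: "r > 0" and w: "w \<noteq> 0" "cmod w \<noteq> r"
  shows "((\<lambda>t. ln (cmod (w - complex_of_real r * cis t))) has_integral 2 * pi * ln (max r (cmod w))) {0..2*pi}"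
proof -
  obtain c where c: "cmod c < 1" "\<And>t. cmod (w - complex_of_real r * cis t) = max r (cmod w) * cmod (1 - c * cis t)"
  proof (cases "cmod w < r")
    case True
    \<comment> \<open>Taking out \<open>- r cis t\<close> leaves \<open>1 - (w/r) cis (-t)\<close>;
      conjugation preserves the modulus and turns \<open>cis (-t)\<close> into \<open>cis t\<close>
      and \<open>w\<close> into \<open>cnj w\<close>.\<close>
    show ?thesis
    proof (rule that[of "cnj w / of_real r"])
      show "cmod (cnj w / of_real r) < 1" using True r by (simp add: norm_divide)
      fix t
      have "w - complex_of_real r * cis t = - (cis t * (r * cnj (1 - cnj w / of_real r * cis t)))"
        using r by (simp add: algebra_simps cis_cnj flip: cis_inverse)
      then have "cmod (w - complex_of_real r * cis t) = r * cmod (cnj (1 - cnj w / of_real r * cis t))"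
        using r by (simp only: norm_minus_cancel norm_mult norm_cis norm_of_real)
      then show "cmod (w - complex_of_real r * cis t) = max r (cmod w) * cmod (1 - cnj w / of_real r * cis t)"
        using True by (simp only: complex_mod_cnj max.absorb1 less_imp_le)
    qed
  next
    case False
    show ?thesis
    proof (rule that[of "of_real r / w"])
      show "cmod (of_real r / w) < 1" using False r w by (simp add: norm_divide)
      fix t
      have "w - complex_of_real r * cis t = w * (1 - of_real r / w * cis t)"
        using w by (simp add: field_simps)
      then show "cmod (w - complex_of_real r * cis t) = max r (cmod w) * cmod (1 - of_real r / w * cis t)"
        using False by (simp only: norm_mult max.absorb2 not_less)
    qed
  qed
  have nz: "cmod (1 - c * cis t) > 0" for t
  proof -
    have "cmod (c * cis t) < 1" using c(1) by (simp add: norm_mult)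
    then show ?thesis by auto
  qed
  have "((\<lambda>t. ln (max r (cmod w)) + ln (cmod (1 - c * cis t))) has_integral
     2 * pi * ln (max r (cmod w)) + 0) {0..2*pi}"
    using has_integral_const_real[of "ln (max r (cmod w))" 0 "2*pi"]
    by (intro has_integral_add has_integral_ln_cmod_one_minus_cis[OF c(1)]) simp
  moreover have "ln (max r (cmod w)) + ln (cmod (1 - c * cis t)) = ln (cmod (w - complex_of_real r * cis t))" for t
    unfolding c(2) using r nz[of t] by (subst ln_mult) auto
  ultimately show ?thesis by simp
qed

text \<open>Off the circle this follows from the exact mean. On the circle the integrand is
  unbounded near the parameter of \<open>w\<close>, and Fatou's lemma along points approaching
  \<open>w\<close> radially from outside gives the inequality; subtracting from \<open>K\<close>
  makes all integrands nonnegative.\<close>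

lemma nn_integral_ln_cmod_minus_circle_le:
  assumes r: "r > 0" and w: "w \<noteq> 0" and K: "K \<ge> ln (1 + 2 * (cmod w + r))"
  shows "(\<integral>\<^sup>+t. ennreal (K - ln (cmod (w - complex_of_real r * cis t))) * indicator {0..2*pi} t \<partial>lborel)
     \<le> ennreal (2 * pi * (K - ln (cmod w)))"
proof -
  have bound: "ln (cmod (v - complex_of_real r * cis t)) \<le> K" if "cmod v \<le> 2 * cmod w" for v t
  proof (cases "v - complex_of_real r * cis t = 0")
    case True
    have "0 \<le> ln (1 + 2 * (cmod w + r))" using r by simp
    then show ?thesis using True K by (simp del: eq_iff_diff_eq_0)
  next
    case False
    have "cmod (v - complex_of_real r * cis t) \<le> cmod v + r"
      using norm_triangle_ineq4[of v "complex_of_real r * cis t"] r by (simp add: norm_mult)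
    also have "\<dots> \<le> 1 + 2 * (cmod w + r)" using that r by simp
    finally have "ln (cmod (v - complex_of_real r * cis t)) \<le> ln (1 + 2 * (cmod w + r))"
      using False r by (subst ln_le_cancel_iff) (auto intro: add_pos_nonneg)
    then show ?thesis using K by linarith
  qed
  have eq: "(\<integral>\<^sup>+t. ennreal (K - ln (cmod (v - complex_of_real r * cis t))) * indicator {0..2*pi} t \<partial>lborel)
     = ennreal (2 * pi * (K - ln (max r (cmod v))))"
    if v: "v \<noteq> 0" "cmod v \<noteq> r" "cmod v \<le> 2 * cmod w" for v
  proof -
    have "((\<lambda>t. K - ln (cmod (v - complex_of_real r * cis t))) has_integral
       2 * pi * K - 2 * pi * ln (max r (cmod v))) {0..2*pi}"
      using has_integral_const_real[of K 0 "2*pi"]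
      by (intro has_integral_diff has_integral_ln_cmod_minus_circle[OF r v(1,2)]) simp
    then have "(\<integral>\<^sup>+t. indicator {0..2*pi} t * (K - ln (cmod (v - complex_of_real r * cis t))) \<partial>lborel)
        = ennreal (2 * pi * K - 2 * pi * ln (max r (cmod v)))"
      using bound[OF v(3)] by (intro nn_integral_has_integral_lebesgue) auto
    moreover have "(\<integral>\<^sup>+t. indicator {0..2*pi} t * (K - ln (cmod (v - complex_of_real r * cis t))) \<partial>lborel)
      = (\<integral>\<^sup>+t. ennreal (K - ln (cmod (v - complex_of_real r * cis t))) * indicator {0..2*pi} t \<partial>lborel)"
      by (intro nn_integral_cong) (auto simp: indicator_def)
    ultimately show ?thesis by (simp add: algebra_simps)
  qed
  show ?thesis
  proof (cases "cmod w = r")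
    case False
    have "ln (cmod w) \<le> ln (max r (cmod w))" using w r by simp
    then show ?thesis by (subst eq) (use w False in \<open>auto intro!: ennreal_leI mult_left_mono\<close>)
  next
    case True
    \<comment> \<open>Since \<open>1 + 1/(j + 1)\<close> exceeds 1 and is at most 2, every
      \<open>v j\<close> lies outside the circle and satisfies \<open>|v j| \<le> 2 |w|\<close>.
      This is the origin of the factor 2 in the condition on \<open>K\<close>.\<close>
    define v where "v j = of_real (1 + 1 / real (Suc j)) * w" for j
    have cv: "cmod (v j) = (1 + 1 / real (Suc j)) * r" for j
      unfolding v_def norm_mult norm_of_real True by simp
    have cvr: "cmod (v j) > r" for j unfolding cv using r by (simp add: field_simps)
    have cv2: "cmod (v j) \<le> 2 * cmod w" for j
      unfolding cv True using r by (intro mult_right_mono) auto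
    define f where "f j t = ennreal (K - ln (cmod (v j - complex_of_real r * cis t))) * indicator {0..2*pi} t" for j t
    have lim: "ennreal (K - ln (cmod (w - complex_of_real r * cis t))) * indicator {0..2*pi} t
        \<le> liminf (\<lambda>j. f j t)" for t
    proof (cases "w - complex_of_real r * cis t = 0")
      case True
      \<comment> \<open>At the singular parameter the convention \<open>ln 0 = 0\<close> gives the
        limit integrand the value \<open>K\<close>, and the approximants are at least
        \<open>K\<close> as soon as \<open>r / (j + 1) \<le> 1\<close>.\<close>
      then have wt: "w = complex_of_real r * cis t" by simp
      have "v j - complex_of_real r * cis t = of_real (1 / real (Suc j)) * w" for j
        unfolding v_def wt[symmetric] of_real_add by (simp add: algebra_simps)
      then have c: "cmod (v j - complex_of_real r * cis t) = r / real (Suc j)" for j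
        by (simp only: norm_mult norm_of_real \<open>cmod w = r\<close>) simp
      have "\<forall>\<^sub>F j in sequentially. r / real (Suc j) \<le> 1"
      proof -
        obtain N :: nat where "r \<le> real N" using real_arch_simple by blast
        then show ?thesis by (intro eventually_sequentiallyI[of N]) (auto simp: field_simps)
      qed
      then have "\<forall>\<^sub>F j in sequentially. ln (r / real (Suc j)) \<le> 0"
        by eventually_elim (use r in \<open>simp\<close>)
      then have "\<forall>\<^sub>F j in sequentially. ennreal (K - ln (cmod (w - complex_of_real r * cis t))) * indicator {0..2*pi} t \<le> f j t"
        unfolding f_def c True by eventually_elim (auto simp: indicator_def intro!: ennreal_leI)
      then show ?thesis by (rule Liminf_bounded)
    next
      case False
      have "(\<lambda>j. of_real (1 + 1 / real (Suc j)) * w) \<longlonglongrightarrow> of_real (1 + 0) * w"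
        by (intro tendsto_intros LIMSEQ_Suc[OF lim_inverse_n'])
      then have "v \<longlonglongrightarrow> w" unfolding v_def by simp
      then have "(\<lambda>j. f j t) \<longlonglongrightarrow> ennreal (K - ln (cmod (w - complex_of_real r * cis t))) * indicator {0..2*pi} t"
        unfolding f_def using False by (cases "t \<in> {0..2*pi}") (auto intro!: tendsto_intros tendsto_ennrealI)
      then show ?thesis by (simp add: lim_imp_Liminf)
    qed
    have "(\<integral>\<^sup>+t. ennreal (K - ln (cmod (w - complex_of_real r * cis t))) * indicator {0..2*pi} t \<partial>lborel)
       \<le> (\<integral>\<^sup>+t. liminf (\<lambda>j. f j t) \<partial>lborel)" by (intro nn_integral_mono lim)
    also have "\<dots> \<le> liminf (\<lambda>j. \<integral>\<^sup>+t. f j t \<partial>lborel)"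
    proof (rule nn_integral_liminf)
      have "continuous_on UNIV (\<lambda>t. K - ln (cmod (v j - complex_of_real r * cis t)))" for j
      proof (intro continuous_intros ballI)
        fix t show "cmod (v j - complex_of_real r * cis t) \<noteq> 0"
        proof
          assume "cmod (v j - complex_of_real r * cis t) = 0"
          then have "v j = complex_of_real r * cis t" by simp
          then have "cmod (v j) = r" using r by (simp add: norm_mult)
          with cvr[of j] show False by simp
        qed
      qed
      then have [measurable]: "(\<lambda>t. K - ln (cmod (v j - complex_of_real r * cis t))) \<in> borel_measurable borel" for j
        by (rule borel_measurable_continuous_onI)
      show "f j \<in> borel_measurable lborel" for j unfolding f_def by measurable
    qed
    also have "\<dots> = liminf (\<lambda>j. ennreal (2 * pi * (K - ln (cmod (v j)))))"
    proof -
      have "(\<integral>\<^sup>+t. f j t \<partial>lborel) = ennreal (2 * pi * (K - ln (cmod (v j))))" for j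
        unfolding f_def using eq[of "v j"] cvr[of j] cv2[of j] r by (simp add: max_def) force
      then show ?thesis by simp
    qed
    also have "\<dots> \<le> ennreal (2 * pi * (K - ln (cmod w)))"
    proof -
      have "liminf (\<lambda>j. ennreal (2 * pi * (K - ln (cmod (v j))))) \<le> liminf (\<lambda>j::nat. ennreal (2 * pi * (K - ln (cmod w))))"
      proof (intro Liminf_mono always_eventually allI ennreal_leI mult_left_mono diff_left_mono)
        fix j show "ln (cmod w) \<le> ln (cmod (v j))"
          using cvr[of j] r True by (subst ln_le_cancel_iff) linarith+
      qed auto
      then show ?thesis by (simp add: Liminf_const)
    qed
    finally show ?thesis .
  qed
qed

text \<open>The inequality is the sub-mean-value property of \<open>ln |w - u|\<close> at
  \<open>u = 0\<close>, with \<open>w\<close> allowed on the circle. Finiteness of the integral of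
  the nonnegative function \<open>K - ln |w - u|\<close> gives integrability, and its upper bound
  becomes a lower bound for the logarithm.\<close>

lemma
  assumes r: "r > 0" and w: "w \<noteq> 0"
  shows set_integrable_ln_cmod_minus_circle:
      "set_integrable lborel {0<..<2*pi} (\<lambda>t. ln (cmod (w - complex_of_real r * cis t)))"
    and set_integral_ln_cmod_minus_circle_ge:
      "2 * pi * ln (cmod w) \<le> (LINT t:{0<..<2*pi}|lborel. ln (cmod (w - complex_of_real r * cis t)))"
proof -
  define K where "K = ln (1 + 2 * (cmod w + r))"
  define g where "g t = K - ln (cmod (w - complex_of_real r * cis t))" for t
  have [measurable]: "cis \<in> borel_measurable borel"
    by (intro borel_measurable_continuous_onI continuous_intros)
  have gm [measurable]: "g \<in> borel_measurable borel" unfolding g_def by measurable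
  have g0: "g t \<ge> 0" for t
  proof (cases "w - complex_of_real r * cis t = 0")
    case True
    then show ?thesis using r unfolding g_def True K_def by simp
  next
    case False
    have "cmod (w - complex_of_real r * cis t) \<le> cmod w + r"
      using norm_triangle_ineq4[of w "complex_of_real r * cis t"] r by (simp add: norm_mult)
    also have "\<dots> \<le> 1 + 2 * (cmod w + r)" using r by simp
    finally have "ln (cmod (w - complex_of_real r * cis t)) \<le> K"
      unfolding K_def using False r by (subst ln_le_cancel_iff) (auto intro: add_pos_nonneg)
    then show ?thesis by (simp add: g_def)
  qed
  have le: "(\<integral>\<^sup>+t. ennreal (indicator {0<..<2*pi} t *\<^sub>R g t) \<partial>lborel) \<le> ennreal (2 * pi * (K - ln (cmod w)))"
  proof -
    have "(\<integral>\<^sup>+t. ennreal (indicator {0<..<2*pi} t *\<^sub>R g t) \<partial>lborel)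
      \<le> (\<integral>\<^sup>+t. ennreal (K - ln (cmod (w - complex_of_real r * cis t))) * indicator {0..2*pi} t \<partial>lborel)"
      by (rule nn_integral_mono) (auto simp: g_def indicator_def)
    also have "\<dots> \<le> ennreal (2 * pi * (K - ln (cmod w)))"
      by (rule nn_integral_ln_cmod_minus_circle_le[OF r w]) (simp add: K_def)
    finally show ?thesis .
  qed
  have gi: "set_integrable lborel {0<..<2*pi} g"
    unfolding set_integrable_def
  proof (rule integrableI_nonneg)
    show "AE t in lborel. 0 \<le> indicator {0<..<2*pi} t *\<^sub>R g t" using g0 by (simp add: indicator_def)
    show "(\<integral>\<^sup>+t. ennreal (indicator {0<..<2*pi} t *\<^sub>R g t) \<partial>lborel) < \<infinity>"
      using le by (rule le_less_trans) simp
  qed measurable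
  have K0: "0 \<le> K - ln (cmod w)"
  proof -
    have "ln (cmod w) \<le> K" unfolding K_def using w r by (subst ln_le_cancel_iff) (auto intro: add_pos_nonneg)
    then show ?thesis by simp
  qed
  have gle: "(LINT t:{0<..<2*pi}|lborel. g t) \<le> 2 * pi * (K - ln (cmod w))"
  proof -
    have "ennreal (LINT t:{0<..<2*pi}|lborel. g t) \<le> ennreal (2 * pi * (K - ln (cmod w)))"
      unfolding set_lebesgue_integral_def
      using gi g0 le by (subst nn_integral_eq_integral[symmetric]) (auto simp: set_integrable_def indicator_def)
    then show ?thesis using K0 by (simp add: ennreal_le_iff)
  qed
  have cI: "set_integrable lborel {0<..<2*pi} (\<lambda>t. K)"
    unfolding set_integrable_def by (auto intro!: integrable_mult_left integrable_real_indicator)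
  have eqg: "(\<lambda>t. ln (cmod (w - complex_of_real r * cis t))) = (\<lambda>t. K - g t)" by (auto simp: g_def)
  show "set_integrable lborel {0<..<2*pi} (\<lambda>t. ln (cmod (w - complex_of_real r * cis t)))"
    unfolding eqg by (rule set_integral_diff(1)[OF cI gi])
  have "(LINT t:{0<..<2*pi}|lborel. K) = 2 * pi * K"
    unfolding set_lebesgue_integral_def by simp
  then show "2 * pi * ln (cmod w) \<le> (LINT t:{0<..<2*pi}|lborel. ln (cmod (w - complex_of_real r * cis t)))"
    unfolding eqg using gle by (subst set_integral_diff(2)[OF cI gi]) (simp add: algebra_simps)
qed

lemma cis_eq_unique:
  assumes "s \<in> {0<..<2*pi}" "t \<in> {0<..<2*pi}" "cis s = cis t"
  shows "s = t"
  using assms Arg2pi_unique[of 1 s "cis s"] Arg2pi_unique[of 1 t "cis t"] by (auto simp: cis_conv_exp)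

lemma AE_circle_notin_finite:
  assumes "finite F" and r: "r > 0"
  shows "AE t in lborel. t \<in> {0<..<2*pi} \<longrightarrow> complex_of_real r * cis t \<notin> F"
proof -
  have "finite {t \<in> {0<..<2*pi}. complex_of_real r * cis t \<in> F}"
  proof (rule inj_on_finite[OF _ _ \<open>finite F\<close>])
    show "inj_on (\<lambda>t. complex_of_real r * cis t) {t \<in> {0<..<2*pi}. complex_of_real r * cis t \<in> F}"
      using r cis_eq_unique by (auto simp: inj_on_def)
  qed auto
  then have "{t \<in> {0<..<2*pi}. complex_of_real r * cis t \<in> F} \<in> null_sets lborel"
    by (rule finite_imp_null_set_lborel)
  then show ?thesis by (rule AE_I') auto
qed

section \<open>Level curves of polynomials\<close>

lemma borel_measurable_poly_complex [measurable]: "poly p \<in> borel_measurable (borel :: complex measure)"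
  by (intro borel_measurable_continuous_onI continuous_intros)

lemma borel_measurable_Arg2pi [measurable]: "Arg2pi \<in> borel_measurable borel"
  unfolding borel_measurable_iff_le using closed_Arg2pi2pi_le by auto

lemma Arg2pi_cis: "r > 0 \<Longrightarrow> 0 \<le> t \<Longrightarrow> t < 2*pi \<Longrightarrow> Arg2pi (of_real r * cis t) = t"
  by (rule Arg2pi_unique[of r]) (auto simp: cis_conv_exp)

lemma finite_level_set:
  fixes F :: "complex poly"
  assumes "degree F \<ge> 1"
  shows "finite {z. poly F z = w}"
proof -
  have "F - [:w:] \<noteq> 0" using assms by (metis degree_pCons_0 eq_iff_diff_eq_0 not_one_le_zero)
  then have "finite {z. poly (F - [:w:]) z = 0}" by (rule poly_roots_finite)
  then show ?thesis by simp
qed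

text \<open>
  Away from critical points and from the preimage of the positive axis, the level curve
  \<open>|F| = r\<close> is locally parametrised by the argument of \<open>F\<close>, with speed \<open>r / |F'|\<close>.
\<close>

lemma level_curve_chart:
  fixes F :: "complex poly"
  assumes deg: "degree F \<ge> 1" and r: "r > 0"
    and z0: "poly (pderiv F) z0 \<noteq> 0" "poly F z0 \<notin> \<real>\<^sub>\<ge>\<^sub>0"
  shows "\<exists>U. open U \<and> z0 \<in> U \<and> (\<forall>f\<in>borel_measurable borel. (\<forall>z. z \<notin> U \<longrightarrow> f z = (0::ennreal)) \<longrightarrow>
     (\<lambda>t. (\<Sum>z | poly F z = of_real r * cis t. f z) * indicator {0<..<2*pi} t) \<in> borel_measurable borel \<and>
     (\<integral>\<^sup>+z. f z * ennreal (cmod (poly (pderiv F) z)) * indicator {z. cmod (poly F z) = r} z \<partial>hausdorff1)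
      = (\<integral>\<^sup>+t. ennreal r * ((\<Sum>z | poly F z = of_real r * cis t. f z) * indicator {0<..<2*pi} t) \<partial>lborel))"
proof -
  define \<Omega> where "\<Omega> = {z. poly (pderiv F) z \<noteq> 0} \<inter> poly F -` (- \<real>\<^sub>\<ge>\<^sub>0)"
  have op: "open \<Omega>" unfolding \<Omega>_def
    by (intro open_Int open_Collect_neq open_vimage continuous_intros) (auto simp: open_Compl)
  have hol: "poly F holomorphic_on A" for A by (intro holomorphic_intros)
  have dF: "deriv (poly F) z = poly (pderiv F) z" for z by (rule DERIV_imp_deriv[OF poly_DERIV])
  have z0': "z0 \<in> \<Omega>" using z0 by (simp add: \<Omega>_def)
  obtain \<rho> where \<rho>: "\<rho> > 0" "ball z0 \<rho> \<subseteq> \<Omega>" "inj_on (poly F) (ball z0 \<rho>)"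
    using has_complex_derivative_locally_injective[OF hol z0' op] z0(1) unfolding dF by blast
  define U where "U = ball z0 \<rho>"
  have U: "open U" "z0 \<in> U" "U \<subseteq> \<Omega>" using \<rho> by (auto simp: U_def)
  obtain h where h: "h holomorphic_on (poly F ` U)"
      "\<And>z. z \<in> U \<Longrightarrow> deriv (poly F) z * deriv h (poly F z) = 1" "\<And>z. z \<in> U \<Longrightarrow> h (poly F z) = z"
    using holomorphic_has_inverse[OF hol U(1)] \<rho>(3) unfolding U_def by blast
  define W where "W = poly F ` U"
  have W: "open W" unfolding W_def using \<rho>(3) by (intro open_mapping_thm3[OF hol U(1)]) (simp add: U_def)
  define e where "e t = complex_of_real r * cis t" for t
  have ce: "continuous_on UNIV e" unfolding e_def by (intro continuous_intros)
  define T where "T = {0<..<2*pi} \<inter> e -` W"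
  have T: "open T" unfolding T_def using ce W by (intro open_Int open_vimage) auto
  define \<gamma> where "\<gamma> t = h (e t)" for t
  define \<gamma>' where "\<gamma>' t = e t * \<i> * deriv h (e t)" for t
  have Tim: "\<gamma> t \<in> U" "poly F (\<gamma> t) = e t" if "t \<in> T" for t
    using that h(3) by (auto simp: T_def W_def \<gamma>_def)
  have der: "(\<gamma> has_vector_derivative \<gamma>' t) (at t)" if t: "t \<in> T" for t
  proof -
    have "(e has_vector_derivative e t * \<i>) (at t)"
    proof -
      have "((\<lambda>z. of_real r * exp (\<i> * z)) has_field_derivative of_real r * exp (\<i> * of_real t) * \<i>) (at (of_real t))"
        by (auto intro!: derivative_eq_intros)
      from has_vector_derivative_real_field[OF this] show ?thesis
        unfolding e_def cis_conv_exp by simp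
    qed
    moreover have "(h has_field_derivative deriv h (e t)) (at (e t))"
      using h(1) t W by (intro holomorphic_derivI[of _ W]) (auto simp: W_def T_def)
    ultimately have "((h \<circ> e) has_vector_derivative e t * \<i> * deriv h (e t)) (at t)"
      by (rule field_vector_diff_chain_at)
    moreover have "h \<circ> e = \<gamma>" by (auto simp: \<gamma>_def)
    ultimately show ?thesis by (simp add: \<gamma>'_def)
  qed
  have dh: "poly (pderiv F) (\<gamma> t) * deriv h (e t) = 1" if "t \<in> T" for t
    using h(2)[OF Tim(1)[OF that]] Tim(2)[OF that] by (simp add: dF)
  have cont: "continuous_on T \<gamma>'"
  proof -
    have "continuous_on W (deriv h)"
      using h(1) W by (intro holomorphic_on_imp_continuous_on holomorphic_deriv) (auto simp: W_def)
    then have "continuous_on T (\<lambda>t. deriv h (e t))"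
      by (rule continuous_on_compose2[OF _ continuous_on_subset[OF ce]]) (auto simp: T_def)
    then show ?thesis unfolding \<gamma>'_def by (intro continuous_intros continuous_on_subset[OF ce]) auto
  qed
  have nz: "\<gamma>' t \<noteq> 0" if "t \<in> T" for t
    using dh[OF that] r by (auto simp: \<gamma>'_def e_def)
  \<comment> \<open>\<open>\<gamma>'\<close> is \<open>\<i> e\<close> times the derivative of the
    inverse branch, so its modulus is \<open>r / |F'|\<close> and the weight \<open>|F'|\<close>
    turns arc length into \<open>r dt\<close>.\<close>
  have speed: "cmod (poly (pderiv F) (\<gamma> t)) * cmod (\<gamma>' t) = r" if "t \<in> T" for t
  proof -
    have "cmod (poly (pderiv F) (\<gamma> t) * deriv h (e t)) = 1" using dh[OF that] by simp
    then show ?thesis using r by (simp add: \<gamma>'_def e_def norm_mult mult_ac)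
  qed
  have inv: "Arg2pi (poly F (\<gamma> t)) = t" if "t \<in> T" for t
    unfolding Tim(2)[OF that] e_def using that r by (intro Arg2pi_cis) (auto simp: T_def)
  define L where "L = {z. cmod (poly F z) = r}"
  have Lm [measurable]: "L \<in> sets borel"
    unfolding L_def by (intro borel_closed closed_Collect_eq continuous_intros)
  have im: "\<gamma> ` T = U \<inter> L"
  proof (intro equalityI subsetI)
    fix z assume "z \<in> \<gamma> ` T"
    then show "z \<in> U \<inter> L" using Tim r by (auto simp: L_def e_def norm_mult)
  next
    fix z assume z: "z \<in> U \<inter> L"
    define t where "t = Arg2pi (poly F z)"
    have et: "e t = poly F z"
      using Arg2pi_eq[of "poly F z"] z by (simp add: e_def t_def L_def cis_conv_exp)
    have "poly F z \<notin> \<real>\<^sub>\<ge>\<^sub>0" using z U(3) by (auto simp: \<Omega>_def)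
    then have "t \<noteq> 0" unfolding t_def Arg2pi_eq_0 by (auto simp: complex_nonneg_Reals_iff complex_is_Real_iff)
    then have "t \<in> T" using Arg2pi_ge_0[of "poly F z"] Arg2pi_lt_2pi[of "poly F z"] et z
      by (auto simp: T_def W_def t_def)
    moreover have "\<gamma> t = z" using et z h(3) by (simp add: \<gamma>_def)
    ultimately show "z \<in> \<gamma> ` T" by blast
  qed
  have imm: "\<gamma> ` T \<in> sets borel" unfolding im using U(1) by auto
  \<comment> \<open>\<open>F\<close> is injective on \<open>U\<close>, so a function supported in
    \<open>U\<close> sees at most one point of each fibre. Writing its value as a sum over the whole
    fibre gives a formula that does not mention the chart and can be added over charts.\<close>
  have Sf: "(\<Sum>z | poly F z = of_real r * cis t. f z) * indicator {0<..<2*pi} t = f (\<gamma> t) * indicator T t"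
    if f: "\<forall>z. z \<notin> U \<longrightarrow> f z = (0::ennreal)" for f t
  proof (cases "t \<in> T")
    case True
    have "(\<Sum>z | poly F z = e t. f z) = (\<Sum>z\<in>{\<gamma> t}. f z)"
    proof (rule sum.mono_neutral_right)
      show "\<forall>z\<in>{z. poly F z = e t} - {\<gamma> t}. f z = 0"
      proof
        fix z assume z: "z \<in> {z. poly F z = e t} - {\<gamma> t}"
        then have "z \<notin> U" using h(3)[of z] by (auto simp: \<gamma>_def)
        then show "f z = 0" using f by blast
      qed
    qed (use True Tim finite_level_set[OF deg] in auto)
    then show ?thesis using True by (auto simp: e_def T_def)
  next
    case False
    show ?thesis
    proof (cases "t \<in> {0<..<2*pi}")
      case t: True
      have "(\<Sum>z | poly F z = e t. f z) = 0"
      proof (rule sum.neutral, rule ballI)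
        fix z assume "z \<in> {z. poly F z = e t}"
        then have "e t = poly F z" by simp
        then have "z \<notin> U" using False t by (auto simp: T_def W_def)
        then show "f z = 0" using f by blast
      qed
      then show ?thesis using False by (simp add: e_def)
    qed (use False in simp)
  qed
  have cg: "continuous_on T \<gamma>"
    using der has_vector_derivative_continuous by (fastforce intro: continuous_at_imp_continuous_on)
  have "(\<lambda>t. (\<Sum>z | poly F z = of_real r * cis t. f z) * indicator {0<..<2*pi} t) \<in> borel_measurable borel \<and>
     (\<integral>\<^sup>+z. f z * ennreal (cmod (poly (pderiv F) z)) * indicator L z \<partial>hausdorff1)
      = (\<integral>\<^sup>+t. ennreal r * ((\<Sum>z | poly F z = of_real r * cis t. f z) * indicator {0<..<2*pi} t) \<partial>lborel)"
    if f [measurable]: "f \<in> borel_measurable borel" and f0: "\<forall>z. z \<notin> U \<longrightarrow> f z = (0::ennreal)" for f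
  proof
    have [measurable]: "T \<in> sets borel" using T by auto
    have [measurable]: "(\<lambda>t. indicator T t *\<^sub>R \<gamma> t) \<in> borel_measurable borel"
      using cg by (auto intro: borel_measurable_continuous_on_indicator)
    have "f (\<gamma> t) * indicator T t = f (indicator T t *\<^sub>R \<gamma> t) * indicator T t" for t
      by (auto simp: indicator_def)
    then show "(\<lambda>t. (\<Sum>z | poly F z = of_real r * cis t. f z) * indicator {0<..<2*pi} t) \<in> borel_measurable borel"
      unfolding Sf[OF f0] by simp
    have "(\<integral>\<^sup>+z. f z * ennreal (cmod (poly (pderiv F) z)) * indicator L z \<partial>hausdorff1)
        = (\<integral>\<^sup>+z. f z * ennreal (cmod (poly (pderiv F) z)) * indicator (\<gamma> ` T) z \<partial>hausdorff1)"
      using f0 unfolding im by (intro nn_integral_cong) (auto simp: indicator_def)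
    also have "\<dots> = (\<integral>\<^sup>+t. f (\<gamma> t) * ennreal (cmod (poly (pderiv F) (\<gamma> t))) * ennreal (norm (\<gamma>' t)) * indicator T t \<partial>lborel)"
      by (rule nn_integral_hausdorff1_curve[OF T der cont nz _ inv imm]) auto
    also have "\<dots> = (\<integral>\<^sup>+t. ennreal r * (f (\<gamma> t) * indicator T t) \<partial>lborel)"
    proof (rule nn_integral_cong)
      fix t
      show "f (\<gamma> t) * ennreal (cmod (poly (pderiv F) (\<gamma> t))) * ennreal (norm (\<gamma>' t)) * indicator T t
        = ennreal r * (f (\<gamma> t) * indicator T t)"
        using speed[of t] by (cases "t \<in> T") (auto simp: mult_ac simp flip: ennreal_mult)
    qed
    finally show "(\<integral>\<^sup>+z. f z * ennreal (cmod (poly (pderiv F) z)) * indicator L z \<partial>hausdorff1)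
      = (\<integral>\<^sup>+t. ennreal r * ((\<Sum>z | poly F z = of_real r * cis t. f z) * indicator {0<..<2*pi} t) \<partial>lborel)"
      unfolding Sf[OF f0] .
  qed
  then show ?thesis using U unfolding L_def by blast
qed

lemma finite_null_sets_hausdorff1: "finite A \<Longrightarrow> A \<in> null_sets hausdorff1"
proof (induction rule: finite_induct)
  case (insert x A)
  have "{x} \<in> null_sets hausdorff1" by (simp add: null_sets_def emeasure_hausdorff1)
  then have "{x} \<union> A \<in> null_sets hausdorff1" using insert.IH by (rule null_sets.Un)
  then show ?case by simp
qed simp

text \<open>Countably many charts cover \<open>\<Omega>\<close>; made disjoint, they split
  \<open>f\<close> into pieces supported in single charts, whose formulas add up. Only finitely many
  points of the curve lie outside \<open>\<Omega>\<close>, and only finitely many parameters have a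
  fibre that leaves it, so both sides ignore them. The fibre sum of \<open>f\<close> is identified
  with the sum of the pieces only almost everywhere, hence the measurable representative
  \<open>g\<close>.\<close>

lemma
  fixes F :: "complex poly"
  assumes deg: "degree F \<ge> 1" and r: "r > 0" and f [measurable]: "f \<in> borel_measurable borel"
  shows level_sum_AE_eq_measurable: "\<exists>g\<in>borel_measurable borel. AE t in lborel.
      (\<Sum>z | poly F z = of_real r * cis t. f z) * indicator {0<..<2*pi} t = (g t :: ennreal)"
    and nn_integral_level_curve: "(\<integral>\<^sup>+z. f z * ennreal (cmod (poly (pderiv F) z)) * indicator {z. cmod (poly F z) = r} z \<partial>hausdorff1)
      = ennreal r * (\<integral>\<^sup>+t. (\<Sum>z | poly F z = of_real r * cis t. f z) * indicator {0<..<2*pi} t \<partial>lborel)"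
proof -
  define L where "L = {z. cmod (poly F z) = r}"
  have Lm [measurable]: "L \<in> sets borel"
    unfolding L_def by (intro borel_closed closed_Collect_eq continuous_intros)
  define S where "S f t = (\<Sum>z | poly F z = of_real r * cis t. f z) * indicator {0<..<2*pi} t" for f :: "complex \<Rightarrow> ennreal" and t
  define \<Omega> where "\<Omega> = {z. poly (pderiv F) z \<noteq> 0 \<and> poly F z \<notin> \<real>\<^sub>\<ge>\<^sub>0}"
  define \<U> where "\<U> = {U. open U \<and> (\<forall>f\<in>borel_measurable borel. (\<forall>z. z \<notin> U \<longrightarrow> f z = (0::ennreal)) \<longrightarrow>
     S f \<in> borel_measurable borel \<and>
     (\<integral>\<^sup>+z. f z * ennreal (cmod (poly (pderiv F) z)) * indicator L z \<partial>hausdorff1)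
      = (\<integral>\<^sup>+t. ennreal r * S f t \<partial>lborel))}"
  have cov: "\<Omega> \<subseteq> \<Union>\<U>"
  proof
    fix z assume "z \<in> \<Omega>"
    then show "z \<in> \<Union>\<U>"
      using level_curve_chart[OF deg r, of z] unfolding \<Omega>_def \<U>_def S_def L_def by blast
  qed
  obtain \<F> where F: "\<F> \<subseteq> \<U>" "countable \<F>" "\<Union>\<F> = \<Union>\<U>"
    using Lindelof[of \<U>] by (auto simp: \<U>_def)
  \<comment> \<open>The Lindelof subfamily may be empty; inserting \<open>{}\<close> allows an
    enumeration by all natural numbers, so \<open>{}\<close> has to qualify as a chart.\<close>
  have emp: "{} \<in> \<U>"
  proof -
    have S0: "S f t = 0" if "\<forall>z. z \<notin> {} \<longrightarrow> f z = 0" for f t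
      using that by (simp add: S_def)
    have "S f \<in> borel_measurable borel \<and>
     (\<integral>\<^sup>+z. f z * ennreal (cmod (poly (pderiv F) z)) * indicator L z \<partial>hausdorff1)
      = (\<integral>\<^sup>+t. ennreal r * S f t \<partial>lborel)" if f: "\<forall>z. z \<notin> {} \<longrightarrow> f z = 0" for f
    proof -
      have "S f = (\<lambda>_. 0)" using S0[OF f] by auto
      then show ?thesis using f by simp
    qed
    then show ?thesis unfolding \<U>_def by simp
  qed
  define U where "U = from_nat_into (insert {} \<F>)"
  have ran: "range U = insert {} \<F>" unfolding U_def using F(2) by (intro range_from_nat_into) auto
  have UU: "U i \<in> \<U>" for i
  proof -
    have "U i \<in> insert {} \<F>" using ran by blast
    then show ?thesis using F(1) emp by auto
  qed
  then have oU: "open (U i)" for i by (simp add: \<U>_def)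
  have UN: "\<Omega> \<subseteq> (\<Union>i. U i)" using cov F(3) ran by auto
  define B where "B = disjointed U"
  have Bs [measurable]: "B i \<in> sets borel" for i
  proof -
    have "range (disjointed U) \<subseteq> sets borel"
      by (rule sets.range_disjointed_sets) (use oU in auto)
    then show ?thesis unfolding B_def by blast
  qed
  have dB: "disjoint_family B" unfolding B_def by (rule disjoint_family_disjointed)
  have UNB: "\<Omega> \<subseteq> (\<Union>i. B i)" using UN UN_disjointed_eq[of U] by (auto simp: B_def)
  define g where "g i z = f z * indicator (B i) z" for i z
  have gm [measurable]: "g i \<in> borel_measurable borel" for i unfolding g_def by measurable
  have g0: "\<forall>z. z \<notin> U i \<longrightarrow> g i z = 0" for i
    using disjointed_subset[of U i] by (auto simp: g_def B_def indicator_def)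
  have chart: "S (g i) \<in> borel_measurable borel"
    "(\<integral>\<^sup>+z. g i z * ennreal (cmod (poly (pderiv F) z)) * indicator L z \<partial>hausdorff1)
      = (\<integral>\<^sup>+t. ennreal r * S (g i) t \<partial>lborel)" for i
    using UU[of i] gm[of i] g0[of i] unfolding \<U>_def by blast+
  note chart(1)[measurable]
  have sumg: "(\<Sum>i. g i z) = f z" if "z \<in> \<Omega>" for z
  proof -
    have "(\<Sum>i. g i z) = f z * (\<Sum>i. indicator (B i) z)" unfolding g_def by simp
    also have "(\<Sum>i. indicator (B i) z) = (indicator (\<Union>i. B i) z :: ennreal)"
      by (rule suminf_indicator[OF dB])
    finally show ?thesis using subsetD[OF UNB that] by (simp only: indicator_simps mult_1_right)
  qed
  define C where "C = {z. poly (pderiv F) z = 0}"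
  have finC: "finite C"
  proof -
    have "pderiv F \<noteq> 0" using deg by (simp add: pderiv_eq_0_iff)
    then show ?thesis unfolding C_def by (rule poly_roots_finite)
  qed
  have null: "AE z in hausdorff1. z \<in> L \<longrightarrow> z \<in> \<Omega>"
  proof -
    have "finite (C \<union> {z. poly F z = of_real r})" using finC finite_level_set[OF deg] by simp
    then have "C \<union> {z. poly F z = of_real r} \<in> null_sets hausdorff1"
      by (rule finite_null_sets_hausdorff1)
    then show ?thesis
    proof (rule AE_I')
      have "z \<in> C \<union> {z. poly F z = of_real r}" if "z \<in> L" "z \<notin> \<Omega>" for z
      proof (cases "z \<in> C")
        case False
        then have "poly F z \<in> \<real>\<^sub>\<ge>\<^sub>0" using that by (auto simp: \<Omega>_def C_def)
        then obtain x where "poly F z = of_real x" "x \<ge> 0" by (auto simp: nonneg_Reals_def)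
        then show ?thesis using \<open>z \<in> L\<close> by (simp add: L_def)
      qed simp
      then show "{z \<in> space hausdorff1. \<not> (z \<in> L \<longrightarrow> z \<in> \<Omega>)} \<subseteq> C \<union> {z. poly F z = of_real r}" by blast
    qed
  qed
  have "AE t in lborel. t \<in> {0<..<2*pi} \<longrightarrow> complex_of_real r * cis t \<notin> poly F ` C \<union> {of_real r}"
    using finC r by (intro AE_circle_notin_finite) auto
  then have AEg: "AE t in lborel. (\<Sum>i. S (g i) t) = S f t"
  proof eventually_elim
    case (elim t)
    show ?case
    proof (cases "t \<in> {0<..<2*pi}")
      case True
      have om: "z \<in> \<Omega>" if "poly F z = of_real r * cis t" for z
      proof -
        have "z \<notin> C" using elim True that by (metis UnCI imageI)
        moreover have "poly F z \<notin> \<real>\<^sub>\<ge>\<^sub>0"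
        proof
          assume "poly F z \<in> \<real>\<^sub>\<ge>\<^sub>0"
          then obtain x where x: "poly F z = of_real x" "x \<ge> 0" by (auto simp: nonneg_Reals_def)
          then have "x = cmod (of_real r * cis t)" using that by (metis abs_of_nonneg norm_of_real)
          then have "x = r" using r by (simp add: norm_mult)
          then show False using elim True that x by auto
        qed
        ultimately show ?thesis by (simp add: \<Omega>_def C_def)
      qed
      have "(\<Sum>i. S (g i) t) = (\<Sum>i. \<Sum>z | poly F z = of_real r * cis t. g i z)"
        using True by (simp add: S_def)
      also have "\<dots> = (\<Sum>z | poly F z = of_real r * cis t. \<Sum>i. g i z)"
        by (rule suminf_sum) (simp add: summableI)
      also have "\<dots> = S f t" using True om sumg by (simp add: S_def)
      finally show ?thesis .
    qed (simp add: S_def)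
  qed
  show "\<exists>g\<in>borel_measurable borel. AE t in lborel.
      (\<Sum>z | poly F z = of_real r * cis t. f z) * indicator {0<..<2*pi} t = (g t :: ennreal)"
    using AEg unfolding S_def[of f, symmetric]
    by (intro bexI[of _ "\<lambda>t. \<Sum>i. S (g i) t"]) (auto elim: eventually_mono)
  have "(\<integral>\<^sup>+z. f z * ennreal (cmod (poly (pderiv F) z)) * indicator L z \<partial>hausdorff1)
     = (\<integral>\<^sup>+z. (\<Sum>i. g i z * (ennreal (cmod (poly (pderiv F) z)) * indicator L z)) \<partial>hausdorff1)"
  proof (rule nn_integral_cong_AE)
    show "AE z in hausdorff1. f z * ennreal (cmod (poly (pderiv F) z)) * indicator L z
       = (\<Sum>i. g i z * (ennreal (cmod (poly (pderiv F) z)) * indicator L z))"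
      using null
    proof eventually_elim
      case (elim z)
      have "(\<Sum>i. g i z * (ennreal (cmod (poly (pderiv F) z)) * indicator L z))
        = (\<Sum>i. g i z) * (ennreal (cmod (poly (pderiv F) z)) * indicator L z)" by simp
      then show ?case using elim sumg[of z] by (cases "z \<in> L") (auto simp: mult_ac)
    qed
  qed
  also have "\<dots> = (\<Sum>i. \<integral>\<^sup>+z. g i z * (ennreal (cmod (poly (pderiv F) z)) * indicator L z) \<partial>hausdorff1)"
    by (rule nn_integral_suminf) measurable
  also have "\<dots> = (\<Sum>i. \<integral>\<^sup>+t. ennreal r * S (g i) t \<partial>lborel)"
    using chart(2) by (simp add: mult.assoc)
  also have "\<dots> = (\<integral>\<^sup>+t. (\<Sum>i. ennreal r * S (g i) t) \<partial>lborel)"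
    by (rule nn_integral_suminf[symmetric]) measurable
  also have "\<dots> = (\<integral>\<^sup>+t. ennreal r * (\<Sum>i. S (g i) t) \<partial>lborel)" by simp
  also have "\<dots> = ennreal r * (\<integral>\<^sup>+t. (\<Sum>i. S (g i) t) \<partial>lborel)"
    by (rule nn_integral_cmult) measurable
  also have "(\<integral>\<^sup>+t. (\<Sum>i. S (g i) t) \<partial>lborel) = (\<integral>\<^sup>+t. S f t \<partial>lborel)"
    by (rule nn_integral_cong_AE[OF AEg])
  finally show "(\<integral>\<^sup>+z. f z * ennreal (cmod (poly (pderiv F) z)) * indicator {z. cmod (poly F z) = r} z \<partial>hausdorff1)
      = ennreal r * (\<integral>\<^sup>+t. (\<Sum>z | poly F z = of_real r * cis t. f z) * indicator {0<..<2*pi} t \<partial>lborel)"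
    unfolding S_def L_def .
qed

section \<open>Roots of irreducible integer polynomials and products over level sets\<close>

lemma degree_cpoly [simp]: "degree (cpoly P) = degree P"
  by (rule degree_map_poly) auto

lemma cpoly_eq_0_iff [simp]: "cpoly P = 0 \<longleftrightarrow> P = 0"
  by (rule map_poly_eq_0_iff) auto

lemma cpoly_power: "cpoly (P ^ n) = cpoly P ^ n"
  by (induction n) (simp_all add: cpoly_mult)

lemma pderiv_cpoly: "pderiv (cpoly P) = cpoly (pderiv P)"
  by (rule poly_eqI) (simp add: coeff_pderiv coeff_map_poly)

text \<open>
  Pseudo-division by an integer polynomial \<open>G\<close> of least degree vanishing at \<open>\<alpha>\<close> shows that \<open>G\<close>
  divides integer multiples of \<open>V\<close> and \<open>Q\<close>, and primality of \<open>V\<close> does the rest.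
\<close>

lemma irreducible_dvd_if_common_root:
  fixes V Q :: "int poly" and \<alpha> :: complex
  assumes irr: "irreducible V" and deg: "degree V \<ge> 1"
    and V0: "poly (cpoly V) \<alpha> = 0" and Q0: "poly (cpoly Q) \<alpha> = 0"
  shows "V dvd Q"
proof -
  have prime: "prime_elem V" using irr by (rule irreducible_imp_prime_elem)
  have const: "\<not> V dvd [:c:]" if "c \<noteq> 0" for c
  proof
    assume "V dvd [:c:]"
    then have "degree V \<le> degree [:c:]" using that by (intro dvd_imp_degree_le) auto
    with deg show False by simp
  qed
  define A where "A G \<longleftrightarrow> G \<noteq> 0 \<and> poly (cpoly G) \<alpha> = 0" for G
  have "A V" using V0 deg by (auto simp: A_def)
  then obtain G where G: "A G" "\<And>H. A H \<Longrightarrow> degree G \<le> degree H"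
    using exists_least_iff[of "\<lambda>d. \<exists>G. A G \<and> degree G = d"] by (metis not_le)
  have G0: "G \<noteq> 0" using G(1) by (simp add: A_def)
  have div: "\<exists>c S. c \<noteq> 0 \<and> [:c:] * H = G * S" if H: "poly (cpoly H) \<alpha> = 0" for H
  proof -
    obtain S T where ST: "pseudo_divmod H G = (S, T)" by fastforce
    define c where "c = coeff G (degree G) ^ (Suc (degree H) - degree G)"
    have c0: "c \<noteq> 0" using G0 by (simp add: c_def)
    have eq: "Polynomial.smult c H = G * S + T" and T: "T = 0 \<or> degree T < degree G"
      using pseudo_divmod[OF G0 ST] by (auto simp: c_def)
    have "poly (cpoly (Polynomial.smult c H)) \<alpha> = poly (cpoly ([:c:] * H)) \<alpha>" by simp
    also have "\<dots> = 0" unfolding cpoly_mult using H by simp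
    finally have "poly (cpoly (G * S + T)) \<alpha> = 0" unfolding eq .
    moreover have "cpoly (G * S + T) = cpoly G * cpoly S + cpoly T"
      unfolding cpoly_mult[symmetric] by (rule poly_eqI) (simp add: coeff_map_poly)
    ultimately have "poly (cpoly T) \<alpha> = 0" using G(1) by (simp add: A_def)
    then have "T = 0" using T G(2)[of T] unfolding A_def by linarith
    then show ?thesis using eq c0 by (intro exI[of _ c] exI[of _ S]) simp
  qed
  obtain c S where c: "c \<noteq> 0" "[:c:] * V = G * S" using div[OF V0] by blast
  have "V dvd G * S" unfolding c(2)[symmetric] by (rule dvd_triv_right)
  then have "V dvd G"
  proof (rule prime_elem_dvd_multD[OF prime, THEN disjE])
    assume "V dvd S"
    then obtain S' where "S = V * S'" by (elim dvdE)
    then have "V * [:c:] = V * (G * S')" using c(2) by (simp only: mult_ac)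
    then have "[:c:] = G * S'" using deg by (subst (asm) mult_cancel_left) auto
    then have "degree (G * S') = 0" "S' \<noteq> 0" using c(1) by (metis degree_pCons_0, force)
    then have "degree G = 0" using G0 by (simp add: degree_mult_eq)
    then obtain g where "G = [:g:]" by (rule degree_eq_zeroE)
    then have False using G(1) by (auto simp: A_def map_poly_pCons)
    then show ?thesis ..
  qed
  obtain c' S' where c': "c' \<noteq> 0" "[:c':] * Q = G * S'" using div[OF Q0] by blast
  have "V dvd [:c':] * Q" unfolding c'(2) using \<open>V dvd G\<close> by simp
  then show ?thesis using prime_elem_dvd_multD[OF prime] const[OF c'(1)] by blast
qed

text \<open>A multiple root is shared with the derivative, so \<open>V\<close> would divide a
  nonzero polynomial of smaller degree.\<close>

lemma irreducible_simple_roots: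
  fixes V :: "int poly" and \<alpha> :: complex
  assumes "irreducible V" "degree V \<ge> 1" "poly (cpoly V) \<alpha> = 0"
  shows "poly (pderiv (cpoly V)) \<alpha> \<noteq> 0"
proof
  assume "poly (pderiv (cpoly V)) \<alpha> = 0"
  then have "V dvd pderiv V"
    using assms by (intro irreducible_dvd_if_common_root[of _ \<alpha>]) (auto simp: pderiv_cpoly)
  moreover have "pderiv V \<noteq> 0" using assms by (simp add: pderiv_eq_0_iff)
  ultimately have "degree V \<le> degree (pderiv V)" by (rule dvd_imp_degree_le)
  then show False using assms(2) by (simp add: degree_pderiv)
qed

text \<open>When no point of the level set is critical, \<open>F - w\<close> is squarefree and
  splits into distinct linear factors over that set.\<close>

lemma
  fixes F :: "complex poly"
  assumes deg: "degree F \<ge> 1" and simple: "\<And>z. poly F z = w \<Longrightarrow> poly (pderiv F) z \<noteq> 0"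
  shows level_set_prod: "poly F x - w = lead_coeff F * (\<Prod>z | poly F z = w. x - z)"
    and card_level_set: "card {z. poly F z = w} = degree F"
proof -
  define p where "p = F - [:w:]"
  have pF: "poly p z = poly F z - w" for z by (simp add: p_def)
  have dp: "degree p = degree F"
    using deg degree_add_eq_left[of "- [:w:]" F] by (simp add: p_def diff_conv_add_uminus del: add_uminus_conv_diff)
  have lp: "lead_coeff p = lead_coeff F" unfolding dp using deg
    by (cases "degree F") (auto simp: p_def)
  have "pderiv p = pderiv F" by (simp add: p_def pderiv_diff pderiv_pCons)
  then have "rsquarefree p" using simple by (auto simp: rsquarefree_roots pF)
  from complex_poly_decompose_rsquarefree[OF this]
  have eq: "Polynomial.smult (lead_coeff F) (\<Prod>z | poly F z = w. [:- z, 1:]) = p" by (simp add: lp pF)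
  show "poly F x - w = lead_coeff F * (\<Prod>z | poly F z = w. x - z)"
    unfolding pF[symmetric] by (subst eq[symmetric]) (simp add: poly_prod)
  have "lead_coeff F \<noteq> 0" using deg by auto
  then have "degree p = card {z. poly F z = w}"
    by (subst eq[symmetric]) (simp add: degree_prod_sum_eq)
  then show "card {z. poly F z = w} = degree F" using dp by simp
qed

text \<open>Exchange of a double product: with \<open>\<zeta> i\<close> the roots of
  \<open>Q\<close> and \<open>a\<close> the leading coefficient of \<open>F\<close>, the factors
  \<open>z - \<zeta> i\<close> over the fibre multiply, up to sign, to
  \<open>(F (\<zeta> i) - w) / a\<close>. So the product of \<open>Q\<close> over the fibre is a
  polynomial in \<open>w\<close> with roots \<open>v i = F (\<zeta> i)\<close>, and taking moduli
  removes the signs.\<close>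

lemma prod_level_set_factorization:
  fixes F Q :: "complex poly"
  assumes deg: "degree F \<ge> 1" and Q: "Q \<noteq> 0"
  obtains C v where "C \<noteq> 0" "\<And>i. i < degree Q \<Longrightarrow> \<exists>\<zeta>. poly Q \<zeta> = 0 \<and> v i = poly F \<zeta>"
    "\<And>w. (\<And>z. poly F z = w \<Longrightarrow> poly (pderiv F) z \<noteq> 0) \<Longrightarrow>
       cmod (\<Prod>z | poly F z = w. poly Q z) = cmod (C * (\<Prod>i<degree Q. v i - w))"
proof -
  obtain \<zeta> where \<zeta>: "Polynomial.smult (lead_coeff Q) (\<Prod>i<degree Q. [:- \<zeta> i, 1:]) = Q"
    using complex_poly_decompose' by blast
  have Qz: "poly Q z = lead_coeff Q * (\<Prod>i<degree Q. z - \<zeta> i)" for z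
    by (subst \<zeta>[symmetric]) (simp add: poly_prod)
  define a where "a = lead_coeff F"
  have a: "a \<noteq> 0" using deg by (auto simp: a_def)
  show thesis
  proof (rule that[of "lead_coeff Q ^ degree F / a ^ degree Q" "\<lambda>i. poly F (\<zeta> i)"])
    show "lead_coeff Q ^ degree F / a ^ degree Q \<noteq> 0" using a Q by simp
    show "\<exists>z. poly Q z = 0 \<and> poly F (\<zeta> i) = poly F z" if "i < degree Q" for i
      using that by (intro exI[of _ "\<zeta> i"]) (auto simp: Qz)
    fix w assume simple: "\<And>z. poly F z = w \<Longrightarrow> poly (pderiv F) z \<noteq> 0"
    have lin: "(\<Prod>z | poly F z = w. cmod (z - \<zeta> i)) = cmod ((poly F (\<zeta> i) - w) / a)" for i
    proof -
      have "poly F (\<zeta> i) - w = a * (\<Prod>z | poly F z = w. \<zeta> i - z)"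
        unfolding a_def by (rule level_set_prod[OF deg simple])
      then have "cmod ((poly F (\<zeta> i) - w) / a) = cmod (\<Prod>z | poly F z = w. \<zeta> i - z)"
        using a by simp
      then show ?thesis by (simp add: prod_norm[symmetric] norm_minus_commute)
    qed
    have "cmod (\<Prod>z | poly F z = w. poly Q z)
        = cmod (lead_coeff Q) ^ degree F * (\<Prod>z | poly F z = w. \<Prod>i<degree Q. cmod (z - \<zeta> i))"
      by (simp add: Qz prod.distrib norm_mult norm_power card_level_set[OF deg simple] prod_norm)
    also have "(\<Prod>z | poly F z = w. \<Prod>i<degree Q. cmod (z - \<zeta> i))
        = (\<Prod>i<degree Q. cmod ((poly F (\<zeta> i) - w) / a))"
      by (subst prod.swap) (simp add: lin)
    finally show "cmod (\<Prod>z | poly F z = w. poly Q z)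
        = cmod (lead_coeff Q ^ degree F / a ^ degree Q * (\<Prod>i<degree Q. poly F (\<zeta> i) - w))"
      by (simp add: norm_mult norm_divide norm_power prod_dividef prod_norm)
  qed
qed

text \<open>The roots of \<open>V\<close> are distinct, so the resultant computation applies and
  yields an integer; a vanishing factor would be a common root of \<open>V\<close> and
  \<open>Q\<close>.\<close>

lemma prod_roots_irreducible_ge:
  fixes V Q :: "int poly"
  assumes irr: "irreducible V" and deg: "degree V \<ge> 1" and ndvd: "\<not> V dvd Q"
  shows "1 \<le> \<bar>real_of_int (lead_coeff V)\<bar> ^ degree Q * cmod (\<Prod>z | poly (cpoly V) z = 0. poly (cpoly Q) z)"
proof -
  define Z where "Z = {z. poly (cpoly V) z = 0}"
  have fin: "finite Z" unfolding Z_def using deg by (intro poly_roots_finite) auto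
  have card: "card Z = degree V"
    unfolding Z_def using card_level_set[of "cpoly V" 0] irreducible_simple_roots[OF irr deg] deg by simp
  obtain \<alpha> where \<alpha>: "bij_betw \<alpha> {..<degree V} Z"
    using ex_bij_betw_nat_finite[OF fin] card by (auto simp: atLeast0LessThan)
  define X where "X = of_int (lead_coeff V) ^ degree Q * (\<Prod>z\<in>Z. poly (cpoly Q) z)"
  have "(\<Prod>c<degree V. poly (cpoly Q) (\<alpha> c)) = (\<Prod>z\<in>Z. poly (cpoly Q) z)"
    by (rule prod.reindex_bij_betw[OF \<alpha>])
  then have "X \<in> \<int>"
    unfolding X_def
    using lead_coeff_power_prod_poly_roots_Ints[of V "degree V" Q "degree Q" \<alpha>] \<alpha>
    by (auto simp: bij_betw_def Z_def)
  then obtain x where x: "X = of_int x" by (elim Ints_cases)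
  have "X \<noteq> 0"
    using fin deg irreducible_dvd_if_common_root[OF irr deg] ndvd by (auto simp: X_def Z_def)
  then have "1 \<le> cmod X" unfolding x by simp
  then show ?thesis by (simp add: X_def Z_def norm_mult norm_power)
qed

text \<open>The integrand is kept as a sum of logarithms so that each root is treated separately;
  because of \<open>ln 0 = 0\<close> it can differ from the logarithm of the product where a factor
  vanishes.\<close>

lemma
  fixes C :: complex and v :: "nat \<Rightarrow> complex"
  assumes r: "r > 0" and C: "C \<noteq> 0" and v: "\<And>i. i < n \<Longrightarrow> v i \<noteq> 0"
  shows set_integrable_ln_cmod_prod_circle:
      "set_integrable lborel {0<..<2*pi} (\<lambda>t. ln (cmod C) + (\<Sum>i<n. ln (cmod (v i - complex_of_real r * cis t))))"
    and set_integral_ln_cmod_prod_circle_ge: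
      "2 * pi * ln (cmod (C * (\<Prod>i<n. v i)))
        \<le> (LINT t:{0<..<2*pi}|lborel. ln (cmod C) + (\<Sum>i<n. ln (cmod (v i - complex_of_real r * cis t))))"
proof -
  have cI: "set_integrable lborel {0<..<2*pi} (\<lambda>t. ln (cmod C))"
    unfolding set_integrable_def by (auto intro!: integrable_mult_left integrable_real_indicator)
  have sI: "set_integrable lborel {0<..<2*pi} (\<lambda>t. \<Sum>i<n. ln (cmod (v i - complex_of_real r * cis t)))"
    unfolding set_integrable_def scaleR_sum_right
    using set_integrable_ln_cmod_minus_circle[OF r v, unfolded set_integrable_def]
    by (intro Bochner_Integration.integrable_sum) auto
  show "set_integrable lborel {0<..<2*pi} (\<lambda>t. ln (cmod C) + (\<Sum>i<n. ln (cmod (v i - complex_of_real r * cis t))))"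
    by (rule set_integral_add(1)[OF cI sI])
  have "(LINT t:{0<..<2*pi}|lborel. ln (cmod C)) = 2 * pi * ln (cmod C)"
    unfolding set_lebesgue_integral_def by simp
  moreover have "(LINT t:{0<..<2*pi}|lborel. \<Sum>i<n. ln (cmod (v i - complex_of_real r * cis t)))
     = (\<Sum>i<n. LINT t:{0<..<2*pi}|lborel. ln (cmod (v i - complex_of_real r * cis t)))"
    unfolding set_lebesgue_integral_def scaleR_sum_right
    using set_integrable_ln_cmod_minus_circle[OF r v, unfolded set_integrable_def]
    by (intro Bochner_Integration.integral_sum) auto
  moreover have "(\<Sum>i<n. 2 * pi * ln (cmod (v i)))
     \<le> (\<Sum>i<n. LINT t:{0<..<2*pi}|lborel. ln (cmod (v i - complex_of_real r * cis t)))"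
    by (intro sum_mono set_integral_ln_cmod_minus_circle_ge[OF r v]) auto
  moreover have "ln (cmod (C * (\<Prod>i<n. v i))) = ln (cmod C) + (\<Sum>i<n. ln (cmod (v i)))"
  proof -
    have "(\<Prod>i<n. cmod (v i)) > 0" using v by (intro prod_pos) auto
    moreover have "ln (\<Prod>i<n. cmod (v i)) = (\<Sum>i<n. ln (cmod (v i)))"
      using v by (intro ln_prod) auto
    ultimately show ?thesis using C v by (auto simp: norm_mult ln_mult simp flip: prod_norm)
  qed
  ultimately show "2 * pi * ln (cmod (C * (\<Prod>i<n. v i)))
        \<le> (LINT t:{0<..<2*pi}|lborel. ln (cmod C) + (\<Sum>i<n. ln (cmod (v i - complex_of_real r * cis t))))"
    by (subst set_integral_add(2)[OF cI sI]) (simp add: algebra_simps sum_distrib_left)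
qed

section \<open>Equality case: from almost all of the circle to a constant polynomial\<close>

text \<open>The maximum over the closed disc is attained at the centre, so \<open>p\<close> equals a
  constant \<open>c\<close> on the open disc and \<open>p - c\<close> has infinitely many
  roots.\<close>

lemma maximum_modulus_poly_circle:
  fixes p :: "complex poly"
  assumes r: "r > 0" and le: "\<And>w. cmod w = r \<Longrightarrow> cmod (poly p w) \<le> cmod (poly p 0)"
  shows "degree p = 0"
proof -
  have hol: "poly p holomorphic_on S" for S by (intro holomorphic_intros)
  have "cmod (poly p z) \<le> cmod (poly p 0)" if "z \<in> ball 0 r" for z
  proof (rule maximum_modulus_frontier[of "poly p" "ball 0 r"])
    show "continuous_on (closure (ball 0 r)) (poly p)" by (intro continuous_intros)
  qed (use r le hol that in auto)
  then have "poly p constant_on ball 0 r"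
    using r by (intro maximum_modulus_principle[OF hol, where U = "ball 0 r" and \<xi> = 0]) auto
  then obtain c where c: "\<And>z. z \<in> ball 0 r \<Longrightarrow> poly p z = c" unfolding constant_on_def by blast
  have "infinite (ball (0::complex) r)"
    using r uncountable_ball countable_finite by blast
  then have "infinite {z. poly (p - [:c:]) z = 0}"
    by (rule infinite_super[rotated]) (use c in auto)
  then have "p - [:c:] = 0" using poly_roots_finite by blast
  then show ?thesis by (metis degree_pCons_0 eq_iff_diff_eq_0)
qed

text \<open>The parameters at which a continuous function differs from \<open>c\<close> form an open
  null set, hence none; the closure of the parameter interval then recovers the point
  \<open>w = r\<close>, where the circle is cut.\<close>

lemma continuous_AE_circle_imp_all:
  fixes h :: "complex \<Rightarrow> real"
  assumes h: "continuous_on UNIV h" and r: "r > 0"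
    and ae: "AE t in lborel. t \<in> {0<..<2*pi} \<longrightarrow> h (of_real r * cis t) = c" and w: "cmod w = r"
  shows "h w = c"
proof -
  define g where "g t = h (of_real r * cis t)" for t
  have cg: "continuous_on UNIV g"
    unfolding g_def by (intro continuous_on_compose2[OF h] continuous_intros) auto
  define B where "B = {0<..<2*pi} \<inter> {t. g t \<noteq> c}"
  have oB: "open B" unfolding B_def by (intro open_Int open_Collect_neq cg continuous_intros open_greaterThanLessThan)
  have "AE t in lborel. t \<notin> B" using ae by eventually_elim (auto simp: B_def g_def)
  then have "B \<in> null_sets lborel" using oB by (subst (asm) AE_iff_null_sets[symmetric]) auto
  then have "negligible B" by (simp add: negligible_iff_null_sets null_sets_completionI)
  then have "B = {}" using open_not_negligible[OF oB] by blast
  then have "{0<..<2*pi} \<subseteq> {t. g t = c}" by (auto simp: B_def)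
  moreover have "closed {t. g t = c}" by (intro closed_Collect_eq cg continuous_intros)
  ultimately have "closure {0<..<2*pi} \<subseteq> {t. g t = c}" by (rule closure_minimal)
  then have *: "{0..2*pi} \<subseteq> {t. g t = c}" by simp
  have "Arg2pi w \<in> {0..2*pi}" using Arg2pi_ge_0[of w] Arg2pi_lt_2pi[of w] by simp
  then have "g (Arg2pi w) = c" using * by blast
  moreover have "of_real r * cis (Arg2pi w) = w" using Arg2pi_eq[of w] w by (simp add: cis_conv_exp)
  ultimately show ?thesis by (simp add: g_def)
qed

section \<open>The lemniscate of an irreducible polynomial\<close>

lemma compact_lemniscate:
  assumes "degree V \<ge> 1"
  shows "compact (lemniscate V r)"
  unfolding compact_eq_bounded_closed
proof
  have "filterlim (poly (cpoly V)) at_infinity at_infinity"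
    using assms by (intro filterlim_poly_at_infinity) auto
  then have "\<forall>x>0. \<forall>\<^sub>F z in at_infinity. x \<le> cmod (poly (cpoly V) z)"
    by (subst (asm) filterlim_at_infinity[OF order_refl])
  then have "\<forall>\<^sub>F z in at_infinity. \<bar>r\<bar> + 1 \<le> cmod (poly (cpoly V) z)"
    by (rule allE[of _ "\<bar>r\<bar> + 1"]) (simp add: add_nonneg_pos)
  then have "\<exists>B. \<forall>z. B \<le> cmod z \<longrightarrow> \<bar>r\<bar> + 1 \<le> cmod (poly (cpoly V) z)"
    by (simp only: eventually_at_infinity)
  then obtain B where B: "\<And>z. B \<le> cmod z \<Longrightarrow> \<bar>r\<bar> + 1 \<le> cmod (poly (cpoly V) z)"
    by blast
  have "cmod z \<le> B" if "z \<in> lemniscate V r" for z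
    using B[of z] that by (force simp: lemniscate_def)
  then show "bounded (lemniscate V r)" by (auto simp: bounded_iff)
  show "closed (lemniscate V r)"
    unfolding lemniscate_def by (intro closed_Collect_eq continuous_intros)
qed

locale irreducible_lemniscate =
  fixes V :: "int poly" and r :: real
  assumes irr: "irreducible V" and deg: "degree V \<ge> 1" and r: "r > 0"
begin

definition L where "L = lemniscate V r"
definition \<mu> where "\<mu> = lemniscate_measure V r"
definition a where "a = \<bar>real_of_int (lead_coeff V)\<bar>"

abbreviation level :: "complex \<Rightarrow> complex set" where
  "level w \<equiv> {z. poly (cpoly V) z = w}"

abbreviation lower_bound :: "int poly \<Rightarrow> real" where
  "lower_bound Q \<equiv> a powr - (real (degree Q) / real (degree V))"

lemma a_ge_1: "a \<ge> 1"
proof -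
  have "lead_coeff V \<noteq> 0" using deg by auto
  then show ?thesis unfolding a_def by linarith
qed

lemma mem_L: "z \<in> L \<longleftrightarrow> cmod (poly (cpoly V) z) = r"
  by (simp add: L_def lemniscate_def)

lemma L_borel [measurable]: "L \<in> sets borel"
  using compact_lemniscate[OF deg, of r] by (auto simp: L_def compact_imp_closed)

lemma space_\<mu>: "space \<mu> = L"
  by (simp add: \<mu>_def lemniscate_measure_def space_restrict_space L_def)

lemma measurable_\<mu>: "f \<in> borel_measurable borel \<Longrightarrow> f \<in> borel_measurable \<mu>"
  unfolding \<mu>_def lemniscate_measure_def measurable_density_eq1
  by (rule measurable_restrict_space1) (simp add: measurable_cong_sets[OF sets_hausdorff1 refl])

lemma nn_integral_\<mu>:
  assumes f [measurable]: "f \<in> borel_measurable borel"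
  shows "(\<integral>\<^sup>+z. f z \<partial>\<mu>) = ennreal (1 / (2 * pi * degree V)) *
      (\<integral>\<^sup>+t. (\<Sum>z\<in>level (of_real r * cis t). f z) * indicator {0<..<2*pi} t \<partial>lborel)"
proof -
  let ?c = "1 / (2 * pi * degree V * r)"
  have c: "?c \<ge> 0" using r by simp
  have "(\<integral>\<^sup>+z. f z \<partial>\<mu>) = (\<integral>\<^sup>+z. ennreal (cmod (poly (pderiv (cpoly V)) z) / (2 * pi * real (degree V) * r)) * f z
      \<partial>restrict_space hausdorff1 L)"
    unfolding \<mu>_def lemniscate_measure_def L_def
    by (rule nn_integral_density) (auto intro!: measurable_restrict_space1)
  also have "\<dots> = (\<integral>\<^sup>+z. ennreal (cmod (poly (pderiv (cpoly V)) z) / (2 * pi * real (degree V) * r)) * f z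
      * indicator L z \<partial>hausdorff1)"
    by (rule nn_integral_restrict_space) simp
  also have "\<dots> = (\<integral>\<^sup>+z. ennreal ?c * (f z * ennreal (cmod (poly (pderiv (cpoly V)) z)) * indicator L z) \<partial>hausdorff1)"
  proof (rule nn_integral_cong)
    fix z
    have "ennreal (cmod (poly (pderiv (cpoly V)) z) / (2 * pi * real (degree V) * r))
       = ennreal ?c * ennreal (cmod (poly (pderiv (cpoly V)) z))"
      using c by (subst ennreal_mult[symmetric]) auto
    then show "ennreal (cmod (poly (pderiv (cpoly V)) z) / (2 * pi * real (degree V) * r)) * f z * indicator L z
       = ennreal ?c * (f z * ennreal (cmod (poly (pderiv (cpoly V)) z)) * indicator L z)"
      by (simp only: mult_ac)
  qed
  also have "\<dots> = ennreal ?c * (\<integral>\<^sup>+z. f z * ennreal (cmod (poly (pderiv (cpoly V)) z)) * indicator L z \<partial>hausdorff1)"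
    by (rule nn_integral_cmult) measurable
  also have "(\<integral>\<^sup>+z. f z * ennreal (cmod (poly (pderiv (cpoly V)) z)) * indicator L z \<partial>hausdorff1)
     = ennreal r * (\<integral>\<^sup>+t. (\<Sum>z\<in>level (of_real r * cis t). f z) * indicator {0<..<2*pi} t \<partial>lborel)"
    unfolding L_def lemniscate_def using deg r by (intro nn_integral_level_curve) auto
  also have "ennreal ?c * (ennreal r * (\<integral>\<^sup>+t. (\<Sum>z\<in>level (of_real r * cis t). f z) * indicator {0<..<2*pi} t \<partial>lborel))
     = ennreal (?c * r) * (\<integral>\<^sup>+t. (\<Sum>z\<in>level (of_real r * cis t). f z) * indicator {0<..<2*pi} t \<partial>lborel)"
    using c r by (subst ennreal_mult) (auto simp: mult.assoc)
  also have "?c * r = 1 / (2 * pi * degree V)" using r by simp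
  finally show ?thesis .
qed

lemma AE_level_simple:
  "AE t in lborel. t \<in> {0<..<2*pi} \<longrightarrow> (\<forall>z\<in>level (of_real r * cis t). poly (pderiv (cpoly V)) z \<noteq> 0)"
proof -
  have "pderiv (cpoly V) \<noteq> 0" using deg by (simp add: pderiv_eq_0_iff)
  then have "finite {z. poly (pderiv (cpoly V)) z = 0}" by (rule poly_roots_finite)
  then have "AE t in lborel. t \<in> {0<..<2*pi} \<longrightarrow> of_real r * cis t \<notin> poly (cpoly V) ` {z. poly (pderiv (cpoly V)) z = 0}"
    using r by (intro AE_circle_notin_finite) auto
  then show ?thesis by eventually_elim force
qed

lemma level_in_L: "z \<in> level (of_real r * cis t) \<Longrightarrow> z \<in> L"
  using r by (simp add: mem_L norm_mult)

lemma finite_level: "finite (level w)"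
  using deg by (intro finite_level_set) simp

text \<open>Almost every fibre has exactly \<open>m = degree V\<close> points, so the total mass is
  \<open>2 pi m / (2 pi m)\<close>.\<close>

sublocale prob_space \<mu>
proof
  have "emeasure \<mu> (space \<mu>) = (\<integral>\<^sup>+z. 1 \<partial>\<mu>)" by simp
  also have "\<dots> = ennreal (1 / (2 * pi * degree V)) *
      (\<integral>\<^sup>+t. (\<Sum>z\<in>level (of_real r * cis t). 1) * indicator {0<..<2*pi} t \<partial>lborel)"
    by (rule nn_integral_\<mu>) simp
  also have "(\<integral>\<^sup>+t. (\<Sum>z\<in>level (of_real r * cis t). 1) * indicator {0<..<2*pi} t \<partial>lborel)
     = (\<integral>\<^sup>+t. ennreal (degree V) * indicator {0<..<2*pi} t \<partial>lborel)"
  proof (rule nn_integral_cong_AE)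
    show "AE t in lborel. (\<Sum>z\<in>level (of_real r * cis t). 1) * indicator {0<..<2*pi} t
       = ennreal (degree V) * indicator {0<..<2*pi} t"
      using AE_level_simple
    proof eventually_elim
      case (elim t)
      show ?case
      proof (cases "t \<in> {0<..<2*pi}")
        case True
        then have "card (level (of_real r * cis t)) = degree V"
          using card_level_set[of "cpoly V" "of_real r * cis t"] elim deg by auto
        then show ?thesis by (simp add: ennreal_of_nat_eq_real_of_nat)
      qed simp
    qed
  qed
  also have "\<dots> = ennreal (degree V) * ennreal (2 * pi)"
    by (simp add: nn_integral_cmult_indicator)
  also have "ennreal (1 / (2 * pi * degree V)) * (ennreal (degree V) * ennreal (2 * pi)) = 1"
  proof -
    have "ennreal (degree V) * ennreal (2 * pi) = ennreal (2 * pi * degree V)"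
      by (subst ennreal_mult[symmetric]) (auto simp: mult_ac)
    moreover have "ennreal (1 / (2 * pi * degree V)) * ennreal (2 * pi * degree V) = 1"
      using deg by (subst ennreal_mult[symmetric]) auto
    ultimately show ?thesis by simp
  qed
  finally show "emeasure \<mu> (space \<mu>) = 1" .
qed

lemma bounded_on_L:
  obtains B where "B > 0" "\<And>z. z \<in> L \<Longrightarrow> cmod (poly (cpoly Q) z) \<le> B"
proof -
  have "compact (poly (cpoly Q) ` L)"
    unfolding L_def by (intro compact_continuous_image compact_lemniscate deg continuous_intros)
  then have "bounded (poly (cpoly Q) ` L)" by (rule compact_imp_bounded)
  then have "\<exists>B. \<forall>x\<in>poly (cpoly Q) ` L. norm x \<le> B" by (simp only: bounded_iff)
  then obtain B where B: "\<And>x. x \<in> poly (cpoly Q) ` L \<Longrightarrow> norm x \<le> B" by blast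
  show thesis
  proof (rule that[of "max B 1"])
    fix z assume "z \<in> L"
    then show "cmod (poly (cpoly Q) z) \<le> max B 1" using B[of "poly (cpoly Q) z"] by auto
  qed simp
qed

lemma L_nonempty: "L \<noteq> {}"
  using not_empty by (simp add: space_\<mu>)

lemma AE_poly_nonzero:
  assumes "Q \<noteq> 0"
  shows "AE z in \<mu>. poly (cpoly Q) z \<noteq> 0"
proof -
  have "finite {z. poly (cpoly Q) z = 0}" using assms by (intro poly_roots_finite) simp
  then have "{z. poly (cpoly Q) z = 0} \<in> null_sets hausdorff1" by (rule finite_null_sets_hausdorff1)
  then have "AE z in hausdorff1. poly (cpoly Q) z \<noteq> 0" by (rule AE_I') auto
  then have "AE z in restrict_space hausdorff1 L. poly (cpoly Q) z \<noteq> 0"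
    by (subst AE_restrict_space_iff) (auto elim: eventually_mono)
  then show ?thesis unfolding \<mu>_def lemniscate_measure_def L_def[symmetric]
    by (subst AE_density) (auto intro!: measurable_restrict_space1 elim: eventually_mono)
qed

text \<open>\<open>C\<close> times the product of the \<open>v i - w\<close> is, up to a constant of
  modulus one, the fibre product \<open>R w\<close>. The \<open>v i\<close> are values of
  \<open>V\<close> at zeros of \<open>Q\<close>, nonzero because a common root would make
  \<open>V\<close> divide \<open>Q\<close>; at \<open>w = 0\<close> the resultant bound
  applies.\<close>

lemma norm_product:
  assumes "\<not> V dvd Q" "Q \<noteq> 0"
  obtains C v where "C \<noteq> 0" "\<And>i. i < degree Q \<Longrightarrow> v i \<noteq> 0"
    "\<And>w. (\<And>z. z \<in> level w \<Longrightarrow> poly (pderiv (cpoly V)) z \<noteq> 0) \<Longrightarrow>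
       (\<Prod>z\<in>level w. cmod (poly (cpoly Q) z)) = cmod (C * (\<Prod>i<degree Q. v i - w))"
    "1 \<le> a ^ degree Q * cmod (C * (\<Prod>i<degree Q. v i))"
proof -
  obtain C v where Cv: "C \<noteq> 0" "\<And>i. i < degree Q \<Longrightarrow> \<exists>\<zeta>. poly (cpoly Q) \<zeta> = 0 \<and> v i = poly (cpoly V) \<zeta>"
    "\<And>w. (\<And>z. poly (cpoly V) z = w \<Longrightarrow> poly (pderiv (cpoly V)) z \<noteq> 0) \<Longrightarrow>
       cmod (\<Prod>z\<in>level w. poly (cpoly Q) z) = cmod (C * (\<Prod>i<degree Q. v i - w))"
    using prod_level_set_factorization[of "cpoly V" "cpoly Q"] deg assms(2)
    by (simp only: degree_cpoly cpoly_eq_0_iff not_False_eq_True) blast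
  have v0: "v i \<noteq> 0" if "i < degree Q" for i
    using Cv(2)[OF that] irreducible_dvd_if_common_root[OF irr deg] assms(1) by metis
  have "1 \<le> a ^ degree Q * cmod (C * (\<Prod>i<degree Q. v i))"
    using prod_roots_irreducible_ge[OF irr deg assms(1)] Cv(3)[of 0] irreducible_simple_roots[OF irr deg]
    by (simp add: a_def)
  then show thesis using that[of C v] Cv(1,3) v0 by (simp add: prod_norm)
qed

text \<open>On \<open>L\<close> the logarithm is at most \<open>K\<close>, so
  \<open>g = K - ln |Q|\<close> is nonnegative there and its integral moves to the circle before
  anything is known about integrability. The fibre sum of \<open>g\<close> is
  \<open>m * K - G t\<close>, and the circle estimate for \<open>G\<close> yields both
  claims.\<close>

lemma
  assumes ndvd: "\<not> V dvd Q" and Q: "Q \<noteq> 0"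
  shows integrable_ln_norm: "integrable \<mu> (\<lambda>z. ln (cmod (poly (cpoly Q) z)))"
    and integral_ln_norm_ge: "(LINT z|\<mu>. ln (cmod (poly (cpoly Q) z))) \<ge> - (real (degree Q) / real (degree V)) * ln a"
proof -
  obtain C v where Cv: "C \<noteq> 0" "\<And>i. i < degree Q \<Longrightarrow> v i \<noteq> 0"
    "\<And>w. (\<And>z. z \<in> level w \<Longrightarrow> poly (pderiv (cpoly V)) z \<noteq> 0) \<Longrightarrow>
       (\<Prod>z\<in>level w. cmod (poly (cpoly Q) z)) = cmod (C * (\<Prod>i<degree Q. v i - w))"
    "1 \<le> a ^ degree Q * cmod (C * (\<Prod>i<degree Q. v i))"
    using norm_product[OF assms] by metis
  define G where "G t = ln (cmod C) + (\<Sum>i<degree Q. ln (cmod (v i - complex_of_real r * cis t)))" for t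
  have Gi: "set_integrable lborel {0<..<2*pi} G"
    unfolding G_def by (rule set_integrable_ln_cmod_prod_circle[OF r Cv(1,2)])
  have Gge: "2 * pi * ln (cmod (C * (\<Prod>i<degree Q. v i))) \<le> (LINT t:{0<..<2*pi}|lborel. G t)"
    unfolding G_def by (rule set_integral_ln_cmod_prod_circle_ge[OF r Cv(1,2)])
  obtain B where B: "B > 0" "\<And>z. z \<in> L \<Longrightarrow> cmod (poly (cpoly Q) z) \<le> B" using bounded_on_L by blast
  \<comment> \<open>Adding 1 makes \<open>K\<close> nonnegative, so that \<open>g\<close> is
    nonnegative also at zeros of \<open>Q\<close>, where \<open>ln 0 = 0\<close>.\<close>
  define K where "K = ln (1 + B)"
  define g where "g z = K - ln (cmod (poly (cpoly Q) z))" for z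
  have gm [measurable]: "g \<in> borel_measurable borel" unfolding g_def by measurable
  have g0: "g z \<ge> 0" if "z \<in> L" for z
  proof (cases "poly (cpoly Q) z = 0")
    case False
    have "ln (cmod (poly (cpoly Q) z)) \<le> K"
      unfolding K_def using False B(1) B(2)[OF that] by (subst ln_le_cancel_iff) auto
    then show ?thesis by (simp add: g_def)
  qed (use B in \<open>simp add: g_def K_def\<close>)
  define m where "m = real (degree V)"
  have m: "m > 0" using deg by (simp add: m_def)
  define X where "X = (LINT t:{0<..<2*pi}|lborel. m * K - G t)"
  have cI: "set_integrable lborel {0<..<2*pi} (\<lambda>t. m * K)"
    unfolding set_integrable_def by (auto intro!: integrable_mult_left integrable_real_indicator)
  have KGi: "set_integrable lborel {0<..<2*pi} (\<lambda>t. m * K - G t)"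
    by (rule set_integral_diff(1)[OF cI Gi])
  have mK: "(LINT t:{0<..<2*pi}|lborel. m * K) = 2 * pi * (m * K)"
    unfolding set_lebesgue_integral_def by simp
  have X_le: "X \<le> 2 * pi * (m * K - ln (cmod (C * (\<Prod>i<degree Q. v i))))"
    unfolding X_def set_integral_diff(2)[OF cI Gi] mK right_diff_distrib using Gge by (rule diff_left_mono)
  have AEm: "AE t in lborel. t \<in> {0<..<2*pi} \<longrightarrow>
      (\<Sum>z\<in>level (of_real r * cis t). ennreal (g z)) = ennreal (m * K - G t) \<and> m * K - G t \<ge> 0"
  proof -
    \<comment> \<open>At the discarded parameters a factor of the product vanishes and its logarithm
      does not split into a sum.\<close>
    have "AE t in lborel. t \<in> {0<..<2*pi} \<longrightarrow> of_real r * cis t \<notin> v ` {..<degree Q}"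
      using r by (intro AE_circle_notin_finite) auto
    then show ?thesis using AE_level_simple
    proof eventually_elim
      case (elim t)
      show ?case
      proof
        assume t: "t \<in> {0<..<2*pi}"
        define Z where "Z = level (of_real r * cis t)"
        have simple: "\<And>z. z \<in> Z \<Longrightarrow> poly (pderiv (cpoly V)) z \<noteq> 0" using elim t by (auto simp: Z_def)
        have vt: "v i - of_real r * cis t \<noteq> 0" if "i < degree Q" for i
          using elim(1) t that by (metis eq_iff_diff_eq_0 imageI lessThan_iff)
        have finZ: "finite Z" unfolding Z_def by (rule finite_level)
        have cardZ: "card Z = degree V"
          unfolding Z_def using card_level_set[of "cpoly V" "of_real r * cis t"] simple deg by (auto simp: Z_def)
        have prodZ: "(\<Prod>z\<in>Z. cmod (poly (cpoly Q) z)) = cmod C * (\<Prod>i<degree Q. cmod (v i - of_real r * cis t))"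
          unfolding Z_def using Cv(3)[of "of_real r * cis t"] simple by (simp add: Z_def norm_mult prod_norm)
        also have "\<dots> \<noteq> 0" using Cv(1) vt by auto
        finally have Q0: "poly (cpoly Q) z \<noteq> 0" if "z \<in> Z" for z using that finZ by auto
        have "(\<Sum>z\<in>Z. ln (cmod (poly (cpoly Q) z))) = ln (\<Prod>z\<in>Z. cmod (poly (cpoly Q) z))"
          using finZ Q0 by (intro ln_prod[symmetric]) auto
        also have "\<dots> = G t"
        proof -
          have "(\<Prod>i<degree Q. cmod (v i - of_real r * cis t)) > 0" using vt by (intro prod_pos) auto
          moreover have "ln (\<Prod>i<degree Q. cmod (v i - of_real r * cis t))
             = (\<Sum>i<degree Q. ln (cmod (v i - of_real r * cis t)))" using vt by (intro ln_prod) auto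
          ultimately show ?thesis unfolding prodZ G_def using Cv(1) vt by (auto simp: ln_mult)
        qed
        finally have sumg: "(\<Sum>z\<in>Z. g z) = m * K - G t"
          by (simp add: g_def sum_subtractf cardZ m_def)
        have nonneg: "g z \<ge> 0" if "z \<in> Z" for z
          using g0[OF level_in_L] that unfolding Z_def by blast
        have "(\<Sum>z\<in>Z. ennreal (g z)) = ennreal (m * K - G t)"
          unfolding sumg[symmetric] using nonneg by (rule sum_ennreal)
        moreover have "m * K - G t \<ge> 0" unfolding sumg[symmetric] using nonneg by (rule sum_nonneg)
        ultimately show "(\<Sum>z\<in>level (of_real r * cis t). ennreal (g z)) = ennreal (m * K - G t) \<and> m * K - G t \<ge> 0"
          by (simp add: Z_def)
      qed
    qed
  qed
  have X0: "X \<ge> 0"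
    unfolding X_def set_lebesgue_integral_def
    by (rule integral_nonneg_AE) (use AEm in eventually_elim, auto simp: indicator_def)
  have "(\<integral>\<^sup>+z. ennreal (g z) \<partial>\<mu>) = ennreal (1 / (2 * pi * m)) *
      (\<integral>\<^sup>+t. (\<Sum>z\<in>level (of_real r * cis t). ennreal (g z)) * indicator {0<..<2*pi} t \<partial>lborel)"
    unfolding m_def by (rule nn_integral_\<mu>) measurable
  also have "(\<integral>\<^sup>+t. (\<Sum>z\<in>level (of_real r * cis t). ennreal (g z)) * indicator {0<..<2*pi} t \<partial>lborel)
      = (\<integral>\<^sup>+t. ennreal (indicator {0<..<2*pi} t *\<^sub>R (m * K - G t)) \<partial>lborel)"
    by (rule nn_integral_cong_AE) (use AEm in eventually_elim, auto simp: indicator_def)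
  also have "\<dots> = ennreal X"
    unfolding X_def set_lebesgue_integral_def
    by (rule nn_integral_eq_integral)
       (use KGi in \<open>simp add: set_integrable_def\<close>, use AEm in eventually_elim, auto simp: indicator_def)
  also have "ennreal (1 / (2 * pi * m)) * ennreal X = ennreal (X / (2 * pi * m))"
    using m X0 by (subst ennreal_mult[symmetric]) auto
  finally have nng: "(\<integral>\<^sup>+z. ennreal (g z) \<partial>\<mu>) = ennreal (X / (2 * pi * m))" .
  have AEg0: "AE z in \<mu>. 0 \<le> g z" by (rule AE_I2) (simp add: space_\<mu> g0)
  have gi: "integrable \<mu> g"
    by (rule integrableI_nonneg[OF _ AEg0]) (auto simp: nng intro!: measurable_\<mu>)
  have LG: "(LINT z|\<mu>. g z) = X / (2 * pi * m)"
    by (rule integral_eq_nn_integral[OF _ AEg0, THEN trans]) (use nng m X0 in \<open>auto intro!: measurable_\<mu>\<close>)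
  have lng: "(\<lambda>z. ln (cmod (poly (cpoly Q) z))) = (\<lambda>z. K - g z)" by (auto simp: g_def)
  show "integrable \<mu> (\<lambda>z. ln (cmod (poly (cpoly Q) z)))" unfolding lng using gi by simp
  have "(LINT z|\<mu>. ln (cmod (poly (cpoly Q) z))) = K - X / (2 * pi * m)"
    unfolding lng using gi by (simp add: LG prob_space)
  moreover have "X / (2 * pi * m) \<le> K - ln (cmod (C * (\<Prod>i<degree Q. v i))) / m"
    using X_le m by (simp add: field_simps)
  moreover have "- real (degree Q) * ln a / m \<le> ln (cmod (C * (\<Prod>i<degree Q. v i))) / m"
  proof -
    define R where "R = cmod (C * (\<Prod>i<degree Q. v i))"
    have R: "R > 0" using Cv(1,2) by (auto simp: R_def)
    have a: "a > 0" using a_ge_1 by simp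
    have "0 \<le> ln (a ^ degree Q * R)" using Cv(4) by (simp add: R_def)
    also have "\<dots> = real (degree Q) * ln a + ln R" using R a by (simp add: ln_mult ln_realpow)
    finally have "- real (degree Q) * ln a \<le> ln R" by simp
    then show ?thesis unfolding R_def using m by (intro divide_right_mono) auto
  qed
  moreover have "- (real (degree Q) / real (degree V)) * ln a = - real (degree Q) * ln a / m"
    by (simp add: m_def)
  ultimately show "(LINT z|\<mu>. ln (cmod (poly (cpoly Q) z))) \<ge> - (real (degree Q) / real (degree V)) * ln a"
    by linarith
qed

lemma degree_eq_0_if_AE_constant:
  assumes ndvd: "\<not> V dvd Q" and Q: "Q \<noteq> 0"
    and ae: "AE z in \<mu>. cmod (poly (cpoly Q) z) = c" and c: "c \<le> lower_bound Q"
  shows "degree Q = 0"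
proof (rule ccontr)
  assume n: "degree Q \<noteq> 0"
  obtain C v where Cv: "C \<noteq> 0" "\<And>i. i < degree Q \<Longrightarrow> v i \<noteq> 0"
    "\<And>w. (\<And>z. z \<in> level w \<Longrightarrow> poly (pderiv (cpoly V)) z \<noteq> 0) \<Longrightarrow>
       (\<Prod>z\<in>level w. cmod (poly (cpoly Q) z)) = cmod (C * (\<Prod>i<degree Q. v i - w))"
    "1 \<le> a ^ degree Q * cmod (C * (\<Prod>i<degree Q. v i))"
    using norm_product[OF ndvd Q] by metis
  define R where "R = Polynomial.smult C (\<Prod>i<degree Q. [:v i, - 1:])"
  have R: "poly R w = C * (\<Prod>i<degree Q. v i - w)" for w by (simp add: R_def poly_prod)
  \<comment> \<open>The exceptional set \<open>|Q| \<noteq> c\<close> becomes a function with values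
    0 and 1, whose integral transfers from \<open>L\<close> to the circle.\<close>
  define f :: "complex \<Rightarrow> ennreal" where "f z = (if cmod (poly (cpoly Q) z) = c then 0 else 1)" for z
  have fm [measurable]: "f \<in> borel_measurable borel" unfolding f_def by measurable
  have "(\<integral>\<^sup>+z. f z \<partial>\<mu>) = 0"
    by (subst nn_integral_0_iff_AE) (use ae in \<open>auto simp: f_def elim: eventually_mono intro!: measurable_\<mu>\<close>)
  then have "ennreal (1 / (2 * pi * degree V)) *
      (\<integral>\<^sup>+t. (\<Sum>z\<in>level (of_real r * cis t). f z) * indicator {0<..<2*pi} t \<partial>lborel) = 0"
    by (subst (asm) nn_integral_\<mu>) auto
  then have int0: "(\<integral>\<^sup>+t. (\<Sum>z\<in>level (of_real r * cis t). f z) * indicator {0<..<2*pi} t \<partial>lborel) = 0"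
    using deg by (auto simp: ennreal_eq_0_iff mult_le_0_iff)
  obtain g where g [measurable]: "g \<in> borel_measurable borel" and
    gAE: "AE t in lborel. (\<Sum>z\<in>level (of_real r * cis t). f z) * indicator {0<..<2*pi} t = g t"
    using level_sum_AE_eq_measurable[of "cpoly V" r f] deg r by auto
  have "(\<integral>\<^sup>+t. g t \<partial>lborel) = 0" using int0 nn_integral_cong_AE[OF gAE] by simp
  then have "AE t in lborel. g t = 0" by (subst (asm) nn_integral_0_iff_AE) auto
  then have "AE t in lborel. t \<in> {0<..<2*pi} \<longrightarrow> cmod (poly R (of_real r * cis t)) = c ^ degree V"
    using gAE AE_level_simple
  proof eventually_elim
    case (elim t)
    show ?case
    proof
      assume t: "t \<in> {0<..<2*pi}"
      then have "(\<Sum>z\<in>level (of_real r * cis t). f z) = 0" using elim by simp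
      then have "\<forall>z\<in>level (of_real r * cis t). f z = 0"
        using finite_level by (simp add: sum_eq_0_iff)
      then have cz: "cmod (poly (cpoly Q) z) = c" if "z \<in> level (of_real r * cis t)" for z
        using that by (auto simp: f_def split: if_splits)
      have "cmod (poly R (of_real r * cis t)) = (\<Prod>z\<in>level (of_real r * cis t). cmod (poly (cpoly Q) z))"
        unfolding R by (rule Cv(3)[symmetric]) (use elim t in auto)
      also have "\<dots> = c ^ card (level (of_real r * cis t))" using cz by simp
      also have "card (level (of_real r * cis t)) = degree V"
        using card_level_set[of "cpoly V" "of_real r * cis t"] elim t deg by auto
      finally show "cmod (poly R (of_real r * cis t)) = c ^ degree V" .
    qed
  qed
  then have circ: "cmod (poly R w) = c ^ degree V" if "cmod w = r" for w
    by (rule continuous_AE_circle_imp_all[OF _ r _ that, rotated]) (intro continuous_intros)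
  have "c \<ge> 0"
  proof -
    have "AE z in \<mu>. c \<ge> 0" using ae by eventually_elim auto
    then show ?thesis by simp
  qed
  \<comment> \<open>With \<open>m\<close> and \<open>n\<close> the degrees of \<open>V\<close> and
    \<open>Q\<close>, the chain \<open>c^m \<le> a^(-n) \<le> |R 0|\<close> bounds the constant
    modulus of \<open>R\<close> on the circle by its modulus at the centre.\<close>
  have "c ^ degree V \<le> lower_bound Q ^ degree V" using c \<open>c \<ge> 0\<close> by (rule power_mono)
  also have "\<dots> = 1 / a ^ degree Q"
  proof -
    have "lower_bound Q ^ degree V = a powr (- (real (degree Q) / real (degree V)) * real (degree V))"
      using a_ge_1 by (subst powr_realpow[symmetric]) (auto simp: powr_powr)
    also have "\<dots> = a powr - real (degree Q)" using deg by simp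
    finally show ?thesis using a_ge_1 by (simp add: powr_minus powr_realpow divide_inverse)
  qed
  also have "\<dots> \<le> cmod (poly R 0)" using Cv(4) a_ge_1 by (simp add: R field_simps)
  finally have "degree R = 0" by (intro maximum_modulus_poly_circle[OF r]) (simp add: circ)
  then obtain k where "R = [:k:]" by (rule degree_eq_zeroE)
  then have "poly R (v 0) = poly R 0" by simp
  \<comment> \<open>The root \<open>v 0\<close> exists because \<open>degree Q\<close> is nonzero,
    whereas \<open>R\<close> does not vanish at 0.\<close>
  moreover have "poly R (v 0) = 0" using n by (auto simp: R)
  ultimately show False using Cv(1,2) by (auto simp: R)
qed

lemma integrable_norm_powr: "integrable \<mu> (\<lambda>z. cmod (poly (cpoly Q) z) powr p)" if p: "p > 0"
proof -
  obtain B where B: "B > 0" "\<And>z. z \<in> L \<Longrightarrow> cmod (poly (cpoly Q) z) \<le> B" using bounded_on_L by blast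
  show ?thesis
  proof (rule integrable_const_bound[of _ "B powr p"])
    show "AE z in \<mu>. norm (cmod (poly (cpoly Q) z) powr p) \<le> B powr p"
      using B p by (intro AE_I2) (auto simp: space_\<mu> intro!: powr_mono2)
  qed (rule measurable_\<mu>, measurable)
qed

text \<open>Jensen's inequality in the form \<open>ln x \<le> x - 1\<close>, whose equality case is \<open>x = 1\<close>.\<close>

lemma
  assumes ndvd: "\<not> V dvd Q" and Q: "Q \<noteq> 0" and p: "p > 0"
  shows lp_norm_ge: "lower_bound Q \<le> (LINT z|\<mu>. cmod (poly (cpoly Q) z) powr p) powr (1 / p)"
    and lp_norm_le_imp_constant:
      "(LINT z|\<mu>. cmod (poly (cpoly Q) z) powr p) powr (1 / p) \<le> lower_bound Q \<Longrightarrow> degree Q = 0"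
proof -
  define c where "c = exp (LINT z|\<mu>. ln (cmod (poly (cpoly Q) z)))"
  have c: "c > 0" "ln c = (LINT z|\<mu>. ln (cmod (poly (cpoly Q) z)))" by (auto simp: c_def)
  define X where "X = (LINT z|\<mu>. cmod (poly (cpoly Q) z) powr p)"
  have X0: "X \<ge> 0" unfolding X_def by (intro integral_nonneg_AE) auto
  have low: "lower_bound Q \<le> c"
  proof -
    have "lower_bound Q = exp (- (real (degree Q) / real (degree V)) * ln a)"
      using a_ge_1 by (simp add: powr_def)
    also have "\<dots> \<le> c" unfolding c_def using integral_ln_norm_ge[OF ndvd Q] by simp
    finally show ?thesis .
  qed
  \<comment> \<open>This is \<open>x - 1 - ln x\<close> for \<open>x = (|Q z| / c)^p\<close>, with
    the logarithm expanded so that integrability is immediate; the two forms agree where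
    \<open>Q z\<close> is nonzero. The logarithmic term integrates to 0 because \<open>c\<close> is
    the geometric mean of \<open>|Q|\<close>.\<close>
  define h where "h z = cmod (poly (cpoly Q) z) powr p / c powr p - 1 - p * (ln (cmod (poly (cpoly Q) z)) - ln c)" for z
  have hi: "integrable \<mu> h"
    unfolding h_def using integrable_norm_powr[OF p, of Q] integrable_ln_norm[OF ndvd Q] by simp
  have hX: "(LINT z|\<mu>. h z) = X / c powr p - 1"
    unfolding h_def X_def c(2) using integrable_norm_powr[OF p, of Q] integrable_ln_norm[OF ndvd Q]
    by (simp add: prob_space)
  have hln: "h z = (cmod (poly (cpoly Q) z) / c) powr p - 1 - ln ((cmod (poly (cpoly Q) z) / c) powr p)"
    if "poly (cpoly Q) z \<noteq> 0" for z
    using that c(1) by (simp add: h_def powr_divide ln_powr ln_div algebra_simps)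
  have h0: "AE z in \<mu>. 0 \<le> h z"
    using AE_poly_nonzero[OF Q]
  proof eventually_elim
    case (elim z)
    show ?case unfolding hln[OF elim] using ln_le_minus_one[of "(cmod (poly (cpoly Q) z) / c) powr p"] elim c(1) by simp
  qed
  have "0 \<le> X / c powr p - 1" unfolding hX[symmetric] by (rule integral_nonneg_AE[OF h0])
  then have "c powr p \<le> X" using c(1) by (simp add: field_simps)
  then have "(c powr p) powr (1 / p) \<le> X powr (1 / p)" using p by (intro powr_mono2) auto
  then have cN: "c \<le> X powr (1 / p)" using c(1) p by (simp add: powr_powr)
  with low show "lower_bound Q \<le> (LINT z|\<mu>. cmod (poly (cpoly Q) z) powr p) powr (1 / p)"
    by (simp add: X_def)
  assume "(LINT z|\<mu>. cmod (poly (cpoly Q) z) powr p) powr (1 / p) \<le> lower_bound Q"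
  \<comment> \<open>The lower bound is at most \<open>c\<close> and \<open>c\<close> is at most the
    norm, so the assumed upper bound forces equality throughout.\<close>
  then have eq: "X powr (1 / p) = c" "c \<le> lower_bound Q" using low cN by (auto simp: X_def)
  have "X = (X powr (1 / p)) powr p" using X0 p by (simp add: powr_powr)
  then have "X = c powr p" by (simp add: eq)
  then have "(LINT z|\<mu>. h z) = 0" using c(1) by (simp add: hX)
  then have "AE z in \<mu>. h z = 0" using integral_nonneg_eq_0_iff_AE[OF hi h0] by simp
  then have "AE z in \<mu>. cmod (poly (cpoly Q) z) = c"
    using AE_poly_nonzero[OF Q]
  proof eventually_elim
    case (elim z)
    define x where "x = (cmod (poly (cpoly Q) z) / c) powr p"
    have "x > 0" using elim c(1) by (simp add: x_def)
    moreover have "ln x = x - 1" using elim(1) unfolding hln[OF elim(2)] x_def by simp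
    ultimately have "x = 1" by (rule ln_eq_minus_one)
    then have "p * ln (cmod (poly (cpoly Q) z) / c) = 0"
      using elim(2) c(1) by (simp add: x_def flip: ln_powr)
    then have "cmod (poly (cpoly Q) z) / c = 1" using p c(1) elim(2) by (simp add: ln_eq_zero_iff)
    then show ?case using c(1) by simp
  qed
  then show "degree Q = 0" using eq(2) by (rule degree_eq_0_if_AE_constant[OF ndvd Q])
qed

section \<open>Common properties of the norms and of the Mahler measure\<close>

lemma V_power_mult_norm: "z \<in> L \<Longrightarrow> cmod (poly (cpoly (V ^ l * Q)) z) = r ^ l * cmod (poly (cpoly Q) z)"
  by (simp add: cpoly_mult cpoly_power norm_mult norm_power mem_L)

lemma lemniscate_norm_real:
  "lemniscate_norm V r (ereal p) Q = (LINT z|\<mu>. cmod (poly (cpoly Q) z) powr p) powr (1 / p)"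
  by (simp add: lemniscate_norm_def \<mu>_def)

lemma bdd_above_norm_L: "bdd_above ((\<lambda>z. cmod (poly (cpoly Q) z)) ` L)"
proof -
  obtain B where "\<And>z. z \<in> L \<Longrightarrow> cmod (poly (cpoly Q) z) \<le> B" using bounded_on_L by blast
  then show ?thesis by (rule bdd_aboveI2)
qed

lemma lemniscate_norm_infinity: "lemniscate_norm V r \<infinity> Q = (SUP z\<in>L. cmod (poly (cpoly Q) z))"
  by (simp add: lemniscate_norm_def L_def)

text \<open>\<open>\<mu>\<close> has mass one, so a mean is at most the supremum. This carries both
  the lower bound and the equality case from \<open>p = 1\<close> to
  \<open>p = \<infinity>\<close>.\<close>

lemma lemniscate_norm_1_le_infinity: "lemniscate_norm V r (ereal 1) Q \<le> lemniscate_norm V r \<infinity> Q"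
proof -
  have "(LINT z|\<mu>. cmod (poly (cpoly Q) z) powr 1) \<le> (LINT z|\<mu>. lemniscate_norm V r \<infinity> Q)"
  proof (rule integral_mono_AE)
    show "integrable \<mu> (\<lambda>z. cmod (poly (cpoly Q) z) powr 1)" by (rule integrable_norm_powr) simp
    show "AE z in \<mu>. cmod (poly (cpoly Q) z) powr 1 \<le> lemniscate_norm V r \<infinity> Q"
      unfolding lemniscate_norm_infinity
      by (rule AE_I2) (auto simp: space_\<mu> intro!: cSUP_upper bdd_above_norm_L)
  qed simp
  moreover have "0 \<le> (LINT z|\<mu>. cmod (poly (cpoly Q) z) powr 1)" by (intro integral_nonneg_AE) auto
  ultimately show ?thesis unfolding lemniscate_norm_real by (simp add: prob_space)
qed

lemma ereal_pos_cases:
  assumes "0 < (p::ereal)"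
  obtains (real) q where "p = ereal q" "q > 0" | (infinity) "p = \<infinity>"
  using assms by (cases p) auto

lemma lemniscate_norm_ge:
  assumes "0 < p" "\<not> V dvd Q" "Q \<noteq> 0"
  shows "lower_bound Q \<le> lemniscate_norm V r p Q"
  using assms(1)
proof (cases rule: ereal_pos_cases)
  case (real q)
  then show ?thesis using lp_norm_ge[OF assms(2,3)] by (simp add: lemniscate_norm_real)
next
  case infinity
  have "lower_bound Q \<le> lemniscate_norm V r (ereal 1) Q"
    unfolding lemniscate_norm_real by (rule lp_norm_ge[OF assms(2,3)]) simp
  then show ?thesis using lemniscate_norm_1_le_infinity[of Q] by (simp add: infinity)
qed

lemma lemniscate_norm_le_imp_constant:
  assumes "0 < p" "\<not> V dvd Q" "Q \<noteq> 0" "lemniscate_norm V r p Q \<le> lower_bound Q"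
  shows "degree Q = 0"
  using assms(1)
proof (cases rule: ereal_pos_cases)
  case (real q)
  then show ?thesis using lp_norm_le_imp_constant[OF assms(2,3)] assms(4) by (simp add: lemniscate_norm_real)
next
  case infinity
  then have "lemniscate_norm V r (ereal 1) Q \<le> lower_bound Q"
    using lemniscate_norm_1_le_infinity[of Q] assms(4) by simp
  then show ?thesis unfolding lemniscate_norm_real by (rule lp_norm_le_imp_constant[OF assms(2,3), rotated]) simp
qed

lemma lemniscate_norm_V_power_mult:
  assumes "0 < p"
  shows "lemniscate_norm V r p (V ^ l * Q) = r ^ l * lemniscate_norm V r p Q"
  using assms
proof (cases rule: ereal_pos_cases)
  case (real q)
  have X0: "0 \<le> (LINT z|\<mu>. cmod (poly (cpoly Q) z) powr q)" by (intro integral_nonneg_AE) auto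
  have "(LINT z|\<mu>. cmod (poly (cpoly (V ^ l * Q)) z) powr q) = (LINT z|\<mu>. (r ^ l) powr q * cmod (poly (cpoly Q) z) powr q)"
    using r by (intro Bochner_Integration.integral_cong) (auto simp: space_\<mu> V_power_mult_norm powr_mult)
  then show ?thesis using r real X0
    by (simp add: lemniscate_norm_real powr_mult powr_powr)
next
  case infinity
  have rl: "r ^ l > 0" using r by simp
  have eq: "(SUP z\<in>L. cmod (poly (cpoly (V ^ l * Q)) z)) = (SUP z\<in>L. r ^ l * cmod (poly (cpoly Q) z))"
    by (intro SUP_cong refl V_power_mult_norm)
  have "(SUP z\<in>L. r ^ l * cmod (poly (cpoly Q) z)) = r ^ l * (SUP z\<in>L. cmod (poly (cpoly Q) z))"
  proof (rule antisym)
    show "(SUP z\<in>L. r ^ l * cmod (poly (cpoly Q) z)) \<le> r ^ l * (SUP z\<in>L. cmod (poly (cpoly Q) z))"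
      using rl by (intro cSUP_least L_nonempty mult_left_mono cSUP_upper bdd_above_norm_L) auto
    have "bdd_above ((\<lambda>z. r ^ l * cmod (poly (cpoly Q) z)) ` L)"
      using bdd_above_norm_L[of "V ^ l * Q"] by (simp add: V_power_mult_norm cong: image_cong)
    then have "r ^ l * cmod (poly (cpoly Q) z) \<le> (SUP z\<in>L. r ^ l * cmod (poly (cpoly Q) z))" if "z \<in> L" for z
      using that by (intro cSUP_upper)
    then have "(SUP z\<in>L. cmod (poly (cpoly Q) z)) \<le> (SUP z\<in>L. r ^ l * cmod (poly (cpoly Q) z)) / r ^ l"
      using rl by (intro cSUP_least L_nonempty) (simp add: field_simps)
    then show "r ^ l * (SUP z\<in>L. cmod (poly (cpoly Q) z)) \<le> (SUP z\<in>L. r ^ l * cmod (poly (cpoly Q) z))"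
      using rl by (simp add: field_simps)
  qed
  then show ?thesis unfolding infinity lemniscate_norm_infinity eq .
qed

lemma lemniscate_norm_const:
  assumes "0 < p"
  shows "lemniscate_norm V r p [:q:] = \<bar>real_of_int q\<bar>"
  using assms
proof (cases rule: ereal_pos_cases)
  case (real s)
  then show ?thesis by (simp add: lemniscate_norm_real map_poly_pCons prob_space powr_powr)
next
  case infinity
  then show ?thesis using L_nonempty by (simp add: lemniscate_norm_infinity map_poly_pCons)
qed

lemma lemniscate_mahler_ge:
  assumes "\<not> V dvd Q" "Q \<noteq> 0"
  shows "lower_bound Q \<le> lemniscate_mahler V r Q"
proof -
  have "lower_bound Q = exp (- (real (degree Q) / real (degree V)) * ln a)"
    using a_ge_1 by (simp add: powr_def)
  also have "\<dots> \<le> lemniscate_mahler V r Q"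
    unfolding lemniscate_mahler_def \<mu>_def[symmetric] using integral_ln_norm_ge[OF assms] by simp
  finally show ?thesis .
qed

lemma lemniscate_mahler_V_power_mult:
  assumes "\<not> V dvd Q" "Q \<noteq> 0"
  shows "lemniscate_mahler V r (V ^ l * Q) = r ^ l * lemniscate_mahler V r Q"
proof -
  have "(LINT z|\<mu>. ln (cmod (poly (cpoly (V ^ l * Q)) z))) = (LINT z|\<mu>. real l * ln r + ln (cmod (poly (cpoly Q) z)))"
  proof (rule integral_cong_AE)
    \<comment> \<open>At a zero of \<open>Q\<close> both logarithms of polynomial values are 0 by
      convention, and the term \<open>l ln r\<close> would be left over.\<close>
    show "AE z in \<mu>. ln (cmod (poly (cpoly (V ^ l * Q)) z)) = real l * ln r + ln (cmod (poly (cpoly Q) z))"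
      using AE_poly_nonzero[OF assms(2)] AE_space
    proof eventually_elim
      case (elim z)
      then show ?case using r by (simp add: space_\<mu> V_power_mult_norm ln_mult ln_realpow)
    qed
  qed (rule measurable_\<mu>, measurable)+
  also have "\<dots> = real l * ln r + (LINT z|\<mu>. ln (cmod (poly (cpoly Q) z)))"
    using integrable_ln_norm[OF assms] by (simp add: prob_space)
  finally show ?thesis
    unfolding lemniscate_mahler_def \<mu>_def[symmetric] using r
    by (simp add: exp_add exp_of_nat_mult)
qed

lemma lemniscate_mahler_const: "q \<noteq> 0 \<Longrightarrow> lemniscate_mahler V r [:q:] = \<bar>real_of_int q\<bar>"
  unfolding lemniscate_mahler_def \<mu>_def[symmetric] by (simp add: map_poly_pCons prob_space)

end

section \<open>The extremal problem for an abstract functional\<close>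

text \<open>The common core of the p-norms and the Mahler measure: powers of \<open>V\<close> factor
  out because \<open>|V| = r\<close> on \<open>L\<close>, the cofactor obeys the resultant bound,
  and constants are measured by absolute value. The infimum and the extremal polynomials are found
  from this alone.\<close>

locale extremal_functional = irreducible_lemniscate +
  fixes N :: "int poly \<Rightarrow> real"
  assumes mult: "\<not> V dvd Q \<Longrightarrow> Q \<noteq> 0 \<Longrightarrow> N (V ^ l * Q) = r ^ l * N Q"
    and ge: "\<not> V dvd Q \<Longrightarrow> Q \<noteq> 0 \<Longrightarrow> lower_bound Q \<le> N Q"
    and const: "q \<noteq> 0 \<Longrightarrow> N [:q:] = \<bar>real_of_int q\<bar>"
    and r_le: "r \<le> 1 / a"
begin

lemma not_dvd_const: "q \<noteq> 0 \<Longrightarrow> \<not> V dvd [:q:]"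
proof
  assume "q \<noteq> 0" "V dvd [:q:]"
  then have "degree V \<le> degree [:q:]" by (intro dvd_imp_degree_le) auto
  with deg show False by simp
qed

lemma power_mult_const: "q \<noteq> 0 \<Longrightarrow> N (V ^ l * [:q:]) = r ^ l * \<bar>real_of_int q\<bar>"
  using mult[OF not_dvd_const] const by simp

lemma V_power: "N (V ^ l) = r ^ l" and uminus_V_power: "N (- (V ^ l)) = r ^ l"
  using power_mult_const[of 1 l] power_mult_const[of "-1" l] by auto

lemma V_power_mult_unit:
  assumes "P = V ^ l * [:q:]" "\<bar>real_of_int q\<bar> = 1"
  shows "P = V ^ l \<or> P = - (V ^ l)"
proof -
  have "q = 1 \<or> q = -1" using assms(2) by linarith
  then show ?thesis using assms(1) by auto
qed

context
  fixes P :: "int poly" and k :: nat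
  assumes P: "P \<noteq> 0" "degree P \<le> k * degree V"
begin

text \<open>\<open>l\<close> is the exact multiplicity of \<open>V\<close> in \<open>P\<close>. The
  degree left for \<open>Q\<close> is at most \<open>(k - l) * degree V\<close>, and as
  \<open>a \<ge> 1\<close> the lower bound does not increase with the degree of \<open>Q\<close>, so
  it stays above \<open>(1 / a)^(k - l)\<close>.\<close>

lemma decomposition:
  obtains l Q where "P = V ^ l * Q" "\<not> V dvd Q" "Q \<noteq> 0" "l \<le> k" "degree Q \<le> (k - l) * degree V"
    "N P = r ^ l * N Q" "(1 / a) ^ (k - l) \<le> lower_bound Q"
proof -
  obtain Q where Q: "P = V ^ multiplicity V P * Q" "\<not> V dvd Q"
    using multiplicity_decompose'[OF P(1) irreducible_not_unit[OF irr]] by blast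
  define l where "l = multiplicity V P"
  have PQ: "P = V ^ l * Q" unfolding l_def by (rule Q(1))
  have Q0: "Q \<noteq> 0" using PQ P(1) by auto
  have V0: "V \<noteq> 0" using deg by auto
  have "degree P = l * degree V + degree Q"
    unfolding PQ using Q0 V0 by (simp add: degree_mult_eq degree_power_eq)
  then have dl: "l * degree V + degree Q \<le> k * degree V" using P(2) by simp
  then have "l * degree V \<le> k * degree V" by (rule add_leD1)
  then have lk: "l \<le> k" using deg by simp
  have dQ: "degree Q \<le> (k - l) * degree V" using dl by (simp add: diff_mult_distrib)
  have "(1 / a) ^ (k - l) = a powr - real (k - l)"
    using a_ge_1 by (simp add: powr_minus powr_realpow power_inverse divide_inverse)
  also have "\<dots> \<le> lower_bound Q"
  proof (rule powr_mono)
    have "real (degree Q) \<le> real (k - l) * real (degree V)" using dQ by (metis of_nat_le_iff of_nat_mult)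
    then show "- real (k - l) \<le> - (real (degree Q) / real (degree V))"
      using deg by (simp add: field_simps)
  qed (rule a_ge_1)
  finally have "(1 / a) ^ (k - l) \<le> lower_bound Q" .
  moreover have "N P = r ^ l * N Q" unfolding PQ by (rule mult[OF Q(2) Q0])
  ultimately show thesis using that[OF PQ Q(2) Q0 lk dQ] by simp
qed

text \<open>Each of the \<open>k - l\<close> missing factors \<open>V\<close> is replaced by a
  factor \<open>1 / a\<close> in the bound for the cofactor, which is at least
  \<open>r\<close>.\<close>

lemma lower: "r ^ k \<le> N P"
proof -
  obtain l Q where lQ: "\<not> V dvd Q" "Q \<noteq> 0" "l \<le> k" "N P = r ^ l * N Q" "(1 / a) ^ (k - l) \<le> lower_bound Q"
    using decomposition by metis
  have "r ^ k = r ^ l * r ^ (k - l)" using lQ(3) by (simp flip: power_add)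
  also have "\<dots> \<le> r ^ l * N Q"
  proof (rule mult_left_mono)
    have "r ^ (k - l) \<le> (1 / a) ^ (k - l)" using r_le r by (intro power_mono) auto
    then show "r ^ (k - l) \<le> N Q" using lQ(5) ge[OF lQ(1,2)] by linarith
  qed (use r in simp)
  finally show ?thesis by (simp add: lQ(4))
qed

text \<open>A missing factor \<open>V\<close> would cost \<open>1 / a > r\<close> and push
  \<open>N P\<close> above \<open>r^k\<close>; hence \<open>l = k\<close>, and the cofactor is a
  constant of absolute value 1.\<close>

lemma eq_interior:
  assumes eq: "N P = r ^ k" and lt: "r < 1 / a"
  shows "P = V ^ k \<or> P = - (V ^ k)"
proof -
  obtain l Q where lQ: "P = V ^ l * Q" "\<not> V dvd Q" "Q \<noteq> 0" "l \<le> k" "degree Q \<le> (k - l) * degree V"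
    "N P = r ^ l * N Q" "(1 / a) ^ (k - l) \<le> lower_bound Q" using decomposition by metis
  have "r ^ l * N Q = r ^ l * r ^ (k - l)" using lQ(4,6) eq by (simp flip: power_add)
  then have NQ: "N Q = r ^ (k - l)" using r by simp
  have "l = k"
  proof (rule ccontr)
    assume "l \<noteq> k"
    then have "r ^ (k - l) < (1 / a) ^ (k - l)" using lt r lQ(4) by (intro power_strict_mono) auto
    then show False using NQ lQ(7) ge[OF lQ(2,3)] by linarith
  qed
  then obtain q where q: "Q = [:q:]" using lQ(5) by (auto elim: degree_eq_zeroE)
  then have "\<bar>real_of_int q\<bar> = 1" using NQ const[of q] lQ(3) \<open>l = k\<close> by simp
  then show ?thesis using V_power_mult_unit[of P k q] lQ(1) q \<open>l = k\<close> by simp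
qed

text \<open>Now \<open>1 / a = r\<close>, and a missing factor \<open>V\<close> need not raise the
  value, so constancy of the cofactor rests on \<open>strict\<close>. It is assumed here and not in
  the locale because the Mahler measure violates it: for \<open>V = z\<close> and
  \<open>r = 1\<close> the polynomial \<open>z - 1\<close> has Mahler measure 1, equal to its lower
  bound. The exponent \<open>l\<close> stays open: \<open>r^l = r^k\<close> determines it when
  \<open>r < 1\<close> and is empty when \<open>r = 1\<close>.\<close>

lemma eq_boundary:
  assumes eq: "N P = r ^ k" and ra: "r = 1 / a"
    and strict: "\<And>Q. \<not> V dvd Q \<Longrightarrow> Q \<noteq> 0 \<Longrightarrow> N Q \<le> lower_bound Q \<Longrightarrow> degree Q = 0"
  obtains l where "l \<le> k" "P = V ^ l \<or> P = - (V ^ l)" "r ^ l = r ^ k"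
proof -
  obtain l Q where lQ: "P = V ^ l * Q" "\<not> V dvd Q" "Q \<noteq> 0" "l \<le> k" "N P = r ^ l * N Q"
    "(1 / a) ^ (k - l) \<le> lower_bound Q" using decomposition by metis
  have "r ^ l * N Q = r ^ l * r ^ (k - l)" using lQ(4,5) eq by (simp flip: power_add)
  then have NQ: "N Q = r ^ (k - l)" using r by simp
  then have "degree Q = 0" using lQ(6) by (intro strict lQ(2,3)) (simp add: ra)
  then obtain q where q: "Q = [:q:]" by (rule degree_eq_zeroE)
  then have qr: "\<bar>real_of_int q\<bar> = r ^ (k - l)" using NQ const[of q] lQ(3) by simp
  have "r \<le> 1" using a_ge_1 by (simp add: ra)
  then have "r ^ (k - l) \<le> 1" using r by (intro power_le_one) auto
  moreover have "q \<noteq> 0" using q lQ(3) by simp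
  \<comment> \<open>\<open>|q|\<close> is a positive integer and equals \<open>r^(k - l)\<close>,
    which is at most 1.\<close>
  ultimately have q1: "\<bar>real_of_int q\<bar> = 1" using qr by linarith
  then have "r ^ l = r ^ k" using qr lQ(4) by (metis le_add_diff_inverse mult.right_neutral power_add)
  then show thesis using that[of l] V_power_mult_unit[of P l q] lQ(1,4) q q1 by auto
qed

end

lemma Inf_eq: "Inf {N P | P. P \<noteq> 0 \<and> degree P \<le> k * degree V} = r ^ k"
proof (rule cInf_eq_minimum)
  have "V ^ k \<noteq> 0" "degree (V ^ k) \<le> k * degree V" using deg degree_power_le[of V k] by (auto simp: mult.commute)
  then show "r ^ k \<in> {N P | P. P \<noteq> 0 \<and> degree P \<le> k * degree V}"
    using V_power[of k] by (intro CollectI exI[of _ "V ^ k"]) simp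
  show "r ^ k \<le> x" if "x \<in> {N P | P. P \<noteq> 0 \<and> degree P \<le> k * degree V}" for x
    using that by (elim CollectE exE conjE) (simp add: lower)
qed

end

context irreducible_lemniscate
begin

lemma extremal_functional_norm:
  "r \<le> 1 / a \<Longrightarrow> 0 < p \<Longrightarrow> extremal_functional V r (lemniscate_norm V r p)"
  by unfold_locales (auto simp: lemniscate_norm_V_power_mult lemniscate_norm_ge lemniscate_norm_const)

lemma extremal_functional_mahler:
  "r \<le> 1 / a \<Longrightarrow> extremal_functional V r (lemniscate_mahler V r)"
  by unfold_locales (auto simp: lemniscate_mahler_V_power_mult lemniscate_mahler_ge lemniscate_mahler_const)

end

text \<open>For \<open>r = 1\<close> every \<open>V^j\<close> with \<open>j \<le> k\<close> has norm
  \<open>1 = r^k\<close>, so the third case must list all these powers, with \<open>P = 1\<close>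
  and \<open>P = - 1\<close> standing for the exponent 0. For \<open>k \<ge> 2\<close> the list
  consisting of \<open>V^k\<close>, 1 and their negatives alone would be incomplete.\<close>

theorem theorem1p2:
  fixes V :: "int poly" and r :: real and k :: nat
  assumes "irreducible V"
    and "degree V \<ge> 1"
    and "0 < r"
    and "r \<le> 1 / \<bar>real_of_int (lead_coeff V)\<bar>"
    and "k \<ge> 1"
  shows "(\<forall>p::ereal. 0 < p \<longrightarrow>
            Inf {lemniscate_norm V r p P | P. P \<noteq> 0 \<and> degree P \<le> k * degree V} = r ^ k)
       \<and> Inf {lemniscate_mahler V r P | P. P \<noteq> 0 \<and> degree P \<le> k * degree V} = r ^ k
       \<and> (\<forall>P::int poly. P \<noteq> 0 \<and> degree P \<le> k * degree V \<longrightarrow>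
            (r < 1 / \<bar>real_of_int (lead_coeff V)\<bar> \<longrightarrow>
               ((\<exists>p::ereal. 0 < p \<and> lemniscate_norm V r p P = r ^ k) \<or> lemniscate_mahler V r P = r ^ k
                  \<longleftrightarrow> P = V ^ k \<or> P = - (V ^ k)))
          \<and> (r = 1 / \<bar>real_of_int (lead_coeff V)\<bar> \<and> r < 1 \<longrightarrow>
               (\<forall>p::ereal. 0 < p \<longrightarrow>
                  (lemniscate_norm V r p P = r ^ k \<longleftrightarrow> P = V ^ k \<or> P = - (V ^ k))))
          \<and> (\<bar>lead_coeff V\<bar> = 1 \<and> r = 1 \<longrightarrow>
               (\<forall>p::ereal. 0 < p \<longrightarrow>
                  (lemniscate_norm V r p P = r ^ k \<longleftrightarrow>
                     (\<exists>j\<in>{1..k}. P = V ^ j \<or> P = - (V ^ j)) \<or> P = 1 \<or> P = - 1))))"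
proof -
  interpret irreducible_lemniscate V r using assms(1-3) by unfold_locales
  note ra = assms(4)[folded a_def]
  note norm = extremal_functional_norm[OF ra]
  interpret mahler: extremal_functional V r "lemniscate_mahler V r" by (rule extremal_functional_mahler[OF ra])
  have case1: "(\<exists>p. 0 < p \<and> lemniscate_norm V r p P = r ^ k) \<or> lemniscate_mahler V r P = r ^ k
      \<longleftrightarrow> P = V ^ k \<or> P = - (V ^ k)" if "P \<noteq> 0" "degree P \<le> k * degree V" "r < 1 / a" for P
  proof
    assume "(\<exists>p. 0 < p \<and> lemniscate_norm V r p P = r ^ k) \<or> lemniscate_mahler V r P = r ^ k"
    then show "P = V ^ k \<or> P = - (V ^ k)"
    proof
      assume "\<exists>p. 0 < p \<and> lemniscate_norm V r p P = r ^ k"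
      then obtain p where p: "0 < p" "lemniscate_norm V r p P = r ^ k" by (elim exE conjE)
      show ?thesis by (rule extremal_functional.eq_interior[OF norm[OF p(1)] that(1,2) p(2) that(3)])
    next
      assume "lemniscate_mahler V r P = r ^ k"
      then show ?thesis by (rule mahler.eq_interior[OF that(1,2) _ that(3)])
    qed
  next
    assume "P = V ^ k \<or> P = - (V ^ k)"
    then show "(\<exists>p. 0 < p \<and> lemniscate_norm V r p P = r ^ k) \<or> lemniscate_mahler V r P = r ^ k"
      using mahler.V_power[of k] mahler.uminus_V_power[of k] by (intro disjI2) (elim disjE, simp_all)
  qed
  have boundary: thesis
    if "P \<noteq> 0" "degree P \<le> k * degree V" "r = 1 / a" "0 < p" "lemniscate_norm V r p P = r ^ k"
      "\<And>l. l \<le> k \<Longrightarrow> P = V ^ l \<or> P = - (V ^ l) \<Longrightarrow> r ^ l = r ^ k \<Longrightarrow> thesis" for P p thesis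
    by (rule extremal_functional.eq_boundary[OF norm[OF that(4)] that(1,2,5,3)])
       (use lemniscate_norm_le_imp_constant[OF that(4)] that(6) in blast)+
  note norm_power = extremal_functional.V_power[OF norm] extremal_functional.uminus_V_power[OF norm]
  have case2: "lemniscate_norm V r p P = r ^ k \<longleftrightarrow> P = V ^ k \<or> P = - (V ^ k)"
    if P: "P \<noteq> 0" "degree P \<le> k * degree V" "r = 1 / a" "r < 1" "0 < p" for P p
  proof
    assume "lemniscate_norm V r p P = r ^ k"
    then obtain l where l: "l \<le> k" "P = V ^ l \<or> P = - (V ^ l)" "r ^ l = r ^ k"
      by (rule boundary[OF P(1-3,5)])
    have "l = k"
    proof (rule ccontr)
      assume "l \<noteq> k"
      then have "r ^ k < r ^ l" using l(1) P(4) assms(3) by (intro power_strict_decreasing) auto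
      with l(3) show False by simp
    qed
    then show "P = V ^ k \<or> P = - (V ^ k)" using l(2) by simp
  next
    assume "P = V ^ k \<or> P = - (V ^ k)"
    then show "lemniscate_norm V r p P = r ^ k" using norm_power[OF P(5), of k] by auto
  qed
  have case3: "lemniscate_norm V r p P = r ^ k \<longleftrightarrow>
      (\<exists>j\<in>{1..k}. P = V ^ j \<or> P = - (V ^ j)) \<or> P = 1 \<or> P = - 1"
    if P: "P \<noteq> 0" "degree P \<le> k * degree V" "r = 1 / a" "r = 1" "0 < p" for P p
  proof
    assume "lemniscate_norm V r p P = r ^ k"
    then obtain l where l: "l \<le> k" "P = V ^ l \<or> P = - (V ^ l)"
      by (rule boundary[OF P(1-3,5)])
    then show "(\<exists>j\<in>{1..k}. P = V ^ j \<or> P = - (V ^ j)) \<or> P = 1 \<or> P = - 1"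
      by (cases "l = 0") auto
  next
    assume "(\<exists>j\<in>{1..k}. P = V ^ j \<or> P = - (V ^ j)) \<or> P = 1 \<or> P = - 1"
    \<comment> \<open>\<open>P = 1\<close> and \<open>P = - 1\<close> are covered by
      \<open>j = 0\<close>.\<close>
    then obtain j where "P = V ^ j \<or> P = - (V ^ j)" by (metis power_0)
    then show "lemniscate_norm V r p P = r ^ k" using norm_power[OF P(5), of j] P(4) by auto
  qed
  have a1: "r = 1 / a" if "\<bar>lead_coeff V\<bar> = 1 \<and> r = 1"
  proof -
    have "a = real_of_int \<bar>lead_coeff V\<bar>" by (simp add: a_def)
    then show ?thesis using that by simp
  qed
  show ?thesis
    unfolding a_def[symmetric]
  proof (intro conjI allI impI)
    show "Inf {lemniscate_norm V r p P | P. P \<noteq> 0 \<and> degree P \<le> k * degree V} = r ^ k" if "0 < p" for p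
      by (rule extremal_functional.Inf_eq[OF norm[OF that]])
    show "Inf {lemniscate_mahler V r P | P. P \<noteq> 0 \<and> degree P \<le> k * degree V} = r ^ k"
      by (rule mahler.Inf_eq)
    fix P :: "int poly"
    assume "P \<noteq> 0 \<and> degree P \<le> k * degree V"
    then have P: "P \<noteq> 0" "degree P \<le> k * degree V" by (rule conjunct1, rule conjunct2)
    show "(\<exists>p. 0 < p \<and> lemniscate_norm V r p P = r ^ k) \<or> lemniscate_mahler V r P = r ^ k
      \<longleftrightarrow> P = V ^ k \<or> P = - (V ^ k)" if "r < 1 / a"
      by (rule case1[OF P that])
    show "lemniscate_norm V r p P = r ^ k \<longleftrightarrow> P = V ^ k \<or> P = - (V ^ k)"
      if "r = 1 / a \<and> r < 1" "0 < p" for p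
      by (rule case2[OF P conjunct1[OF that(1)] conjunct2[OF that(1)] that(2)])
    show "lemniscate_norm V r p P = r ^ k \<longleftrightarrow>
        (\<exists>j\<in>{1..k}. P = V ^ j \<or> P = - (V ^ j)) \<or> P = 1 \<or> P = - 1"
      if "\<bar>lead_coeff V\<bar> = 1 \<and> r = 1" "0 < p" for p
      by (rule case3[OF P a1[OF that(1)] conjunct2[OF that(1)] that(2)])
  qed
qed

end
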